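(* Let $H$ be a finite-dimensional non-semisimple Hopf algebra of finite representation type over an algebraically closed field $\mathbf{k}$, with Green ring $R=r(H)$, and assume $\mathcal{P}_+=\mathcal{P}_-=I_{\operatorname{max}}$. If $x,y\in R_{\geq 0}$, then $\gamma_{\operatorname{max}}(x)=\operatorname{FPdim}_{R_{\mathbb{C},\operatorname{max}}}(\overline{x})$, where $\overline{x}$ is the image of $x$ in $R_{\operatorname{max}}=R/I_{\operatorname{max}}$. This implies $$\gamma_{\operatorname{max}}(xy)=\gamma_{\operatorname{max}}(x)\gamma_{\operatorname{max}}(y),\qquad \gamma_{\operatorname{max}}(x+y)=\gamma_{\operatorname{max}}(x)+\gamma_{\operatorname{max}}(y).$$
   Context: All modules are finite-dimensional left $H$-modules. Finite representation type means finitely many isomorphism classes of indecomposable modules. The Green ring $R=r(H)$ is the abelian group generated by isomorphism classes $[V]$ of modules with relations $[U\oplus V]=[U]+[V]$ and product $[U][V]=[U\otimes V]$; it has $\mathbb{Z}$-basis $\{x_i\}_{i\in\mathfrak{I}}$, the isomorphism classes of indecomposable modules, with $\mathbf{1}=[\mathbf{k}]$ the class of the trivial module. $[x:x_i]$ is the coefficient of $x_i$ in $x$, and $R_{\geq 0}$ is the set of elements with all coefficients non-negative. The duality operator $*$ is the additive map with $[V]^*=[V^*]$, $V^*=\operatorname{Hom}_{\mathbf{k}}(V,\mathbf{k})$ with $(hf)(v)=f(S(h)v)$, $S$ the antipode. $\mathcal{P}_+:=\mathbb{Z}\{x_i\mid [x_ix_i^*:\mathbf{1}]=0\}$ and $\mathcal{P}_-:=\mathbb{Z}\{x_i\mid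 [x_i^*x_i:\mathbf{1}]=0\}$. A representation ideal is a two-sided ideal $I_{\mathfrak{X}}$ that is the $\mathbb{Z}$-span of $\{x_i\}_{i\in\mathfrak{X}}$ for some proper subset $\mathfrak{X}\subsetneq\mathfrak{I}$ and is closed under $*$; $I_{\operatorname{max}}=I_{\mathfrak{X}_{\operatorname{max}}}$ is the maximal (largest) one. For $x=\sum_i a_ix_i\in R_{\geq0}$ put $\operatorname{core}_{\operatorname{max}}(x)=\sum_{i\in\mathfrak{I}\setminus\mathfrak{X}_{\operatorname{max}}}a_ix_i$, extend $\dim_{\mathbf{k}}$ linearly to $R$, and define $\gamma_{\operatorname{max}}(x)=\limsup_{n\to\infty}\sqrt[n]{\dim_{\mathbf{k}}\operatorname{core}_{\operatorname{max}}(x^n)}$. $R_{\operatorname{max}}=R/I_{\operatorname{max}}$ has basis $\{\overline{x_i}\}_{i\in\mathfrak{I}\setminus\mathfrak{X}_{\operatorname{max}}}$, and $R_{\mathbb{C},\operatorname{max}}=\mathbb{C}\otimes_{\mathbb{Z}}R_{\operatorname{max}}$. The Frobenius–Perron dimension of a basis element $\overline{x_i}$ is the maximal non-negative eigenvalue of the matrix of left multiplication by $\overline{x_i}$ in this basis; $\operatorname{FPdim}_{R_{\mathbb{C},\operatorname{max}}}:R_{\mathbb{C},\operatorname{max}}\to\mathbb{C}$ is the $\mathbb{C}$-linear extension from the basis. *)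

theory Defs
  imports
    Complex_Main
    "HOL-Library.Extended_Real"
    "HOL-Library.Liminf_Limsup"
    "HOL-Library.Poly_Mapping"
    "HOL-Computational_Algebra.Polynomial"
    "HOL-Algebra.QuotRing"
    "HOL-Algebra.Generated_Groups"
    "HOL-Algebra.Free_Abelian_Groups"
    "Jordan_Normal_Form.Char_Poly"
begin

section \<open>Hopf algebras\<close>

text \<open>
  The algebra is the type \<open>'h::ring_1\<close> together with a scalar multiplication. The
  comultiplication is given in Sweedler form: the list \<open>[(a\<^sub>1,b\<^sub>1),\<dots>,(a\<^sub>n,b\<^sub>n)]\<close> stands for the
  tensor \<open>a\<^sub>1 \<otimes> b\<^sub>1 + \<dots> + a\<^sub>n \<otimes> b\<^sub>n\<close>, so \<open>comult H h\<close> is a chosen representative of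
  \<open>\<Delta>(h)\<close> and all axioms on it are stated as equalities in the tensor product.
\<close>

record ('k, 'h) hopf =
  hscale :: "'k \<Rightarrow> 'h \<Rightarrow> 'h"
  comult :: "'h \<Rightarrow> ('h \<times> 'h) list"
  counit :: "'h \<Rightarrow> 'k"
  antipode :: "'h \<Rightarrow> 'h"

text \<open>
  \<open>A \<otimes>\<^sub>k A\<close> and \<open>A \<otimes>\<^sub>k A \<otimes>\<^sub>k A\<close> are the free abelian groups on pairs and triples modulo the
  subgroups generated by the (multi)linearity relations.
\<close>

definition tensor2_null :: "('k \<Rightarrow> 'h \<Rightarrow> 'h::ab_group_add) \<Rightarrow> (('h \<times> 'h) \<Rightarrow>\<^sub>0 int) set" where
  "tensor2_null s = generate (free_Abelian_group UNIV)
     ({frag_of (a + a', b) - frag_of (a, b) - frag_of (a', b) | a a' b. True} \<union>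
      {frag_of (a, b + b') - frag_of (a, b) - frag_of (a, b') | a b b'. True} \<union>
      {frag_of (s c a, b) - frag_of (a, s c b) | c a b. True})"

definition tensor3_null ::
  "('k \<Rightarrow> 'h \<Rightarrow> 'h::ab_group_add) \<Rightarrow> (('h \<times> 'h \<times> 'h) \<Rightarrow>\<^sub>0 int) set" where
  "tensor3_null s = generate (free_Abelian_group UNIV)
     ({frag_of (a + a', b, d) - frag_of (a, b, d) - frag_of (a', b, d) | a a' b d. True} \<union>
      {frag_of (a, b + b', d) - frag_of (a, b, d) - frag_of (a, b', d) | a b b' d. True} \<union>
      {frag_of (a, b, d + d') - frag_of (a, b, d) - frag_of (a, b, d') | a b d d'. True} \<union>
      {frag_of (s c a, b, d) - frag_of (a, s c b, d) | c a b d. True} \<union>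
      {frag_of (a, s c b, d) - frag_of (a, b, s c d) | c a b d. True})"

definition formal_sum :: "'a list \<Rightarrow> ('a \<Rightarrow>\<^sub>0 int)" where
  "formal_sum xs = sum_list (map frag_of xs)"

definition tensor2_eq ::
  "('k \<Rightarrow> 'h \<Rightarrow> 'h::ab_group_add) \<Rightarrow> ('h \<times> 'h) list \<Rightarrow> ('h \<times> 'h) list \<Rightarrow> bool" where
  "tensor2_eq s xs ys \<longleftrightarrow> formal_sum xs - formal_sum ys \<in> tensor2_null s"

definition tensor3_eq ::
  "('k \<Rightarrow> 'h \<Rightarrow> 'h::ab_group_add) \<Rightarrow> ('h \<times> 'h \<times> 'h) list \<Rightarrow> ('h \<times> 'h \<times> 'h) list \<Rightarrow> bool" where
  "tensor3_eq s xs ys \<longleftrightarrow> formal_sum xs - formal_sum ys \<in> tensor3_null s"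

locale hopf_algebra = vector_space "hscale H"
  for H :: "('k::field, 'h::ring_1) hopf" (structure) +
  assumes scale_mult_left: "hscale H c x * y = hscale H c (x * y)"
    and scale_mult_right: "x * hscale H c y = hscale H c (x * y)"
    and comult_add: "tensor2_eq (hscale H) (comult H (x + y)) (comult H x @ comult H y)"
    and comult_scale: "tensor2_eq (hscale H) (comult H (hscale H c x))
          [(hscale H c a, b). (a, b) \<leftarrow> comult H x]"
    and comult_mult: "tensor2_eq (hscale H) (comult H (x * y))
          [(a * a', b * b'). (a, b) \<leftarrow> comult H x, (a', b') \<leftarrow> comult H y]"
    and comult_one: "tensor2_eq (hscale H) (comult H 1) [(1, 1)]"
    and coassoc: "tensor3_eq (hscale H)
          [(a', a'', b). (a, b) \<leftarrow> comult H x, (a', a'') \<leftarrow> comult H a]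
          [(a, b', b''). (a, b) \<leftarrow> comult H x, (b', b'') \<leftarrow> comult H b]"
    and counit_linear: "Vector_Spaces.linear (hscale H) (*) (counit H)"
    and counit_mult: "counit H (x * y) = counit H x * counit H y"
    and counit_one: "counit H 1 = 1"
    and counit_left: "(\<Sum>(a, b)\<leftarrow>comult H x. hscale H (counit H a) b) = x"
    and counit_right: "(\<Sum>(a, b)\<leftarrow>comult H x. hscale H (counit H b) a) = x"
    and antipode_linear: "Vector_Spaces.linear (hscale H) (hscale H) (antipode H)"
    and antipode_left: "(\<Sum>(a, b)\<leftarrow>comult H x. antipode H a * b) = hscale H (counit H x) 1"
    and antipode_right: "(\<Sum>(a, b)\<leftarrow>comult H x. a * antipode H b) = hscale H (counit H x) 1"

definition finite_dim_algebra :: "('k::field, 'h::ring_1) hopf \<Rightarrow> bool" where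
  "finite_dim_algebra H \<longleftrightarrow> (\<exists>B. finite B \<and> module.span (hscale H) B = UNIV)"

definition left_ideal :: "('k::field, 'h::ring_1) hopf \<Rightarrow> 'h set \<Rightarrow> bool" where
  "left_ideal H L \<longleftrightarrow> module.subspace (hscale H) L \<and> (\<forall>h. \<forall>x\<in>L. h * x \<in> L)"

text \<open>The left regular module is semisimple: every submodule has a complement.\<close>

definition semisimple_algebra :: "('k::field, 'h::ring_1) hopf \<Rightarrow> bool" where
  "semisimple_algebra H \<longleftrightarrow>
     (\<forall>L. left_ideal H L \<longrightarrow>
        (\<exists>M. left_ideal H M \<and> L \<inter> M = {0} \<and> {x + y | x y. x \<in> L \<and> y \<in> M} = UNIV))"


section \<open>Finite-dimensional modules\<close>

text \<open>
  A finite-dimensional left module is given on \<open>k\<^sup>n\<close>: a pair of the dimension \<open>n\<close> and of the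
  action, which sends an element of the algebra to an \<open>n \<times> n\<close> matrix acting on column vectors.
  Every finite-dimensional module is isomorphic to one of these, and they form a set.
\<close>

type_synonym ('k, 'h) fdmod = "nat \<times> ('h \<Rightarrow> 'k mat)"

definition fdmods :: "('k::field, 'h::ring_1) hopf \<Rightarrow> ('k, 'h) fdmod set" where
  "fdmods H = {(n, \<rho>).
     (\<forall>h. \<rho> h \<in> carrier_mat n n) \<and>
     (\<forall>g h. \<rho> (g + h) = \<rho> g + \<rho> h) \<and>
     (\<forall>c h. \<rho> (hscale H c h) = c \<cdot>\<^sub>m \<rho> h) \<and>
     \<rho> 1 = 1\<^sub>m n \<and>
     (\<forall>g h. \<rho> (g * h) = \<rho> g * \<rho> h)}"

definition mod_iso :: "('k::field, 'h) fdmod \<Rightarrow> ('k, 'h) fdmod \<Rightarrow> bool" where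
  "mod_iso V W \<longleftrightarrow> fst V = fst W \<and>
     (\<exists>P \<in> carrier_mat (fst V) (fst V). invertible_mat P \<and> (\<forall>h. P * snd V h = snd W h * P))"

definition mod_dsum :: "('k::field, 'h) fdmod \<Rightarrow> ('k, 'h) fdmod \<Rightarrow> ('k, 'h) fdmod" where
  "mod_dsum V W = (fst V + fst W,
     \<lambda>h. four_block_mat (snd V h) (0\<^sub>m (fst V) (fst W)) (0\<^sub>m (fst W) (fst V)) (snd W h))"

text \<open>
  The Kronecker product is the matrix of \<open>A \<otimes> B\<close> in the basis \<open>e\<^sub>i \<otimes> f\<^sub>j\<close>, ordered
  lexicographically; \<open>h\<close> acts on \<open>U \<otimes> V\<close> through \<open>\<Delta>(h)\<close>.
\<close>

definition kron :: "'k::semiring_0 mat \<Rightarrow> 'k mat \<Rightarrow> 'k mat" where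
  "kron A B = mat (dim_row A * dim_row B) (dim_col A * dim_col B)
     (\<lambda>(i, j). A $$ (i div dim_row B, j div dim_col B) * B $$ (i mod dim_row B, j mod dim_col B))"

definition mod_tensor ::
  "('k::field, 'h::ring_1) hopf \<Rightarrow> ('k, 'h) fdmod \<Rightarrow> ('k, 'h) fdmod \<Rightarrow> ('k, 'h) fdmod" where
  "mod_tensor H V W = (fst V * fst W,
     \<lambda>h. mat (fst V * fst W) (fst V * fst W)
       (\<lambda>ij. \<Sum>(a, b)\<leftarrow>comult H h. kron (snd V a) (snd W b) $$ ij))"

definition mod_triv :: "('k::field, 'h::ring_1) hopf \<Rightarrow> ('k, 'h) fdmod" where
  "mod_triv H = (1, \<lambda>h. mat 1 1 (\<lambda>_. counit H h))"

text \<open>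
  \<open>Hom(V, k)\<close> with \<open>(h f)(v) = f(S(h) v)\<close>: in the dual basis \<open>h\<close> acts by the transpose of the
  matrix of \<open>S(h)\<close>.
\<close>

definition mod_dual :: "('k::field, 'h::ring_1) hopf \<Rightarrow> ('k, 'h) fdmod \<Rightarrow> ('k, 'h) fdmod" where
  "mod_dual H V = (fst V, \<lambda>h. transpose_mat (snd V (antipode H h)))"

definition indecomposables :: "('k::field, 'h::ring_1) hopf \<Rightarrow> ('k, 'h) fdmod set" where
  "indecomposables H = {V \<in> fdmods H. fst V \<noteq> 0 \<and>
     (\<forall>U\<in>fdmods H. \<forall>W\<in>fdmods H. mod_iso V (mod_dsum U W) \<longrightarrow> fst U = 0 \<or> fst W = 0)}"

definition finite_rep_type :: "('k::field, 'h::ring_1) hopf \<Rightarrow> bool" where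
  "finite_rep_type H \<longleftrightarrow>
     finite (indecomposables H // {(V, W). V \<in> indecomposables H \<and> W \<in> indecomposables H \<and> mod_iso V W})"


section \<open>The Green ring\<close>

text \<open>
  The Green ring is the free abelian group on all modules, with the tensor product extended
  bilinearly as multiplication, modulo the relations \<open>[V] = [W]\<close> for \<open>V \<cong> W\<close> and
  \<open>[U \<oplus> V] = [U] + [V]\<close>. Its elements are cosets of \<open>green_rels H\<close>.
\<close>

definition free_mod_ring ::
  "('k::field, 'h::ring_1) hopf \<Rightarrow> (('k, 'h) fdmod \<Rightarrow>\<^sub>0 int) ring" where
  "free_mod_ring H =
     \<lparr>carrier = carrier (free_Abelian_group (fdmods H)),
      monoid.mult = (\<lambda>x y. frag_extend (\<lambda>V. frag_extend (\<lambda>W. frag_of (mod_tensor H V W)) y) x),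
      one = frag_of (mod_triv H),
      ring.zero = 0,
      ring.add = (+)\<rparr>"

definition green_rels ::
  "('k::field, 'h::ring_1) hopf \<Rightarrow> (('k, 'h) fdmod \<Rightarrow>\<^sub>0 int) set" where
  "green_rels H = generate (free_Abelian_group (fdmods H))
     ({frag_of V - frag_of W | V W. V \<in> fdmods H \<and> W \<in> fdmods H \<and> mod_iso V W} \<union>
      {frag_of (mod_dsum V W) - frag_of V - frag_of W | V W. V \<in> fdmods H \<and> W \<in> fdmods H})"

type_synonym ('k, 'h) green = "(('k, 'h) fdmod \<Rightarrow>\<^sub>0 int) set"

definition green_ring :: "('k::field, 'h::ring_1) hopf \<Rightarrow> ('k, 'h) green ring" where
  "green_ring H = free_mod_ring H Quot green_rels H"

definition green_class ::
  "('k::field, 'h::ring_1) hopf \<Rightarrow> ('k, 'h) fdmod \<Rightarrow> ('k, 'h) green" where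
  "green_class H V = green_rels H +>\<^bsub>free_mod_ring H\<^esub> frag_of V"

text \<open>
  The duality operator and the dimension are the additive extensions of \<open>[V] \<mapsto> [V\<^sup>*]\<close> and
  \<open>[V] \<mapsto> dim V\<close>. They are constant on the representatives of a coset, so that the union below is
  a single coset and \<open>the_elem\<close> is applied to a singleton.
\<close>

definition green_dual ::
  "('k::field, 'h::ring_1) hopf \<Rightarrow> ('k, 'h) green \<Rightarrow> ('k, 'h) green" where
  "green_dual H x =
     (\<Union>c\<in>x. green_rels H +>\<^bsub>free_mod_ring H\<^esub> frag_extend (\<lambda>V. frag_of (mod_dual H V)) c)"

definition green_dim :: "('k, 'h) green \<Rightarrow> int" where
  "green_dim x =
     the_elem ((\<lambda>c. \<Sum>V\<in>Poly_Mapping.keys c. Poly_Mapping.lookup c V * int (fst V)) ` x)"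


section \<open>Coordinates, representation ideals and growth\<close>

definition zlincomb :: "('a, 'm) ring_scheme \<Rightarrow> ('a \<Rightarrow>\<^sub>0 int) \<Rightarrow> 'a" where
  "zlincomb R c = (\<Oplus>\<^bsub>R\<^esub>b\<in>Poly_Mapping.keys c. [Poly_Mapping.lookup c b] \<cdot>\<^bsub>R\<^esub> b)"

definition zspan :: "('a, 'm) ring_scheme \<Rightarrow> 'a set \<Rightarrow> 'a set" where
  "zspan R B = zlincomb R ` {c. Poly_Mapping.keys c \<subseteq> B}"

text \<open>The coordinates of \<open>x\<close> with respect to a \<open>\<int>\<close>-basis \<open>B\<close> of the additive group of \<open>R\<close>.\<close>

definition zcoords :: "('a, 'm) ring_scheme \<Rightarrow> 'a set \<Rightarrow> 'a \<Rightarrow> ('a \<Rightarrow>\<^sub>0 int)" where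
  "zcoords R B x = (THE c. Poly_Mapping.keys c \<subseteq> B \<and> zlincomb R c = x)"

text \<open>
  The \<open>\<int>\<close>-basis of the classes of indecomposables. An index \<open>i\<close> is identified with the basis
  element \<open>x\<^sub>i\<close>, so the sets of indices are the subsets of \<open>indec_basis H\<close>.
\<close>

definition indec_basis :: "('k::field, 'h::ring_1) hopf \<Rightarrow> ('k, 'h) green set" where
  "indec_basis H = green_class H ` indecomposables H"

definition green_coeff ::
  "('k::field, 'h::ring_1) hopf \<Rightarrow> ('k, 'h) green \<Rightarrow> ('k, 'h) green \<Rightarrow> int" where
  "green_coeff H x b = Poly_Mapping.lookup (zcoords (green_ring H) (indec_basis H) x) b"

definition green_nonneg :: "('k::field, 'h::ring_1) hopf \<Rightarrow> ('k, 'h) green set" where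
  "green_nonneg H = {x \<in> carrier (green_ring H). \<forall>b\<in>indec_basis H. 0 \<le> green_coeff H x b}"

definition P_plus :: "('k::field, 'h::ring_1) hopf \<Rightarrow> ('k, 'h) green set" where
  "P_plus H = zspan (green_ring H) {b \<in> indec_basis H.
     green_coeff H (b \<otimes>\<^bsub>green_ring H\<^esub> green_dual H b) \<one>\<^bsub>green_ring H\<^esub> = 0}"

definition P_minus :: "('k::field, 'h::ring_1) hopf \<Rightarrow> ('k, 'h) green set" where
  "P_minus H = zspan (green_ring H) {b \<in> indec_basis H.
     green_coeff H (green_dual H b \<otimes>\<^bsub>green_ring H\<^esub> b) \<one>\<^bsub>green_ring H\<^esub> = 0}"

definition spans_rep_ideal ::
  "('k::field, 'h::ring_1) hopf \<Rightarrow> ('k, 'h) green set \<Rightarrow> bool" where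
  "spans_rep_ideal H X \<longleftrightarrow>
     X \<subset> indec_basis H \<and> ideal (zspan (green_ring H) X) (green_ring H) \<and>
     (\<forall>x \<in> zspan (green_ring H) X. green_dual H x \<in> zspan (green_ring H) X)"

text \<open>
  The largest representation ideal exists: no representation ideal contains \<open>\<one>\<close>, hence the sum of
  all of them is again proper.
\<close>

definition X_max :: "('k::field, 'h::ring_1) hopf \<Rightarrow> ('k, 'h) green set" where
  "X_max H = (GREATEST X. spans_rep_ideal H X)"

definition I_max :: "('k::field, 'h::ring_1) hopf \<Rightarrow> ('k, 'h) green set" where
  "I_max H = zspan (green_ring H) (X_max H)"

definition core_max ::
  "('k::field, 'h::ring_1) hopf \<Rightarrow> ('k, 'h) green \<Rightarrow> ('k, 'h) green" where
  "core_max H x =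
     (\<Oplus>\<^bsub>green_ring H\<^esub>b\<in>{b \<in> indec_basis H - X_max H. green_coeff H x b \<noteq> 0}.
        [green_coeff H x b] \<cdot>\<^bsub>green_ring H\<^esub> b)"

definition gamma_max ::
  "('k::field, 'h::ring_1) hopf \<Rightarrow> ('k, 'h) green \<Rightarrow> ereal" where
  "gamma_max H x = limsup (\<lambda>n::nat.
     ereal (root n (real_of_int (green_dim (core_max H (x [^]\<^bsub>green_ring H\<^esub> n))))))"


section \<open>The quotient by the largest representation ideal\<close>

definition R_max :: "('k::field, 'h::ring_1) hopf \<Rightarrow> ('k, 'h) green set ring" where
  "R_max H = green_ring H Quot I_max H"

definition to_R_max ::
  "('k::field, 'h::ring_1) hopf \<Rightarrow> ('k, 'h) green \<Rightarrow> ('k, 'h) green set" where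
  "to_R_max H x = I_max H +>\<^bsub>green_ring H\<^esub> x"

definition R_max_basis :: "('k::field, 'h::ring_1) hopf \<Rightarrow> ('k, 'h) green set set" where
  "R_max_basis H = to_R_max H ` (indec_basis H - X_max H)"

text \<open>
  The matrix of left multiplication by \<open>b\<close> in the basis enumerated by \<open>bs\<close>: the entry \<open>(i, j)\<close>
  is the coefficient of the \<open>i\<close>-th basis element in \<open>b\<close> times the \<open>j\<close>-th one.
\<close>

definition left_mult_mat ::
  "('a, 'm) ring_scheme \<Rightarrow> 'a list \<Rightarrow> 'a \<Rightarrow> complex mat" where
  "left_mult_mat R bs b = mat (length bs) (length bs)
     (\<lambda>(i, j). of_int (Poly_Mapping.lookup (zcoords R (set bs) (b \<otimes>\<^bsub>R\<^esub> bs ! j)) (bs ! i)))"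

definition R_max_basis_list :: "('k::field, 'h::ring_1) hopf \<Rightarrow> ('k, 'h) green set list" where
  "R_max_basis_list H = (SOME bs. distinct bs \<and> set bs = R_max_basis H)"

definition FPdim_basis ::
  "('k::field, 'h::ring_1) hopf \<Rightarrow> ('k, 'h) green set \<Rightarrow> real" where
  "FPdim_basis H b =
     Max {t::real. 0 \<le> t \<and> eigenvalue (left_mult_mat (R_max H) (R_max_basis_list H) b) (complex_of_real t)}"

text \<open>
  \<open>\<complex> \<otimes>\<^sub>\<int> R_max\<close> is the complex vector space with basis \<open>1 \<otimes> b\<close> for \<open>b\<close> in \<open>R_max_basis\<close>; its
  elements are given by their coordinates, and \<open>to_RC_max\<close> is \<open>r \<mapsto> 1 \<otimes> r\<close>.
\<close>

definition to_RC_max ::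
  "('k::field, 'h::ring_1) hopf \<Rightarrow> ('k, 'h) green set \<Rightarrow> (('k, 'h) green set \<Rightarrow>\<^sub>0 complex)" where
  "to_RC_max H r = Poly_Mapping.map complex_of_int (zcoords (R_max H) (R_max_basis H) r)"

definition FPdim_RC_max ::
  "('k::field, 'h::ring_1) hopf \<Rightarrow> (('k, 'h) green set \<Rightarrow>\<^sub>0 complex) \<Rightarrow> complex" where
  "FPdim_RC_max H v = (\<Sum>b\<in>Poly_Mapping.keys v. Poly_Mapping.lookup v b * complex_of_real (FPdim_basis H b))"

end

theory Submission
  imports Defs "HOL-Analysis.Function_Topology"
begin

text \<open>
  By the Krull--Schmidt theorem the classes of the indecomposable modules form a \<open>\<int>\<close>-basis of the
  Green ring, so that coefficients make sense. For \<open>i \<notin> X_max\<close> the unit occurs in \<open>x\<^sub>i x\<^sub>i\<^sup>*\<close>, and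
  this makes \<open>R_max\<close> a transitive based ring. The Perron--Frobenius eigenvector of the right
  multiplication by the sum of its basis is then a character \<open>d\<close> that is positive on the basis.
  As a positive left eigenvector of every left multiplication, \<open>d\<close> gives the Frobenius--Perron
  dimensions, and as \<open>d\<close> and the dimension bound each other up to constants on non-negative
  elements, \<open>dim core(x\<^sup>n)\<close> grows like \<open>d(x)\<^sup>n\<close>.
\<close>

section \<open>Matrix calculus\<close>

text \<open>The obstacle before any growth argument is the existence of coordinates. The coefficient
  of an indecomposable is defined as the number of times it can be split off; this number is well
  defined and additive because endomorphism rings of indecomposables are local, which yields
  exchange and cancellation. Decompositions are recorded by inclusions and projections rather than
  block forms, so that all of this is equational and passes through tensor products and duals.

  Non-negativity of the structure constants is free, as products of modules are modules. Strict
  positivity is what the unit in the product of a basis element with its dual supplies. Simplicity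
  of the eigenvalue matters as much as existence of the eigenvector: left multiplications commute
  with the chosen right multiplication, and a one-dimensional eigenspace forces them to act by
  scalars.

  Coordinates outside \<open>X_max\<close> ignore products with elements of the ideal, so the
  character is built and used on the Green ring itself and is compared with \<open>R_max\<close>
  only at the end.\<close>

text \<open>
  Matrices of all shapes embed into one ring, so that identities between rectangular matrices
  become identities in a noncommutative ring, where \<open>1\<^sub>m n\<close> turns into an idempotent.
\<close>

typedef (overloaded) ('k::ab_group_add) addop =
  "{f :: (nat \<Rightarrow> 'k) \<Rightarrow> nat \<Rightarrow> 'k. \<forall>u v. f (\<lambda>i. u i + v i) = (\<lambda>i. f u i + f v i)}"
  by (rule exI[of _ id]) auto

setup_lifting type_definition_addop

instantiation addop :: (ab_group_add) ring
begin
lift_definition zero_addop :: "'a addop" is "\<lambda>v i. 0" by simp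
lift_definition plus_addop :: "'a addop \<Rightarrow> 'a addop \<Rightarrow> 'a addop" is "\<lambda>f g v i. f v i + g v i"
  by (auto simp: fun_eq_iff algebra_simps)
lift_definition minus_addop :: "'a addop \<Rightarrow> 'a addop \<Rightarrow> 'a addop" is "\<lambda>f g v i. f v i - g v i"
  by (auto simp: fun_eq_iff algebra_simps)
lift_definition uminus_addop :: "'a addop \<Rightarrow> 'a addop" is "\<lambda>f v i. - f v i"
  by (auto simp: fun_eq_iff algebra_simps)
lift_definition times_addop :: "'a addop \<Rightarrow> 'a addop \<Rightarrow> 'a addop" is "\<lambda>f g v. f (g v)"
  by simp
instance
proof
  fix a b c :: "'a addop"
  show "a + b + c = a + (b + c)" "a + b = b + a" "0 + a = a" "- a + a = 0" "a - b = a + - b" "(a + b) * c = a * c + b * c"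
    by (transfer; simp add: algebra_simps)+
  show "a * b * c = a * (b * c)"
    by transfer simp
  show "a * (b + c) = a * b + a * c"
    by transfer (simp add: fun_eq_iff)
qed
end

text \<open>The operator reads the first \<open>dim_col A\<close> entries of a sequence and pads its
  result with zeros, so matrices of matching shapes multiply by composition although the ring does
  not see shapes.\<close>

lift_definition mat_op :: "'k::ring_1 mat \<Rightarrow> 'k addop" is
  "\<lambda>A v i. if i < dim_row A then \<Sum>j<dim_col A. A $$ (i, j) * v j else 0"
  by (auto simp: fun_eq_iff distrib_left sum.distrib)

lemma mat_op_add: "dim_row A = dim_row B \<Longrightarrow> dim_col A = dim_col B \<Longrightarrow> mat_op (A + B) = mat_op A + mat_op B"
  by transfer (auto simp: fun_eq_iff distrib_right sum.distrib)

lemma mat_op_diff: "dim_row A = dim_row B \<Longrightarrow> dim_col A = dim_col B \<Longrightarrow> mat_op (A - B) = mat_op A - mat_op B"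
  by transfer (auto simp: fun_eq_iff left_diff_distrib sum_subtractf)

lemma mat_op_zero: "mat_op (0\<^sub>m m n) = 0"
  by transfer (auto simp: fun_eq_iff)

lemma mat_op_mult: "dim_col A = dim_row B \<Longrightarrow> mat_op (A * B) = mat_op A * mat_op B"
proof (transfer, intro ext)
  fix A B :: "'a mat" and v i
  assume d: "dim_col A = dim_row B"
  have "(\<Sum>k<dim_col B. (\<Sum>j<dim_row B. A $$ (i, j) * B $$ (j, k)) * v k) =
      (\<Sum>j<dim_row B. A $$ (i, j) * (\<Sum>k<dim_col B. B $$ (j, k) * v k))"
    unfolding sum_distrib_left sum_distrib_right mult.assoc by (rule sum.swap)
  then show "(if i < dim_row (A * B) then \<Sum>j<dim_col (A * B). (A * B) $$ (i, j) * v j else 0) =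
    (if i < dim_row A then \<Sum>j<dim_col A. A $$ (i, j) *
      (if j < dim_row B then \<Sum>k<dim_col B. B $$ (j, k) * v k else 0) else 0)"
    by (simp add: scalar_prod_def atLeast0LessThan d)
qed

lemma mat_op_one_left: "dim_row A = n \<Longrightarrow> mat_op (1\<^sub>m n) * mat_op A = mat_op A"
  by (subst mat_op_mult[symmetric]) (auto intro: arg_cong[of _ _ mat_op])

lemma mat_op_one_right: "dim_col A = n \<Longrightarrow> mat_op A * mat_op (1\<^sub>m n) = mat_op A"
  by (subst mat_op_mult[symmetric]) (auto intro: arg_cong[of _ _ mat_op])

lemma mat_op_one_left': "dim_row A = n \<Longrightarrow> mat_op (1\<^sub>m n) * (mat_op A * x) = mat_op A * x"
  by (metis mat_op_one_left mult.assoc)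

lemma mat_op_one_right': "dim_col A = n \<Longrightarrow> mat_op A * (mat_op (1\<^sub>m n) * x) = mat_op A * x"
  by (metis mat_op_one_right mult.assoc)

text \<open>Shapes are invisible in the operator ring and are therefore assumed equal; entries are
  recovered by applying both operators to unit sequences. As a substitution rule this moves a matrix
  identity into the ring.\<close>

lemma mat_op_inject:
  assumes "dim_row A = dim_row B" "dim_col A = dim_col B"
  shows "A = B \<longleftrightarrow> mat_op A = mat_op B"
proof
  assume "mat_op A = mat_op B"
  then have "Rep_addop (mat_op A) v i = Rep_addop (mat_op B) v i" for v i
    by simp
  then have eq: "(if i < dim_row A then \<Sum>j<dim_col A. A $$ (i, j) * v j else 0) =
      (if i < dim_row B then \<Sum>j<dim_col B. B $$ (i, j) * v j else 0)" for v i
    by (simp add: mat_op.rep_eq)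
  show "A = B"
  proof (rule eq_matI)
    fix i j assume "i < dim_row B" "j < dim_col B"
    then show "A $$ (i, j) = B $$ (i, j)"
      using eq[of i "\<lambda>k. if k = j then 1 else 0"] assms
      by (simp add: if_distrib[of "\<lambda>x. _ * x"] cong: if_cong)
  qed (use assms in auto)
qed simp

lemmas mat_op_simps = mat_op_add mat_op_diff mat_op_zero mat_op_mult mat_op_one_left mat_op_one_right
  mat_op_one_left' mat_op_one_right' mult.assoc

text \<open>Words of operators are associated to the right, where a rule for \<open>a * b\<close>
  matches only at the end of a word. The extended forms let the same relation fire inside a longer
  word.\<close>

lemma mult_extend:
  fixes a b c :: "'a::semigroup_mult"
  shows "a * b = c \<Longrightarrow> a * (b * x) = c * x"
  by (metis mult.assoc)

lemma mult3_extend: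
  fixes a b c :: "'a::semigroup_mult"
  shows "a * (b * c) = d \<Longrightarrow> a * (b * (c * x)) = d * x"
  by (metis mult.assoc)

lemma mat_mult_assoc:
  "dim_col A = dim_row B \<Longrightarrow> dim_col B = dim_row C \<Longrightarrow> (A * B) * C = A * (B * (C::'a::semiring_0 mat))"
  by (rule assoc_mult_mat[of _ "dim_row A" "dim_row B" _ "dim_row C" _ "dim_col C"]) auto

text \<open>If B A = 1 and A had fewer rows than columns, padding A by zero rows and B by zero
  columns would give square matrices with the same product. One-sided inverses of square matrices
  are two-sided, yet the padded A B has a zero on its diagonal.\<close>

lemma rect_inverse_dim:
  fixes A B :: "'k::field mat"
  assumes A: "A \<in> carrier_mat m n" and B: "B \<in> carrier_mat n m"
    and AB: "A * B = 1\<^sub>m m" and BA: "B * A = 1\<^sub>m n"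
  shows "m = n"
proof -
  have *: "n \<le> m" if A: "A \<in> carrier_mat m n" and B: "B \<in> carrier_mat n m"
    and BA: "B * A = 1\<^sub>m n" for m n and A B :: "'k mat"
  proof (rule ccontr)
    assume "\<not> n \<le> m"
    then obtain k where k: "n = m + k" "k > 0"
      using less_imp_add_positive[of m n] by auto
    let ?A = "mat n n (\<lambda>(i, j). if i < m then A $$ (i, j) else 0)"
    let ?B = "mat n n (\<lambda>(i, j). if j < m then B $$ (i, j) else 0)"
    have "?B * ?A = 1\<^sub>m n"
    proof (rule eq_matI)
      fix i j assume ij: "i < dim_row (1\<^sub>m n :: 'k mat)" "j < dim_col (1\<^sub>m n :: 'k mat)"
      then have "(?B * ?A) $$ (i, j) = (\<Sum>l<n. if l < m then B $$ (i, l) * A $$ (l, j) else 0)"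
        by (auto simp: scalar_prod_def atLeast0LessThan intro!: sum.cong)
      also have "\<dots> = (\<Sum>l<m. B $$ (i, l) * A $$ (l, j))"
        unfolding k by (rule sum.mono_neutral_cong_right) auto
      also have "\<dots> = (B * A) $$ (i, j)"
        using ij A B by (auto simp: scalar_prod_def atLeast0LessThan)
      finally show "(?B * ?A) $$ (i, j) = 1\<^sub>m n $$ (i, j)"
        by (simp add: BA)
    qed auto
    then have "?A * ?B = 1\<^sub>m n"
      by (intro mat_mult_left_right_inverse[of ?B n ?A]) auto
    then have "(?A * ?B) $$ (m, m) = 1\<^sub>m n $$ (m, m)"
      by simp
    then show False
      using k by (simp add: scalar_prod_def)
  qed
  show ?thesis
    using *[OF A B BA] *[OF B A AB] by simp
qed

text \<open>Row operations give an invertible P for which P Q has a zero last row. Dropping this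
  row, and the last column of the inverse of P, writes Q as a product through dimension r -
  1.\<close>

lemma singular_mat_factor:
  fixes Q :: "'k::field mat"
  assumes Q: "Q \<in> carrier_mat r r" and det: "det Q = 0"
  obtains s S T where "s < r" "S \<in> carrier_mat r s" "T \<in> carrier_mat s r" "Q = S * T"
proof -
  obtain P where P: "P \<in> Units (ring_mat TYPE('k) r ())" and row: "row (P * Q) (r - 1) = 0\<^sub>v r" and r: "0 < r"
    using det_zero_imp_zero_row[OF Q det, of "()"] by auto
  then obtain P' where P': "P' \<in> carrier_mat r r" "P' * P = 1\<^sub>m r" and Pc: "P \<in> carrier_mat r r"
    by (auto simp: Units_def ring_mat_simps)
  let ?S = "mat r (r - 1) (\<lambda>(i, j). P' $$ (i, j))"
  let ?T = "mat (r - 1) r (\<lambda>(i, j). (P * Q) $$ (i, j))"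
  have r': "{..<r} = insert (r - 1) {..<r - 1}"
    using r by auto
  have last: "(P * Q) $$ (r - 1, j) = 0" if "j < r" for j
    using arg_cong[OF row, of "\<lambda>v. v $ j"] that r Pc Q by auto
  have "Q = (P' * P) * Q"
    using P' Q by simp
  also have "\<dots> = P' * (P * Q)"
    using P' Pc Q by (intro assoc_mult_mat) auto
  also have "\<dots> = ?S * ?T"
  proof (rule eq_matI)
    fix i j assume ij: "i < dim_row (?S * ?T)" "j < dim_col (?S * ?T)"
    then have "(P' * (P * Q)) $$ (i, j) = (\<Sum>l<r. P' $$ (i, l) * (P * Q) $$ (l, j))"
      using P' Pc Q by (simp add: scalar_prod_def atLeast0LessThan)
    also have "\<dots> = (\<Sum>l<r - 1. P' $$ (i, l) * (P * Q) $$ (l, j))"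
      unfolding r' using last[of j] ij by simp
    also have "\<dots> = (?S * ?T) $$ (i, j)"
      using ij P' Pc Q by (simp add: scalar_prod_def atLeast0LessThan)
    finally show "(P' * (P * Q)) $$ (i, j) = (?S * ?T) $$ (i, j)" .
  qed (use P' Pc Q in auto)
  finally show thesis
    using r by (intro that[of "r - 1" ?S ?T]) auto
qed

lemma pow_mat_add: "f \<in> carrier_mat n n \<Longrightarrow> f ^\<^sub>m (i + j) = f ^\<^sub>m i * f ^\<^sub>m (j::nat)"
  for f :: "'a::semiring_1 mat"
proof (induction j)
  case (Suc j)
  then show ?case
    using pow_carrier_mat[of f n i] pow_carrier_mat[of f n j] by (simp add: assoc_mult_mat[of _ n n _ n _ n])
qed auto

text \<open>
  Take a factorization \<open>f\<^sup>i = S T\<close> through the smallest possible space, over all \<open>i \<ge> 1\<close>: then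
  \<open>T S\<close> is invertible, since otherwise \<open>f\<^sup>2\<^sup>i\<close> would factor through a smaller space.
\<close>

lemma power_factor_invertible:
  fixes f :: "'k::field mat"
  assumes f: "f \<in> carrier_mat n n"
  obtains i r S T Q' where "i > 0" "S \<in> carrier_mat n r" "T \<in> carrier_mat r n" "f ^\<^sub>m i = S * T"
    "Q' \<in> carrier_mat r r" "T * S * Q' = 1\<^sub>m r" "Q' * (T * S) = 1\<^sub>m r"
proof -
  define fac where "fac = (\<lambda>r. \<exists>i S T. i > 0 \<and> S \<in> carrier_mat n r \<and> T \<in> carrier_mat r n \<and> f ^\<^sub>m i = S * T)"
  define r where "r = (LEAST r. fac r)"
  have "fac n"
    unfolding fac_def using f by (intro exI[of _ 1] exI[of _ f] exI[of _ "1\<^sub>m n"]) auto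
  then have "fac r"
    unfolding r_def by (rule LeastI)
  then obtain i S T where i: "i > 0" and S: "S \<in> carrier_mat n r" and T: "T \<in> carrier_mat r n" and eq: "f ^\<^sub>m i = S * T"
    unfolding fac_def by blast
  have Q: "T * S \<in> carrier_mat r r"
    using S T by auto
  have "det (T * S) \<noteq> 0"
  proof
    assume "det (T * S) = 0"
    then obtain s A B where s: "s < r" and A: "A \<in> carrier_mat r s" and B: "B \<in> carrier_mat s r" and AB: "T * S = A * B"
      by (rule singular_mat_factor[OF Q])
    have "f ^\<^sub>m (i + i) = f ^\<^sub>m i * f ^\<^sub>m i"
      by (rule pow_mat_add[OF f])
    also have "\<dots> = S * ((T * S) * T)"
      unfolding eq using S T by (simp add: mat_mult_assoc)
    also have "\<dots> = (S * A) * (B * T)"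
      unfolding AB using S T A B by (simp add: mat_mult_assoc)
    finally have "fac s"
      unfolding fac_def using i S T A B
      by (intro exI[of _ "i + i"] exI[of _ "S * A"] exI[of _ "B * T"]) auto
    then show False
      using s not_less_Least unfolding r_def by blast
  qed
  then obtain Q' where "Q' \<in> carrier_mat r r" "T * S * Q' = 1\<^sub>m r" "Q' * (T * S) = 1\<^sub>m r"
    using det_non_zero_imp_unit[OF Q, of "()"] by (auto simp: Units_def ring_mat_simps)
  then show thesis
    by (rule that[OF i S T eq])
qed

text \<open>Every positive power of E is E, so \<open>power_factor_invertible\<close> factors E
  itself as S T. Idempotence turns into Q^3 = Q^2 for the invertible Q = T S, hence Q = 1.\<close>

lemma idempotent_split:
  fixes E :: "'k::field mat"
  assumes E: "E \<in> carrier_mat n n" and idem: "E * E = E"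
  obtains r S T where "S \<in> carrier_mat n r" "T \<in> carrier_mat r n" "E = S * T" "T * S = 1\<^sub>m r"
proof -
  obtain i r S T Q' where i: "i > 0" and S: "S \<in> carrier_mat n r" and T: "T \<in> carrier_mat r n"
    and eq: "E ^\<^sub>m i = S * T" and Q': "Q' \<in> carrier_mat r r" "T * S * Q' = 1\<^sub>m r" "Q' * (T * S) = 1\<^sub>m r"
    by (rule power_factor_invertible[OF E])
  have pow: "E ^\<^sub>m Suc j = E" for j
  proof (induction j)
    case (Suc j)
    then show ?case
      using idem by (simp only: pow_mat.simps)
  qed (use E in simp)
  have ST: "E = S * T"
    using eq pow[of "i - 1"] i by simp
  have d: "dim_row S = n" "dim_col S = r" "dim_row T = r" "dim_col T = n" "dim_row Q' = r" "dim_col Q' = r"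
    using S T Q' by auto
  have STST: "S * (T * (S * T)) = S * T"
    using idem d by (simp add: ST mat_mult_assoc del: assoc_mult_mat)
  define Q where "Q = T * S"
  have Q: "Q \<in> carrier_mat r r" "Q * Q' = 1\<^sub>m r" "Q' * Q = 1\<^sub>m r"
    using S T Q' by (auto simp: Q_def)
  have "Q * (Q * Q) = T * (S * (T * (S * T))) * S"
    using d by (simp add: Q_def mat_mult_assoc)
  also have "\<dots> = Q * Q"
    unfolding STST using d by (simp add: Q_def mat_mult_assoc)
  finally have QQQ: "Q * (Q * Q) = Q * Q" .
  have inv: "Q' * (Q * X) = X" if "X \<in> carrier_mat r r" for X
  proof -
    have "Q' * (Q * X) = Q' * Q * X"
      by (rule assoc_mult_mat[OF Q'(1) Q(1) that, symmetric])
    then show ?thesis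
      using Q(3) that by simp
  qed
  have "Q * Q = Q"
    using inv[of "Q * Q"] inv[of Q] Q(1) by (simp add: QQQ)
  then have "T * S = 1\<^sub>m r"
    using inv[of Q] Q by (simp add: Q_def)
  then show thesis
    by (rule that[OF S T ST])
qed

section \<open>Homomorphisms and direct sums of modules\<close>

definition mod_hom :: "('k::field, 'h) fdmod \<Rightarrow> ('k, 'h) fdmod \<Rightarrow> 'k mat \<Rightarrow> bool" where
  "mod_hom V W P \<longleftrightarrow> P \<in> carrier_mat (fst W) (fst V) \<and> (\<forall>h. P * snd V h = snd W h * P)"

text \<open>The biproduct identities: V is a direct sum of U and W up to isomorphism, witnessed by
  inclusions i, j and projections p, q. Additive functors preserve such data, which settles tensor
  products and duals.\<close>

definition is_dsum :: "('k::field, 'h) fdmod \<Rightarrow> ('k, 'h) fdmod \<Rightarrow> ('k, 'h) fdmod \<Rightarrow> bool" where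
  "is_dsum V U W \<longleftrightarrow> (\<exists>i j p q. mod_hom U V i \<and> mod_hom W V j \<and> mod_hom V U p \<and> mod_hom V W q \<and>
     p * i = 1\<^sub>m (fst U) \<and> q * j = 1\<^sub>m (fst W) \<and> p * j = 0\<^sub>m (fst U) (fst W) \<and> q * i = 0\<^sub>m (fst W) (fst U) \<and>
     i * p + j * q = 1\<^sub>m (fst V))"

lemma fdmods_dim:
  assumes "V \<in> fdmods H"
  shows "snd V h \<in> carrier_mat (fst V) (fst V)" "dim_row (snd V h) = fst V" "dim_col (snd V h) = fst V"
proof -
  show "snd V h \<in> carrier_mat (fst V) (fst V)"
    using assms by (auto simp: fdmods_def)
  then show "dim_row (snd V h) = fst V" "dim_col (snd V h) = fst V"
    by auto
qed

lemma mod_hom_dim: "mod_hom V W P \<Longrightarrow> dim_row P = fst W" "mod_hom V W P \<Longrightarrow> dim_col P = fst V"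
  by (auto simp: mod_hom_def)

lemma mod_homD: "mod_hom V W P \<Longrightarrow> P * snd V h = snd W h * P"
  by (auto simp: mod_hom_def)

lemma mod_homI:
  "dim_row P = fst W \<Longrightarrow> dim_col P = fst V \<Longrightarrow> (\<And>h. P * snd V h = snd W h * P) \<Longrightarrow> mod_hom V W P"
  by (auto simp: mod_hom_def)

lemma mod_hom_one: "V \<in> fdmods H \<Longrightarrow> mod_hom V V (1\<^sub>m (fst V))"
  by (rule mod_homI) (simp_all add: fdmods_dim(1)[THEN left_mult_one_mat] fdmods_dim(1)[THEN right_mult_one_mat])

lemma mod_hom_comp:
  assumes fd: "U \<in> fdmods H" "V \<in> fdmods H" "W \<in> fdmods H" and P: "mod_hom V W P" and Q: "mod_hom U V Q"
  shows "mod_hom U W (P * Q)"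
proof (rule mod_homI)
  fix h
  note d = fd[THEN fdmods_dim(2)] fd[THEN fdmods_dim(3)] mod_hom_dim[OF P] mod_hom_dim[OF Q]
  have "P * Q * snd U h = P * (Q * snd U h)"
    by (rule mat_mult_assoc) (simp_all add: d)
  also have "\<dots> = P * snd V h * Q"
    unfolding mod_homD[OF Q] by (rule mat_mult_assoc[symmetric]) (simp_all add: d)
  also have "\<dots> = snd W h * (P * Q)"
    unfolding mod_homD[OF P] by (rule mat_mult_assoc) (simp_all add: d)
  finally show "P * Q * snd U h = snd W h * (P * Q)" .
qed (simp_all add: mod_hom_dim[OF P] mod_hom_dim[OF Q])

lemma mod_hom_add:
  assumes fd: "V \<in> fdmods H" "W \<in> fdmods H" and P: "mod_hom V W P" and Q: "mod_hom V W Q"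
  shows "mod_hom V W (P + Q)"
proof (rule mod_homI)
  fix h
  show "(P + Q) * snd V h = snd W h * (P + Q)"
    using P Q fd[THEN fdmods_dim(1), of h] mod_homD[OF P, of h] mod_homD[OF Q, of h] unfolding mod_hom_def
    by (simp add: add_mult_distrib_mat[of _ "fst W" "fst V" _ _ "fst V"] mult_add_distrib_mat[of _ "fst W" "fst W" _ "fst V"])
qed (simp_all add: mod_hom_dim[OF P] mod_hom_dim[OF Q])

lemma mod_hom_diff:
  assumes fd: "V \<in> fdmods H" "W \<in> fdmods H" and P: "mod_hom V W P" and Q: "mod_hom V W Q"
  shows "mod_hom V W (P - Q)"
proof (rule mod_homI)
  fix h
  show "(P - Q) * snd V h = snd W h * (P - Q)"
    using P Q fd[THEN fdmods_dim(1), of h] mod_homD[OF P, of h] mod_homD[OF Q, of h] unfolding mod_hom_def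
    by (simp add: minus_mult_distrib_mat[of _ "fst W" "fst V" _ _ "fst V"] mult_minus_distrib_mat[of _ "fst W" "fst W" _ "fst V"])
qed (simp_all add: mod_hom_dim[OF P] mod_hom_dim[OF Q])

text \<open>Trades the invertible intertwiner between equal dimensions for a pair of mutually
  inverse homomorphisms: the inverse matrix intertwines automatically, and equality of the
  dimensions comes back from \<open>rect_inverse_dim\<close>.\<close>

lemma mod_iso_iff:
  assumes V: "V \<in> fdmods H" and W: "W \<in> fdmods H"
  shows "mod_iso V W \<longleftrightarrow> (\<exists>P Q. mod_hom V W P \<and> mod_hom W V Q \<and> P * Q = 1\<^sub>m (fst W) \<and> Q * P = 1\<^sub>m (fst V))"
proof
  assume "mod_iso V W"
  then obtain P where eq: "fst V = fst W" and P: "P \<in> carrier_mat (fst V) (fst V)" and inv: "invertible_mat P"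
    and hom: "\<And>h. P * snd V h = snd W h * P"
    unfolding mod_iso_def by auto
  from inv obtain Q where PQ: "P * Q = 1\<^sub>m (dim_row P)" and QP: "Q * P = 1\<^sub>m (dim_row Q)"
    unfolding invertible_mat_def inverts_mat_def by auto
  have dQ: "dim_col Q = fst V" "dim_row Q = fst V"
    using arg_cong[OF PQ, of dim_col] arg_cong[OF QP, of dim_col] P by auto
  note d = V[THEN fdmods_dim(2)] V[THEN fdmods_dim(3)] W[THEN fdmods_dim(2)] W[THEN fdmods_dim(3)]
  have "Q * snd W h = snd V h * Q" for h
  proof -
    have "Q * snd W h = Q * snd W h * (P * Q)"
      using PQ P d dQ eq by simp
    also have "\<dots> = Q * (snd W h * P) * Q"
      using P d dQ eq by (simp add: mat_mult_assoc del: assoc_mult_mat)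
    also have "\<dots> = Q * P * (snd V h * Q)"
      unfolding hom[symmetric] using P d dQ eq by (simp add: mat_mult_assoc del: assoc_mult_mat)
    also have "\<dots> = snd V h * Q"
      using QP d dQ by simp
    finally show ?thesis .
  qed
  then have "mod_hom W V Q"
    using dQ eq by (intro mod_homI) auto
  moreover have "mod_hom V W P"
    using P hom eq by (intro mod_homI) auto
  ultimately show "\<exists>P Q. mod_hom V W P \<and> mod_hom W V Q \<and> P * Q = 1\<^sub>m (fst W) \<and> Q * P = 1\<^sub>m (fst V)"
    using PQ QP P dQ eq by (intro exI[of _ P] exI[of _ Q]) auto
next
  assume "\<exists>P Q. mod_hom V W P \<and> mod_hom W V Q \<and> P * Q = 1\<^sub>m (fst W) \<and> Q * P = 1\<^sub>m (fst V)"
  then obtain P Q where P: "mod_hom V W P" and Q: "mod_hom W V Q"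
    and PQ: "P * Q = 1\<^sub>m (fst W)" and QP: "Q * P = 1\<^sub>m (fst V)"
    by auto
  have eq: "fst W = fst V"
    by (rule rect_inverse_dim[OF _ _ PQ QP]) (use P Q in \<open>auto simp: mod_hom_def\<close>)
  have "invertible_mat P"
    unfolding invertible_mat_def inverts_mat_def
    using mod_hom_dim[OF P] mod_hom_dim[OF Q] PQ QP eq by auto
  then show "mod_iso V W"
    unfolding mod_iso_def using P eq by (auto simp: mod_hom_def)
qed

lemma mod_iso_refl: "V \<in> fdmods H \<Longrightarrow> mod_iso V V"
  by (subst mod_iso_iff) (auto intro!: exI[of _ "1\<^sub>m (fst V)"] mod_hom_one)

lemma mod_iso_sym: "V \<in> fdmods H \<Longrightarrow> W \<in> fdmods H \<Longrightarrow> mod_iso V W \<Longrightarrow> mod_iso W V"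
  by (subst (asm) mod_iso_iff, assumption+, subst mod_iso_iff, assumption+) blast

lemma mod_iso_dim: "mod_iso V W \<Longrightarrow> fst V = fst W"
  by (simp add: mod_iso_def)

lemma is_dsumI:
  assumes "mod_hom U V i" "mod_hom W V j" "mod_hom V U p" "mod_hom V W q"
    "p * i = 1\<^sub>m (fst U)" "q * j = 1\<^sub>m (fst W)" "p * j = 0\<^sub>m (fst U) (fst W)" "q * i = 0\<^sub>m (fst W) (fst U)"
    "i * p + j * q = 1\<^sub>m (fst V)"
  shows "is_dsum V U W"
  unfolding is_dsum_def using assms by (intro exI conjI)

lemma is_dsumE:
  assumes "is_dsum V U W"
  obtains i j p q where "mod_hom U V i" "mod_hom W V j" "mod_hom V U p" "mod_hom V W q"
    "p * i = 1\<^sub>m (fst U)" "q * j = 1\<^sub>m (fst W)" "p * j = 0\<^sub>m (fst U) (fst W)" "q * i = 0\<^sub>m (fst W) (fst U)"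
    "i * p + j * q = 1\<^sub>m (fst V)"
  using assms unfolding is_dsum_def by (elim exE conjE)

lemma is_dsum_commute: "is_dsum V U W \<Longrightarrow> is_dsum V W U"
proof (elim is_dsumE)
  fix i j p q
  assume *: "mod_hom U V i" "mod_hom W V j" "mod_hom V U p" "mod_hom V W q"
    "p * i = 1\<^sub>m (fst U)" "q * j = 1\<^sub>m (fst W)" "p * j = 0\<^sub>m (fst U) (fst W)" "q * i = 0\<^sub>m (fst W) (fst U)"
    "i * p + j * q = 1\<^sub>m (fst V)"
  show "is_dsum V W U"
  proof (rule is_dsumI[OF *(2,1,4,3,6,5,8,7)])
    show "j * q + i * p = 1\<^sub>m (fst V)"
      using *(1-4,9) comm_add_mat[of "j * q" "fst V" "fst V" "i * p"] by (auto simp: mod_hom_def)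
  qed
qed

lemma is_dsum_iso:
  assumes fd: "V \<in> fdmods H" "V' \<in> fdmods H" "U \<in> fdmods H" "W \<in> fdmods H"
    and iso: "mod_iso V V'" and sum: "is_dsum V' U W"
  shows "is_dsum V U W"
proof -
  obtain P Q where P: "mod_hom V V' P" and Q: "mod_hom V' V Q" and PQ: "P * Q = 1\<^sub>m (fst V')" and QP: "Q * P = 1\<^sub>m (fst V)"
    using iso unfolding mod_iso_iff[OF fd(1,2)] by blast
  obtain i j p q where h: "mod_hom U V' i" "mod_hom W V' j" "mod_hom V' U p" "mod_hom V' W q"
    and e: "p * i = 1\<^sub>m (fst U)" "q * j = 1\<^sub>m (fst W)" "p * j = 0\<^sub>m (fst U) (fst W)" "q * i = 0\<^sub>m (fst W) (fst U)"
    "i * p + j * q = 1\<^sub>m (fst V')"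
    by (rule is_dsumE[OF sum])
  note d = h[THEN mod_hom_dim(1)] h[THEN mod_hom_dim(2)] mod_hom_dim[OF P] mod_hom_dim[OF Q]
  note r = PQ[THEN arg_cong, of mat_op] QP[THEN arg_cong, of mat_op] e[THEN arg_cong, of mat_op]
  note r = r[simplified mat_op_simps d index_mult_mat]
  show ?thesis
  proof (rule is_dsumI[of _ _ "Q * i" _ "Q * j" "p * P" "q * P"])
    show "mod_hom U V (Q * i)" "mod_hom W V (Q * j)" "mod_hom V U (p * P)" "mod_hom V W (q * P)"
      using mod_hom_comp fd h P Q by blast+
    have "Q * i * (p * P) + Q * j * (q * P) = Q * (i * p + j * q) * P"
      by (subst mat_op_inject) (simp_all add: mat_op_simps d algebra_simps)
    also have "\<dots> = 1\<^sub>m (fst V)"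
      using e(5) QP d by simp
    finally show "Q * i * (p * P) + Q * j * (q * P) = 1\<^sub>m (fst V)" .
  qed (subst mat_op_inject; simp add: mat_op_simps d mult_extend[OF r(1)] r)+
qed

lemma is_dsum_unique:
  assumes fd: "V \<in> fdmods H" "V' \<in> fdmods H" "U \<in> fdmods H" "W \<in> fdmods H"
    and s: "is_dsum V U W" and s': "is_dsum V' U W"
  shows "mod_iso V V'"
proof -
  obtain i j p q where h: "mod_hom U V i" "mod_hom W V j" "mod_hom V U p" "mod_hom V W q"
    and e: "p * i = 1\<^sub>m (fst U)" "q * j = 1\<^sub>m (fst W)" "p * j = 0\<^sub>m (fst U) (fst W)" "q * i = 0\<^sub>m (fst W) (fst U)"
    "i * p + j * q = 1\<^sub>m (fst V)"
    by (rule is_dsumE[OF s])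
  obtain i' j' p' q' where h': "mod_hom U V' i'" "mod_hom W V' j'" "mod_hom V' U p'" "mod_hom V' W q'"
    and e': "p' * i' = 1\<^sub>m (fst U)" "q' * j' = 1\<^sub>m (fst W)" "p' * j' = 0\<^sub>m (fst U) (fst W)" "q' * i' = 0\<^sub>m (fst W) (fst U)"
    "i' * p' + j' * q' = 1\<^sub>m (fst V')"
    by (rule is_dsumE[OF s'])
  note d = h[THEN mod_hom_dim(1)] h[THEN mod_hom_dim(2)] h'[THEN mod_hom_dim(1)] h'[THEN mod_hom_dim(2)]
  note r = e[THEN arg_cong, of mat_op] e'[THEN arg_cong, of mat_op]
  note r = r[simplified mat_op_simps d index_mult_mat index_add_mat]
  have hom: "mod_hom V V' (i' * p + j' * q)" "mod_hom V' V (i * p' + j * q')"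
    by (rule mod_hom_add[OF fd(1,2) mod_hom_comp[OF fd(1,3,2) h'(1) h(3)] mod_hom_comp[OF fd(1,4,2) h'(2) h(4)]],
        rule mod_hom_add[OF fd(2,1) mod_hom_comp[OF fd(2,3,1) h(1) h'(3)] mod_hom_comp[OF fd(2,4,1) h(2) h'(4)]])
  have "(i' * p + j' * q) * (i * p' + j * q') = i' * p' + j' * q'"
    by (subst mat_op_inject) (simp_all add: mat_op_simps d algebra_simps r(1-4)[THEN mult_extend])
  moreover have "(i * p' + j * q') * (i' * p + j' * q) = i * p + j * q"
    by (subst mat_op_inject) (simp_all add: mat_op_simps d algebra_simps r(6-9)[THEN mult_extend])
  ultimately show ?thesis
    unfolding mod_iso_iff[OF fd(1,2)] using hom e(5) e'(5) by auto
qed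

lemma block_diag_mult:
  assumes "A \<in> carrier_mat n n" "B \<in> carrier_mat n n" "C \<in> carrier_mat m m" "D \<in> carrier_mat m m"
  shows "four_block_mat A (0\<^sub>m n m) (0\<^sub>m m n) C * four_block_mat B (0\<^sub>m n m) (0\<^sub>m m n) D =
    four_block_mat (A * B) (0\<^sub>m n m) (0\<^sub>m m n) (C * (D::'a::ring_1 mat))"
proof -
  have "four_block_mat A (0\<^sub>m n m) (0\<^sub>m m n) C * four_block_mat B (0\<^sub>m n m) (0\<^sub>m m n) D =
    four_block_mat (A * B + 0\<^sub>m n m * 0\<^sub>m m n) (A * 0\<^sub>m n m + 0\<^sub>m n m * D)
      (0\<^sub>m m n * B + C * 0\<^sub>m m n) (0\<^sub>m m n * 0\<^sub>m n m + C * D)"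
    by (rule mult_four_block_mat) (use assms in auto)
  moreover have "A * B \<in> carrier_mat n n" "C * D \<in> carrier_mat m m"
    using assms by auto
  ultimately show ?thesis
    using assms by simp
qed

lemma mod_dsum_fdmods:
  assumes "U \<in> fdmods H" "W \<in> fdmods H"
  shows "mod_dsum U W \<in> fdmods H"
proof -
  note d = assms[THEN fdmods_dim(1)]
  show ?thesis
    using assms d unfolding fdmods_def mod_dsum_def
    by (auto simp: add_four_block_mat[of _ "fst U" "fst U" _ "fst W" _ "fst W"]
        smult_four_block_mat[of _ "fst U" "fst U" _ "fst W" _ "fst W"]
        block_diag_mult)
qed

text \<open>The inclusions and projections are block matrices with some blocks of zero width or
  height, so that one block multiplication rule serves all the identities.\<close>

lemma is_dsum_mod_dsum:
  fixes H :: "('k::field, 'h::ring_1) hopf"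
  assumes fd: "U \<in> fdmods H" "W \<in> fdmods H"
  shows "is_dsum (mod_dsum U W) U W"
proof -
  let ?n = "fst U" and ?m = "fst W"
  let ?i = "four_block_mat (1\<^sub>m ?n) (0\<^sub>m ?n 0) (0\<^sub>m ?m ?n) (0\<^sub>m ?m 0) :: 'k mat"
  let ?j = "four_block_mat (0\<^sub>m ?n 0) (0\<^sub>m ?n ?m) (0\<^sub>m ?m 0) (1\<^sub>m ?m) :: 'k mat"
  let ?p = "four_block_mat (1\<^sub>m ?n) (0\<^sub>m ?n ?m) (0\<^sub>m 0 ?n) (0\<^sub>m 0 ?m) :: 'k mat"
  let ?q = "four_block_mat (0\<^sub>m 0 ?n) (0\<^sub>m 0 ?m) (0\<^sub>m ?m ?n) (1\<^sub>m ?m) :: 'k mat"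
  note d = fd[THEN fdmods_dim(1)]
  have m: "four_block_mat A1 B1 C1 D1 * four_block_mat A2 B2 C2 D2 =
      four_block_mat (A1 * A2 + B1 * C2) (A1 * B2 + B1 * D2) (C1 * A2 + D1 * C2) (C1 * B2 + D1 * D2)"
    if "A1 \<in> carrier_mat nr1 n1" "B1 \<in> carrier_mat nr1 n2" "C1 \<in> carrier_mat nr2 n1" "D1 \<in> carrier_mat nr2 n2"
      "A2 \<in> carrier_mat n1 nc1" "B2 \<in> carrier_mat n1 nc2" "C2 \<in> carrier_mat n2 nc1" "D2 \<in> carrier_mat n2 nc2"
    for A1 B1 C1 D1 A2 B2 C2 D2 :: "'k mat" and nr1 nr2 n1 n2 nc1 nc2
    using that by (rule mult_four_block_mat)
  have left: "four_block_mat A (0\<^sub>m r 0) (0\<^sub>m 0 c) (0\<^sub>m 0 0) = A" if "A \<in> carrier_mat r c" for A :: "'k mat" and r c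
    using that by (intro eq_matI) auto
  have right: "four_block_mat (0\<^sub>m 0 0) (0\<^sub>m 0 c) (0\<^sub>m r 0) A = A" if "A \<in> carrier_mat r c" for A :: "'k mat" and r c
    using that by (intro eq_matI) auto
  show ?thesis
  proof (rule is_dsumI[of _ _ ?i _ ?j ?p ?q])
    show "mod_hom U (mod_dsum U W) ?i"
    proof (rule mod_homI)
      fix h
      show "?i * snd U h = snd (mod_dsum U W) h * ?i"
        using m[of "1\<^sub>m ?n" ?n ?n "0\<^sub>m ?n 0" 0 "0\<^sub>m ?m ?n" ?m "0\<^sub>m ?m 0" "snd U h" ?n "0\<^sub>m ?n 0" 0 "0\<^sub>m 0 ?n" "0\<^sub>m 0 0"]
          m[of "snd U h" ?n ?n "0\<^sub>m ?n ?m" ?m "0\<^sub>m ?m ?n" ?m "snd W h" "1\<^sub>m ?n" ?n "0\<^sub>m ?n 0" 0 "0\<^sub>m ?m ?n" "0\<^sub>m ?m 0"] d[of h]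
        by (simp add: left mod_dsum_def)
    qed (auto simp: mod_dsum_def)
    show "mod_hom W (mod_dsum U W) ?j"
    proof (rule mod_homI)
      fix h
      show "?j * snd W h = snd (mod_dsum U W) h * ?j"
        using m[of "0\<^sub>m ?n 0" ?n 0 "0\<^sub>m ?n ?m" ?m "0\<^sub>m ?m 0" ?m "1\<^sub>m ?m" "0\<^sub>m 0 0" 0 "0\<^sub>m 0 ?m" ?m "0\<^sub>m ?m 0" "snd W h"]
          m[of "snd U h" ?n ?n "0\<^sub>m ?n ?m" ?m "0\<^sub>m ?m ?n" ?m "snd W h" "0\<^sub>m ?n 0" 0 "0\<^sub>m ?n ?m" ?m "0\<^sub>m ?m 0" "1\<^sub>m ?m"] d[of h]
        by (simp add: right mod_dsum_def)
    qed (auto simp: mod_dsum_def)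
    show "mod_hom (mod_dsum U W) U ?p"
    proof (rule mod_homI)
      fix h
      show "?p * snd (mod_dsum U W) h = snd U h * ?p"
        using m[of "snd U h" ?n ?n "0\<^sub>m ?n 0" 0 "0\<^sub>m 0 ?n" 0 "0\<^sub>m 0 0" "1\<^sub>m ?n" ?n "0\<^sub>m ?n ?m" ?m "0\<^sub>m 0 ?n" "0\<^sub>m 0 ?m"]
          m[of "1\<^sub>m ?n" ?n ?n "0\<^sub>m ?n ?m" ?m "0\<^sub>m 0 ?n" 0 "0\<^sub>m 0 ?m" "snd U h" ?n "0\<^sub>m ?n ?m" ?m "0\<^sub>m ?m ?n" "snd W h"] d[of h]
        by (simp add: left mod_dsum_def)
    qed (auto simp: mod_dsum_def)
    show "mod_hom (mod_dsum U W) W ?q"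
    proof (rule mod_homI)
      fix h
      show "?q * snd (mod_dsum U W) h = snd W h * ?q"
        using m[of "0\<^sub>m 0 0" 0 0 "0\<^sub>m 0 ?m" ?m "0\<^sub>m ?m 0" ?m "snd W h" "0\<^sub>m 0 ?n" ?n "0\<^sub>m 0 ?m" ?m "0\<^sub>m ?m ?n" "1\<^sub>m ?m"]
          m[of "0\<^sub>m 0 ?n" 0 ?n "0\<^sub>m 0 ?m" ?m "0\<^sub>m ?m ?n" ?m "1\<^sub>m ?m" "snd U h" ?n "0\<^sub>m ?n ?m" ?m "0\<^sub>m ?m ?n" "snd W h"] d[of h]
        by (simp add: right mod_dsum_def)
    qed (auto simp: mod_dsum_def)
    show "?p * ?i = 1\<^sub>m ?n"
      using m[of "1\<^sub>m ?n" ?n ?n "0\<^sub>m ?n ?m" ?m "0\<^sub>m 0 ?n" 0 "0\<^sub>m 0 ?m" "1\<^sub>m ?n" ?n "0\<^sub>m ?n 0" 0 "0\<^sub>m ?m ?n" "0\<^sub>m ?m 0"]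
      by (simp add: left)
    show "?q * ?j = 1\<^sub>m ?m"
      using m[of "0\<^sub>m 0 ?n" 0 ?n "0\<^sub>m 0 ?m" ?m "0\<^sub>m ?m ?n" ?m "1\<^sub>m ?m" "0\<^sub>m ?n 0" 0 "0\<^sub>m ?n ?m" ?m "0\<^sub>m ?m 0" "1\<^sub>m ?m"]
      by (simp add: right)
    show "?p * ?j = 0\<^sub>m ?n ?m"
      using m[of "1\<^sub>m ?n" ?n ?n "0\<^sub>m ?n ?m" ?m "0\<^sub>m 0 ?n" 0 "0\<^sub>m 0 ?m" "0\<^sub>m ?n 0" 0 "0\<^sub>m ?n ?m" ?m "0\<^sub>m ?m 0" "1\<^sub>m ?m"]
      by simp
    show "?q * ?i = 0\<^sub>m ?m ?n"
      using m[of "0\<^sub>m 0 ?n" 0 ?n "0\<^sub>m 0 ?m" ?m "0\<^sub>m ?m ?n" ?m "1\<^sub>m ?m" "1\<^sub>m ?n" ?n "0\<^sub>m ?n 0" 0 "0\<^sub>m ?m ?n" "0\<^sub>m ?m 0"]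
      by simp
    have "?i * ?p = four_block_mat (1\<^sub>m ?n) (0\<^sub>m ?n ?m) (0\<^sub>m ?m ?n) (0\<^sub>m ?m ?m)"
      using m[of "1\<^sub>m ?n" ?n ?n "0\<^sub>m ?n 0" 0 "0\<^sub>m ?m ?n" ?m "0\<^sub>m ?m 0" "1\<^sub>m ?n" ?n "0\<^sub>m ?n ?m" ?m "0\<^sub>m 0 ?n" "0\<^sub>m 0 ?m"]
      by simp
    moreover have "?j * ?q = four_block_mat (0\<^sub>m ?n ?n) (0\<^sub>m ?n ?m) (0\<^sub>m ?m ?n) (1\<^sub>m ?m)"
      using m[of "0\<^sub>m ?n 0" ?n 0 "0\<^sub>m ?n ?m" ?m "0\<^sub>m ?m 0" ?m "1\<^sub>m ?m" "0\<^sub>m 0 ?n" ?n "0\<^sub>m 0 ?m" ?m "0\<^sub>m ?m ?n" "1\<^sub>m ?m"]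
      by simp
    ultimately show "?i * ?p + ?j * ?q = 1\<^sub>m (fst (mod_dsum U W))"
      by (simp add: add_four_block_mat[of _ ?n ?n _ ?m _ ?m] mod_dsum_def)
  qed
qed

lemma mod_iso_mod_dsum_iff:
  assumes fd: "V \<in> fdmods H" "U \<in> fdmods H" "W \<in> fdmods H"
  shows "mod_iso V (mod_dsum U W) \<longleftrightarrow> is_dsum V U W"
  using is_dsum_iso[OF fd(1) mod_dsum_fdmods[OF fd(2,3)] fd(2,3) _ is_dsum_mod_dsum[OF fd(2,3)]]
    is_dsum_unique[OF fd(1) mod_dsum_fdmods[OF fd(2,3)] fd(2,3) _ is_dsum_mod_dsum[OF fd(2,3)]] by blast

lemma is_dsum_dim:
  assumes "V \<in> fdmods H" "U \<in> fdmods H" "W \<in> fdmods H" "is_dsum V U W"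
  shows "fst V = fst U + fst W"
  using assms mod_iso_mod_dsum_iff[OF assms(1-3)] mod_iso_dim by (fastforce simp: mod_dsum_def)

lemma is_dsum_zero:
  assumes V: "V \<in> fdmods H" and Z: "Z \<in> fdmods H" "fst Z = 0"
  shows "is_dsum V V Z"
proof (rule is_dsumI)
  show "mod_hom V V (1\<^sub>m (fst V))"
    by (rule mod_hom_one[OF V])
  then show "mod_hom V V (1\<^sub>m (fst V))" .
  show "mod_hom Z V (0\<^sub>m (fst V) (fst Z))" "mod_hom V Z (0\<^sub>m (fst Z) (fst V))"
    using V Z by (auto intro!: mod_homI eq_matI simp: fdmods_dim(2,3))
qed (use Z in \<open>auto intro!: eq_matI simp: scalar_prod_def\<close>)

lemma is_dsum_zero_iso:
  assumes fd: "V \<in> fdmods H" "U \<in> fdmods H" "Z \<in> fdmods H" and s: "is_dsum V U Z" and Z: "fst Z = 0"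
  shows "mod_iso V U"
  by (rule is_dsum_unique[OF fd(1,2,2,3) s is_dsum_zero[OF fd(2,3) Z]])

lemma is_dsum_assoc:
  assumes fd: "A \<in> fdmods H" "B \<in> fdmods H" "C \<in> fdmods H" "D \<in> fdmods H" "V \<in> fdmods H" "X \<in> fdmods H"
    and 1: "is_dsum V A B" and 2: "is_dsum A C D" and 3: "is_dsum X D B"
  shows "is_dsum V C X"
proof -
  obtain i j p q where h: "mod_hom A V i" "mod_hom B V j" "mod_hom V A p" "mod_hom V B q"
    and e: "p * i = 1\<^sub>m (fst A)" "q * j = 1\<^sub>m (fst B)" "p * j = 0\<^sub>m (fst A) (fst B)" "q * i = 0\<^sub>m (fst B) (fst A)"
    "i * p + j * q = 1\<^sub>m (fst V)"
    by (rule is_dsumE[OF 1])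
  obtain i' j' p' q' where h': "mod_hom C A i'" "mod_hom D A j'" "mod_hom A C p'" "mod_hom A D q'"
    and e': "p' * i' = 1\<^sub>m (fst C)" "q' * j' = 1\<^sub>m (fst D)" "p' * j' = 0\<^sub>m (fst C) (fst D)" "q' * i' = 0\<^sub>m (fst D) (fst C)"
    "i' * p' + j' * q' = 1\<^sub>m (fst A)"
    by (rule is_dsumE[OF 2])
  obtain k l r s where h'': "mod_hom D X k" "mod_hom B X l" "mod_hom X D r" "mod_hom X B s"
    and e'': "r * k = 1\<^sub>m (fst D)" "s * l = 1\<^sub>m (fst B)" "r * l = 0\<^sub>m (fst D) (fst B)" "s * k = 0\<^sub>m (fst B) (fst D)"
    "k * r + l * s = 1\<^sub>m (fst X)"
    by (rule is_dsumE[OF 3])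
  note d = h[THEN mod_hom_dim(1)] h[THEN mod_hom_dim(2)] h'[THEN mod_hom_dim(1)] h'[THEN mod_hom_dim(2)]
    h''[THEN mod_hom_dim(1)] h''[THEN mod_hom_dim(2)]
  note R = e(1-4)[THEN arg_cong, of mat_op] e'(1-4)[THEN arg_cong, of mat_op] e''(1-4)[THEN arg_cong, of mat_op]
  note R = R[simplified mat_op_simps d index_mult_mat index_add_mat]
  note R = R R[THEN mult_extend]
  show ?thesis
  proof (rule is_dsumI[of _ _ "i * i'" _ "i * j' * r + j * s" "p' * p" "k * q' * p + l * q"])
    show "mod_hom C V (i * i')" "mod_hom V C (p' * p)"
      using mod_hom_comp fd h h' by blast+
    show "mod_hom X V (i * j' * r + j * s)"
      by (rule mod_hom_add[OF fd(6,5) mod_hom_comp[OF fd(6,4,5) mod_hom_comp[OF fd(4,1,5) h(1) h'(2)] h''(3)]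
        mod_hom_comp[OF fd(6,2,5) h(2) h''(4)]])
    show "mod_hom V X (k * q' * p + l * q)"
      by (rule mod_hom_add[OF fd(5,6) mod_hom_comp[OF fd(5,1,6) mod_hom_comp[OF fd(1,4,6) h''(1) h'(4)] h(3)]
        mod_hom_comp[OF fd(5,2,6) h''(2) h(4)]])
    show "p' * p * (i * i') = 1\<^sub>m (fst C)" "p' * p * (i * j' * r + j * s) = 0\<^sub>m (fst C) (fst X)"
      "(k * q' * p + l * q) * (i * i') = 0\<^sub>m (fst X) (fst C)"
      by (subst mat_op_inject; simp add: mat_op_simps d algebra_simps R)+
    have "(k * q' * p + l * q) * (i * j' * r + j * s) = k * r + l * s"
      by (subst mat_op_inject) (simp_all add: mat_op_simps d algebra_simps R)
    then show "(k * q' * p + l * q) * (i * j' * r + j * s) = 1\<^sub>m (fst X)"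
      using e'' by simp
    have "i * i' * (p' * p) + (i * j' * r + j * s) * (k * q' * p + l * q) = i * (i' * p' + j' * q') * p + j * q"
      by (subst mat_op_inject) (simp_all add: mat_op_simps d algebra_simps R)
    then show "i * i' * (p' * p) + (i * j' * r + j * s) * (k * q' * p + l * q) = 1\<^sub>m (fst V)"
      using e e' d by simp
  qed
qed

section \<open>The Krull--Schmidt theorem\<close>

text \<open>The image of the idempotent S T in coordinates. As S T commutes with the action and T S
  = 1, the compressed action \<open>T * snd V h * S\<close> is again multiplicative.\<close>

lemma submodule_of_split:
  assumes V: "V \<in> fdmods H" and S: "S \<in> carrier_mat (fst V) r" and T: "T \<in> carrier_mat r (fst V)"
    and TS: "T * S = 1\<^sub>m r" and E: "mod_hom V V (S * T)"
  shows "(r, \<lambda>h. T * snd V h * S) \<in> fdmods H"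
    and "mod_hom (r, \<lambda>h. T * snd V h * S) V S" and "mod_hom V (r, \<lambda>h. T * snd V h * S) T"
proof -
  have d: "dim_row S = fst V" "dim_col S = r" "dim_row T = r" "dim_col T = fst V"
    "\<And>h. dim_row (snd V h) = fst V" "\<And>h. dim_col (snd V h) = fst V"
    using S T V by (auto simp: fdmods_dim)
  have r: "mat_op T * mat_op S = mat_op (1\<^sub>m r)"
    using arg_cong[OF TS, of mat_op] d by (simp add: mat_op_simps)
  have c: "mat_op S * (mat_op T * mat_op (snd V h)) = mat_op (snd V h) * (mat_op S * mat_op T)" for h
    using arg_cong[OF mod_homD[OF E, of h], of mat_op] d by (simp add: mat_op_simps)
  note R = d r r[THEN mult_extend]
  have c1: "mat_op T * mat_op (snd V h) = mat_op T * (mat_op (snd V h) * (mat_op S * mat_op T))" for h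
    using arg_cong[OF c[of h], of "\<lambda>x. mat_op T * x"] by (simp add: mat_op_simps R)
  have c2: "mat_op (snd V h) * mat_op S = mat_op S * (mat_op T * (mat_op (snd V h) * mat_op S))" for h
    using arg_cong[OF c[of h], of "\<lambda>x. x * mat_op S"] by (simp add: mat_op_simps R)
  show "mod_hom (r, \<lambda>h. T * snd V h * S) V S"
    by (rule mod_homI; (subst mat_op_inject)?) (simp_all add: mat_op_simps d c2[symmetric])
  show "mod_hom V (r, \<lambda>h. T * snd V h * S) T"
    by (rule mod_homI; (subst mat_op_inject)?) (simp_all add: mat_op_simps d c1[symmetric])
  have V': "snd V (g + h) = snd V g + snd V h" "snd V (hscale H a h) = a \<cdot>\<^sub>m snd V h"
    "snd V 1 = 1\<^sub>m (fst V)" "snd V (g * h) = snd V g * snd V h" for g h a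
    using V by (auto simp: fdmods_def)
  show "(r, \<lambda>h. T * snd V h * S) \<in> fdmods H"
    unfolding fdmods_def mem_Collect_eq prod.case
  proof (intro conjI allI)
    fix g h a
    show "T * snd V h * S \<in> carrier_mat r r"
      using S T by auto
    show "T * snd V (g + h) * S = T * snd V g * S + T * snd V h * S"
      by (subst mat_op_inject) (simp_all add: mat_op_simps d V' algebra_simps)
    show "T * snd V (hscale H a h) * S = a \<cdot>\<^sub>m (T * snd V h * S)"
      using S T fdmods_dim(1)[OF V, of h] by (simp add: V' mult_smult_distrib[of _ r "fst V" _ "fst V"] mult_smult_assoc_mat[of _ r "fst V" _ r])
    show "T * snd V 1 * S = 1\<^sub>m r"
      using S T TS by (simp add: V')
    show "T * snd V (g * h) * S = T * snd V g * S * (T * snd V h * S)"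
      by (subst mat_op_inject) (simp_all add: mat_op_simps d V' c2[symmetric])
  qed
qed

lemma idempotent_dsum:
  assumes V: "V \<in> fdmods H" and E: "mod_hom V V E" and idem: "E * E = E"
  obtains U W i j p q where "U \<in> fdmods H" "W \<in> fdmods H" "mod_hom U V i" "mod_hom W V j" "mod_hom V U p" "mod_hom V W q"
    "p * i = 1\<^sub>m (fst U)" "q * j = 1\<^sub>m (fst W)" "i * p = E" "j * q = 1\<^sub>m (fst V) - E"
    "is_dsum V U W"
proof -
  let ?n = "fst V" and ?F = "1\<^sub>m (fst V) - E"
  have dE: "dim_row E = ?n" "dim_col E = ?n"
    using mod_hom_dim[OF E] by auto
  have rE: "mat_op E * mat_op E = mat_op E"
    using arg_cong[OF idem, of mat_op] dE by (simp add: mat_op_simps)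
  have F: "mod_hom V V ?F"
    by (rule mod_hom_diff[OF V V mod_hom_one[OF V] E])
  have Fidem: "?F * ?F = ?F"
    by (subst mat_op_inject) (simp_all add: mat_op_simps dE algebra_simps rE)
  have Ec: "E \<in> carrier_mat ?n ?n" "?F \<in> carrier_mat ?n ?n"
    using E F by (auto simp: mod_hom_def)
  obtain r S T where S: "S \<in> carrier_mat ?n r" and T: "T \<in> carrier_mat r ?n" and eq: "E = S * T" and TS: "T * S = 1\<^sub>m r"
    by (rule idempotent_split[OF Ec(1) idem])
  obtain r' S' T' where S': "S' \<in> carrier_mat ?n r'" and T': "T' \<in> carrier_mat r' ?n" and eq': "?F = S' * T'" and TS': "T' * S' = 1\<^sub>m r'"
    by (rule idempotent_split[OF Ec(2) Fidem])
  let ?U = "(r, \<lambda>h. T * snd V h * S)" and ?W = "(r', \<lambda>h. T' * snd V h * S')"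
  note U = submodule_of_split[OF V S T TS E[unfolded eq]]
  note W = submodule_of_split[OF V S' T' TS' F[unfolded eq']]
  have d: "dim_row S = ?n" "dim_col S = r" "dim_row T = r" "dim_col T = ?n"
    "dim_row S' = ?n" "dim_col S' = r'" "dim_row T' = r'" "dim_col T' = ?n"
    using S T S' T' by auto
  have r: "mat_op T * mat_op S = mat_op (1\<^sub>m r)" "mat_op T' * mat_op S' = mat_op (1\<^sub>m r')"
    using arg_cong[OF TS, of mat_op] arg_cong[OF TS', of mat_op] d by (simp_all add: mat_op_simps)
  have sum: "mat_op (1\<^sub>m ?n) - mat_op S * mat_op T = mat_op S' * mat_op T'"
    using arg_cong[OF eq', of mat_op] dE d unfolding eq by (simp add: mat_op_simps)
  \<comment> \<open>\<open>1 - S T\<close> acts as the identity on S', so \<open>S T S'\<close>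
    vanishes; multiplying by T and using \<open>T S = 1\<close> leaves \<open>T S' = 0\<close>.
    Likewise \<open>1 - S T\<close> kills S, which gives \<open>T' S = 0\<close>.\<close>
  have a1: "mat_op S' = mat_op S' - mat_op S * (mat_op T * mat_op S')"
    using arg_cong[OF sum, of "\<lambda>x. x * mat_op S'"] r by (simp add: mat_op_simps d algebra_simps)
  have z1: "T * S' = 0\<^sub>m r r'"
    using arg_cong[OF a1, of "\<lambda>x. mat_op T * x"]
    by (subst mat_op_inject) (simp_all add: mat_op_simps d algebra_simps r[THEN mult_extend])
  have a2: "mat_op S = mat_op S - mat_op S' * (mat_op T' * mat_op S)"
    using arg_cong[OF sum, of "\<lambda>x. x * mat_op S"] r by (simp add: mat_op_simps d algebra_simps)
  have z2: "T' * S = 0\<^sub>m r' r"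
    using arg_cong[OF a2, of "\<lambda>x. mat_op T' * x"]
    by (subst mat_op_inject) (simp_all add: mat_op_simps d algebra_simps r[THEN mult_extend])
  have one: "S * T + S' * T' = 1\<^sub>m ?n"
    using sum[symmetric] by (subst mat_op_inject) (simp_all add: mat_op_simps d)
  have "is_dsum V ?U ?W"
    by (rule is_dsumI[OF U(2) W(2) U(3) W(3)]) (use TS TS' z1 z2 one in simp_all)
  then show thesis
    using TS TS' by (intro that[OF U(1) W(1) U(2) W(2) U(3) W(3) _ _ eq[symmetric] eq'[symmetric]]) simp_all
qed

lemma indecomposablesD:
  assumes "M \<in> indecomposables H"
  shows "M \<in> fdmods H" "fst M \<noteq> 0"
  using assms by (auto simp: indecomposables_def)

lemma indecomposable_dsum:
  assumes "M \<in> indecomposables H" "U \<in> fdmods H" "W \<in> fdmods H" "is_dsum M U W"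
  shows "fst U = 0 \<or> fst W = 0"
proof -
  have "mod_iso M (mod_dsum U W)"
    using mod_iso_mod_dsum_iff[of M H U W] indecomposablesD(1)[OF assms(1)] assms(2-4) by simp
  then show ?thesis
    using assms(1-3) unfolding indecomposables_def by simp
qed

lemma mod_hom_pow:
  assumes V: "V \<in> fdmods H" and f: "mod_hom V V f"
  shows "mod_hom V V (f ^\<^sub>m i)"
proof (induction i)
  case 0
  then show ?case
    using mod_hom_one[OF V] mod_hom_dim[OF f] by simp
next
  case (Suc i)
  then show ?case
    using mod_hom_comp[OF V V V _ f] by simp
qed

lemma endomorphism_inverse_hom:
  assumes V: "V \<in> fdmods H" and f: "mod_hom V V f" and g: "g \<in> carrier_mat (fst V) (fst V)" and fg: "f * g = 1\<^sub>m (fst V)"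
  shows "mod_hom V V g" "g * f = 1\<^sub>m (fst V)"
proof -
  have d: "dim_row f = fst V" "dim_col f = fst V" "dim_row g = fst V" "dim_col g = fst V"
    "\<And>h. dim_row (snd V h) = fst V" "\<And>h. dim_col (snd V h) = fst V"
    using mod_hom_dim[OF f] g fdmods_dim[OF V] by auto
  show gf: "g * f = 1\<^sub>m (fst V)"
    by (rule mat_mult_left_right_inverse[OF _ g fg]) (use f in \<open>auto simp: mod_hom_def\<close>)
  show "mod_hom V V g"
  proof (rule mod_homI)
    fix h
    have "g * snd V h = g * (snd V h * (f * g))"
      using d fdmods_dim(1)[OF V, of h] g by (simp add: fg)
    also have "\<dots> = g * (snd V h * f) * g"
      by (subst mat_op_inject) (simp_all add: mat_op_simps d)
    also have "\<dots> = (g * f) * (snd V h * g)"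
      unfolding mod_homD[OF f, symmetric] by (subst mat_op_inject) (simp_all add: mat_op_simps d)
    also have "\<dots> = snd V h * g"
      using d fdmods_dim(1)[OF V, of h] g by (simp add: gf)
    finally show "g * snd V h = snd V h * g" .
  qed (use d in auto)
qed

text \<open>
  Fitting's lemma: with \<open>f\<^sup>i = S T\<close> and \<open>T S\<close> invertible, \<open>S (T S)\<^sup>-\<^sup>1 T\<close> is the projection
  onto the eventual image of \<open>f\<close> along its eventual kernel.
\<close>

lemma fitting:
  assumes M: "M \<in> indecomposables H" and f: "mod_hom M M f"
  shows "(\<exists>g. mod_hom M M g \<and> f * g = 1\<^sub>m (fst M) \<and> g * f = 1\<^sub>m (fst M)) \<or> (\<exists>i. f ^\<^sub>m i = 0\<^sub>m (fst M) (fst M))"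
proof -
  let ?n = "fst M"
  have V: "M \<in> fdmods H"
    using M by (rule indecomposablesD)
  have fc: "f \<in> carrier_mat ?n ?n"
    using f by (simp add: mod_hom_def)
  obtain i r S T Q where i: "i > 0" and S: "S \<in> carrier_mat ?n r" and T: "T \<in> carrier_mat r ?n"
    and eq: "f ^\<^sub>m i = S * T" and Q: "Q \<in> carrier_mat r r" "T * S * Q = 1\<^sub>m r" "Q * (T * S) = 1\<^sub>m r"
    by (rule power_factor_invertible[OF fc])
  have d: "dim_row S = ?n" "dim_col S = r" "dim_row T = r" "dim_col T = ?n" "dim_row Q = r" "dim_col Q = r"
    "\<And>h. dim_row (snd M h) = ?n" "\<And>h. dim_col (snd M h) = ?n"
    using S T Q V by (auto simp: fdmods_dim)
  have F: "mod_hom M M (S * T)"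
    using mod_hom_pow[OF V f, of i] by (simp add: eq)
  have r: "mat_op T * (mat_op S * mat_op Q) = mat_op (1\<^sub>m r)" "mat_op Q * (mat_op T * mat_op S) = mat_op (1\<^sub>m r)"
    using arg_cong[OF Q(2), of mat_op] arg_cong[OF Q(3), of mat_op] d by (simp_all add: mat_op_simps)
  note R = r r(1)[THEN mult3_extend] r(2)[THEN mult3_extend]
  \<comment> \<open>\<open>?G\<close> inverts \<open>f ^\<^sub>m i\<close> on its image and is zero
    on the complement: both products with \<open>S * T\<close> are the projection
    \<open>?E\<close>.\<close>
  let ?G = "S * Q * Q * T"
  let ?E = "S * Q * T"
  have "mod_hom M M ?G"
  proof (rule mod_homI)
    fix h
    let ?x = "mat_op (snd M h)"
    let ?s = "mat_op S" and ?t = "mat_op T" and ?q = "mat_op Q"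
    have c: "?s * (?t * ?x) = ?x * (?s * ?t)"
      using arg_cong[OF mod_homD[OF F, of h], of mat_op] d by (simp add: mat_op_simps)
    have c': "?s * (?t * (?x * y)) = ?x * (?s * (?t * y))" for y
      using arg_cong[OF c, of "\<lambda>z. z * y"] by (simp add: mult.assoc)
    have xs: "?x * ?s = ?s * (?t * (?x * (?s * ?q)))"
      by (simp add: c' R mat_op_simps d)
    have tx: "?t * ?x = ?q * (?t * (?x * (?s * ?t)))"
      using R(4)[of "?t * ?x"] d by (simp add: c[symmetric] mat_op_simps mult.assoc)
    \<comment> \<open>Neither S, T nor Q is a module map by itself. What makes \<open>?G\<close> one
      is that Q commutes with T x S, because its inverse T S does.\<close>
    have qc: "?q * (?t * (?x * ?s)) = ?t * (?x * (?s * ?q))"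
    proof -
      have "?q * (?t * (?x * ?s)) = ?q * (?t * (?s * (?t * (?x * (?s * ?q)))))"
        by (simp only: xs)
      then show ?thesis
        by (simp add: R mat_op_simps d)
    qed
    have qc': "?q * (?t * (?x * (?s * y))) = ?t * (?x * (?s * (?q * y)))" for y
      using arg_cong[OF qc, of "\<lambda>z. z * y"] by (simp add: mult.assoc)
    have "?s * (?q * (?q * (?t * ?x))) = ?s * (?q * (?q * (?q * (?t * (?x * (?s * ?t))))))"
      by (simp only: tx[symmetric])
    also have "\<dots> = ?s * (?t * (?x * (?s * (?q * (?q * (?q * ?t))))))"
      by (simp only: qc')
    also have "\<dots> = ?x * (?s * (?q * (?q * ?t)))"
      using arg_cong[OF xs, of "\<lambda>z. z * (?q * (?q * ?t))"] by (simp add: mult.assoc)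
    finally show "?G * snd M h = snd M h * ?G"
      by (subst mat_op_inject) (simp_all add: mat_op_simps d)
  qed (use d in auto)
  note G = this
  have FG: "S * T * ?G = ?E" "?G * (S * T) = ?E" "?E * ?E = ?E" "?E * (S * T) = S * T"
    by (subst mat_op_inject; simp add: mat_op_simps d R)+
  have E: "mod_hom M M ?E"
    using mod_hom_comp[OF V V V F G] by (simp add: FG)
  obtain U W i' j p q where UW: "U \<in> fdmods H" "W \<in> fdmods H" and h: "mod_hom U M i'" "mod_hom W M j" "mod_hom M U p" "mod_hom M W q"
    and e: "p * i' = 1\<^sub>m (fst U)" "q * j = 1\<^sub>m (fst W)" "i' * p = ?E" "j * q = 1\<^sub>m ?n - ?E" and s: "is_dsum M U W"
    by (rule idempotent_dsum[OF V E FG(3)])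
  have "fst U = 0 \<or> fst W = 0"
    by (rule indecomposable_dsum[OF M UW s])
  then show ?thesis
  proof
    assume "fst U = 0"
    then have "?E = 0\<^sub>m ?n ?n"
      unfolding e(3)[symmetric] using mod_hom_dim[OF h(1)] mod_hom_dim[OF h(3)] by (auto intro!: eq_matI simp: scalar_prod_def)
    then have "f ^\<^sub>m i = 0\<^sub>m ?n ?n"
      using FG(4) S T by (simp add: eq)
    then show ?thesis
      by blast
  next
    assume "fst W = 0"
    then have z: "1\<^sub>m ?n - ?E = 0\<^sub>m ?n ?n"
      unfolding e(4)[symmetric] using mod_hom_dim[OF h(2)] mod_hom_dim[OF h(4)] by (auto intro!: eq_matI simp: scalar_prod_def)
    have E1: "?E = 1\<^sub>m ?n"
      using arg_cong[OF z, of mat_op] by (subst mat_op_inject) (simp_all add: mat_op_simps d)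
    obtain k where k: "i = Suc k"
      using i by (cases i) auto
    have "f ^\<^sub>m i = f ^\<^sub>m 1 * f ^\<^sub>m k"
      using pow_mat_add[OF fc, of 1 k] by (simp add: k)
    then have fi: "f ^\<^sub>m i = f * f ^\<^sub>m k"
      using fc by simp
    have kc: "f ^\<^sub>m k \<in> carrier_mat ?n ?n"
      using fc by simp
    have "f * (f ^\<^sub>m k * ?G) = S * T * ?G"
      unfolding eq[symmetric] fi
      by (rule assoc_mult_mat[OF fc kc, symmetric]) (use S T Q in auto)
    then have fg: "f * (f ^\<^sub>m k * ?G) = 1\<^sub>m ?n"
      by (simp only: FG(1) E1)
    have "f ^\<^sub>m k * ?G \<in> carrier_mat ?n ?n"
      using carrier_matD[OF kc] d by (intro carrier_matI) simp_all
    from endomorphism_inverse_hom[OF V f this fg] fg show ?thesis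
      by blast
  qed
qed

text \<open>Otherwise both a and b are nilpotent by Fitting's lemma. For the last nonzero power
  \<open>?X\<close> of a, the identity \<open>?X * (a + b) = ?X\<close> reads
  \<open>?X * b = ?X\<close>; so \<open>?X\<close> survives multiplication by every power of b and
  must vanish.\<close>

lemma indecomposable_local:
  fixes H :: "('k::field, 'h::ring_1) hopf"
  assumes M: "M \<in> indecomposables H" and a: "mod_hom M M a" and b: "mod_hom M M b" and ab: "a + b = 1\<^sub>m (fst M)"
  shows "\<exists>c. mod_hom M M c \<and> (c * a = 1\<^sub>m (fst M) \<or> c * b = 1\<^sub>m (fst M))"
proof (rule ccontr)
  assume no: "\<not> ?thesis"
  let ?n = "fst M"
  have ac: "a \<in> carrier_mat ?n ?n" "b \<in> carrier_mat ?n ?n"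
    using a b by (auto simp: mod_hom_def)
  obtain i where i: "a ^\<^sub>m i = 0\<^sub>m ?n ?n"
    using fitting[OF M a] no by blast
  obtain j where j: "b ^\<^sub>m j = 0\<^sub>m ?n ?n"
    using fitting[OF M b] no by blast
  define k where "k = (LEAST i. a ^\<^sub>m i = 0\<^sub>m ?n ?n)"
  have k: "a ^\<^sub>m k = 0\<^sub>m ?n ?n"
    unfolding k_def using i by (rule LeastI)
  show False
  proof (cases k)
    case 0
    then have "1\<^sub>m ?n = (0\<^sub>m ?n ?n :: 'k mat)"
      using k ac by simp
    then have "(1\<^sub>m ?n :: 'k mat) $$ (0, 0) = (0\<^sub>m ?n ?n) $$ (0, 0)"
      by simp
    then show False
      using indecomposablesD(2)[OF M] by simp
  next
    case (Suc l)
    let ?X = "a ^\<^sub>m l"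
    have X: "?X \<in> carrier_mat ?n ?n"
      using ac by simp
    have "?X = ?X * (a + b)"
      by (simp only: ab right_mult_one_mat[OF X])
    also have "\<dots> = ?X * a + ?X * b"
      by (rule mult_add_distrib_mat[OF X ac])
    also have "?X * a = 0\<^sub>m ?n ?n"
      using k Suc by simp
    finally have Xb: "?X * b = ?X"
      using left_add_zero_mat[of "?X * b" ?n ?n] mult_carrier_mat[OF X ac(2)] by simp
    have "?X * b ^\<^sub>m m = ?X" for m
    proof (induction m)
      case (Suc m)
      have "?X * b ^\<^sub>m Suc m = ?X * b ^\<^sub>m m * b"
        using X ac by (simp add: assoc_mult_mat[of _ ?n ?n _ ?n _ ?n])
      then show ?case
        using Suc Xb by simp
    qed (use right_mult_one_mat[OF X] ac in simp)
    from this[of j] have "?X = 0\<^sub>m ?n ?n"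
      by (simp only: j right_mult_zero_mat[OF X])
    then have "k \<le> l"
      unfolding k_def by (rule Least_le)
    then show False
      using Suc by simp
  qed
qed

text \<open>
  If \<open>i p + j q = a c + b d = 1\<close> are the decompositions and \<open>v p a c i = 1\<close>, then \<open>c i\<close> splits
  \<open>M\<close> off \<open>U\<close>, with complement \<open>U'\<close>, and the Schur complement identifies \<open>X\<close> with \<open>U' \<oplus> W\<close>.
\<close>

lemma exchange_left:
  assumes fd: "V \<in> fdmods H" "M \<in> fdmods H" "X \<in> fdmods H" "U \<in> fdmods H" "W \<in> fdmods H"
    and h: "mod_hom M V i" "mod_hom X V j" "mod_hom V M p" "mod_hom V X q"
    and e: "p * i = 1\<^sub>m (fst M)" "q * j = 1\<^sub>m (fst X)" "p * j = 0\<^sub>m (fst M) (fst X)" "q * i = 0\<^sub>m (fst X) (fst M)"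
      "i * p + j * q = 1\<^sub>m (fst V)"
    and h': "mod_hom U V a" "mod_hom W V b" "mod_hom V U c" "mod_hom V W d"
    and e': "c * a = 1\<^sub>m (fst U)" "d * b = 1\<^sub>m (fst W)" "c * b = 0\<^sub>m (fst U) (fst W)" "d * a = 0\<^sub>m (fst W) (fst U)"
      "a * c + b * d = 1\<^sub>m (fst V)"
    and v: "mod_hom M M v" "v * (p * a * (c * i)) = 1\<^sub>m (fst M)"
  shows "\<exists>U'\<in>fdmods H. is_dsum U M U' \<and> is_dsum X U' W"
proof -
  note dd = h[THEN mod_hom_dim(1)] h[THEN mod_hom_dim(2)] h'[THEN mod_hom_dim(1)] h'[THEN mod_hom_dim(2)]
    mod_hom_dim[OF v(1)]
  \<comment> \<open>\<open>?f\<close> carries M into U, and v is exactly what makes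
    \<open>?g\<close> a retraction of it. The complement of M in U is then the image of the
    idempotent \<open>1 - ?f * ?g\<close>.\<close>
  let ?f = "c * i" and ?g = "v * (p * a)"
  have f: "mod_hom M U ?f"
    by (rule mod_hom_comp[OF fd(2,1,4) h'(3) h(1)])
  have g: "mod_hom U M ?g"
    by (rule mod_hom_comp[OF fd(4,2,2) v(1) mod_hom_comp[OF fd(4,1,2) h(3) h'(1)]])
  note R = e(1-4)[THEN arg_cong, of mat_op] e'(1-4)[THEN arg_cong, of mat_op] v(2)[THEN arg_cong, of mat_op]
  note R = R[simplified mat_op_simps dd index_mult_mat index_add_mat]
  have R5: "mat_op i * (mat_op p * x) + mat_op j * (mat_op q * x) = mat_op (1\<^sub>m (fst V)) * x"
    "mat_op a * (mat_op c * x) + mat_op b * (mat_op d * x) = mat_op (1\<^sub>m (fst V)) * x" for x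
    using e(5)[THEN arg_cong, of "\<lambda>y. mat_op y * x"] e'(5)[THEN arg_cong, of "\<lambda>y. mat_op y * x"]
    by (simp_all add: mat_op_simps dd algebra_simps)
  have gf: "?g * ?f = 1\<^sub>m (fst M)"
    using R(9) by (subst mat_op_inject) (simp_all add: mat_op_simps dd)
  have idem: "?f * ?g * (?f * ?g) = ?f * ?g"
  proof -
    have "?f * ?g * (?f * ?g) = ?f * (?g * ?f) * ?g"
      by (subst mat_op_inject) (simp_all add: mat_op_simps dd)
    then show ?thesis
      using dd unfolding gf by simp
  qed
  have E: "mod_hom U U (1\<^sub>m (fst U) - ?f * ?g)"
    by (rule mod_hom_diff[OF fd(4,4) mod_hom_one[OF fd(4)] mod_hom_comp[OF fd(4,2,4) f g]])
  have fg: "mat_op (?f * ?g) * mat_op (?f * ?g) = mat_op (?f * ?g)"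
    using arg_cong[OF idem, of mat_op] by (simp add: mat_op_mult dd)
  have idem': "(1\<^sub>m (fst U) - ?f * ?g) * (1\<^sub>m (fst U) - ?f * ?g) = 1\<^sub>m (fst U) - ?f * ?g"
    by (subst mat_op_inject) (simp_all add: mat_op_simps(1-3,5-9) mat_op_mult[of "1\<^sub>m (fst U) - _"] dd algebra_simps fg)
  obtain U' W' k k' l l' where fd': "U' \<in> fdmods H" and k: "mod_hom U' U k" and l: "mod_hom U U' l"
    and lk: "l * k = 1\<^sub>m (fst U')" and kl: "k * l = 1\<^sub>m (fst U) - ?f * ?g"
    by (rule idempotent_dsum[OF fd(4) E idem'])
  note dk = mod_hom_dim[OF k] mod_hom_dim[OF l]
  note dd = dd dk
  let ?i = "mat_op i" and ?j = "mat_op j" and ?p = "mat_op p" and ?q = "mat_op q"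
  let ?a = "mat_op a" and ?b = "mat_op b" and ?c = "mat_op c" and ?d = "mat_op d" and ?v = "mat_op v"
  let ?k = "mat_op k" and ?l = "mat_op l"
  have lk': "?l * ?k = mat_op (1\<^sub>m (fst U'))"
    using arg_cong[OF lk, of mat_op] by (simp add: mat_op_simps dd)
  have kl': "?k * ?l = mat_op (1\<^sub>m (fst U)) - ?c * (?i * (?v * (?p * ?a)))"
    using arg_cong[OF kl, of mat_op] by (simp add: mat_op_simps dd)
  have gf': "?v * (?p * (?a * (?c * ?i))) = mat_op (1\<^sub>m (fst M))"
    using R(9) by simp
  have gf'': "?v * (?p * (?a * (?c * (?i * x)))) = mat_op (1\<^sub>m (fst M)) * x" for x
    using arg_cong[OF gf', of "\<lambda>y. y * x"] by (simp add: mult.assoc)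
  note R = R(1-8) R(1-8)[THEN mult_extend] lk' lk'[THEN mult_extend] gf' gf''
  have "?l * (?k * ?l) * (?c * ?i) = ?l * (?c * ?i)"
    by (simp add: R mat_op_simps dd flip: mult.assoc)
  then have lf: "?l * (?c * ?i) = 0"
    unfolding kl' by (simp add: R mat_op_simps dd algebra_simps)
  have lf': "?l * (?c * (?i * x)) = 0" for x
    using arg_cong[OF lf, of "\<lambda>y. y * x"] by (simp add: mult.assoc)
  have "(?v * (?p * ?a)) * (?k * ?l) * ?k = ?v * (?p * (?a * ?k))"
    by (simp add: R mat_op_simps dd)
  then have gk: "?v * (?p * (?a * ?k)) = 0"
    unfolding kl' by (simp add: R mat_op_simps dd algebra_simps)
  have gk': "?v * (?p * (?a * (?k * x))) = 0" for x
    using arg_cong[OF gk, of "\<lambda>y. y * x"] by (simp add: mult.assoc)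
  note R = R lf lf' gk gk'
  have "is_dsum U M U'"
    by (rule is_dsumI[OF f k g l gf lk]; subst mat_op_inject) (simp_all add: mat_op_simps dd R kl' algebra_simps)
  \<comment> \<open>Subtracting \<open>d * i * (?g * (c * j))\<close> from \<open>d * j\<close>
    makes the projection onto W vanish on the image of U' in X, because \<open>?g * (c * i)\<close>
    is the identity and \<open>?g * k\<close> is zero.\<close>
  moreover have "is_dsum X U' W"
  proof (rule is_dsumI[of _ _ "q * a * k" _ "q * b" "l * c * j" "d * j - d * i * (?g * (c * j))"])
    show "mod_hom U' X (q * a * k)" "mod_hom W X (q * b)" "mod_hom X U' (l * c * j)"
      using mod_hom_comp fd fd' h h' k l by blast+
    show "mod_hom X W (d * j - d * i * (?g * (c * j)))"
      by (rule mod_hom_diff[OF fd(3,5) mod_hom_comp[OF fd(3,1,5) h'(4) h(2)]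
        mod_hom_comp[OF fd(3,2,5) mod_hom_comp[OF fd(2,1,5) h'(4) h(1)]
          mod_hom_comp[OF fd(3,4,2) g mod_hom_comp[OF fd(3,1,4) h'(3) h(2)]]]])
    have jq: "?j * (?q * x) = mat_op (1\<^sub>m (fst V)) * x - ?i * (?p * x)" for x
      using R5(1)[of x] by (simp add: algebra_simps)
    have bd: "?b * (?d * x) = mat_op (1\<^sub>m (fst V)) * x - ?a * (?c * x)" for x
      using R5(2)[of x] by (simp add: algebra_simps)
    have kl2: "?k * (?l * x) = mat_op (1\<^sub>m (fst U)) * x - ?c * (?i * (?v * (?p * (?a * x))))" for x
      using arg_cong[OF kl', of "\<lambda>y. y * x"] by (simp add: algebra_simps)
    show "l * c * j * (q * a * k) = 1\<^sub>m (fst U')" "l * c * j * (q * b) = 0\<^sub>m (fst U') (fst W)"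
      "(d * j - d * i * (?g * (c * j))) * (q * a * k) = 0\<^sub>m (fst W) (fst U')"
      "(d * j - d * i * (?g * (c * j))) * (q * b) = 1\<^sub>m (fst W)"
      by (subst mat_op_inject; simp add: mat_op_simps dd R jq algebra_simps)+
    show "q * a * k * (l * c * j) + q * b * (d * j - d * i * (?g * (c * j))) = 1\<^sub>m (fst X)"
      by (subst mat_op_inject) (simp_all add: mat_op_simps dd R bd kl2 algebra_simps)
  qed
  ultimately show ?thesis
    using fd' by blast
qed

text \<open>The identity of M is the sum of its passages through U and through W. Locality gives a
  left inverse v of one of them, and the second case is the first with U and W interchanged.\<close>

lemma exchange:
  assumes M: "M \<in> indecomposables H" and fd: "V \<in> fdmods H" "X \<in> fdmods H" "U \<in> fdmods H" "W \<in> fdmods H"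
    and s: "is_dsum V M X" and s': "is_dsum V U W"
  shows "(\<exists>U'\<in>fdmods H. is_dsum U M U' \<and> is_dsum X U' W) \<or> (\<exists>W'\<in>fdmods H. is_dsum W M W' \<and> is_dsum X W' U)"
proof -
  have fM: "M \<in> fdmods H"
    using M by (rule indecomposablesD)
  obtain i j p q where h: "mod_hom M V i" "mod_hom X V j" "mod_hom V M p" "mod_hom V X q"
    and e: "p * i = 1\<^sub>m (fst M)" "q * j = 1\<^sub>m (fst X)" "p * j = 0\<^sub>m (fst M) (fst X)" "q * i = 0\<^sub>m (fst X) (fst M)"
    "i * p + j * q = 1\<^sub>m (fst V)"
    by (rule is_dsumE[OF s])
  obtain a b c d where h': "mod_hom U V a" "mod_hom W V b" "mod_hom V U c" "mod_hom V W d"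
    and e': "c * a = 1\<^sub>m (fst U)" "d * b = 1\<^sub>m (fst W)" "c * b = 0\<^sub>m (fst U) (fst W)" "d * a = 0\<^sub>m (fst W) (fst U)"
    "a * c + b * d = 1\<^sub>m (fst V)"
    by (rule is_dsumE[OF s'])
  note dd = h[THEN mod_hom_dim(1)] h[THEN mod_hom_dim(2)] h'[THEN mod_hom_dim(1)] h'[THEN mod_hom_dim(2)]
  have e5: "b * d + a * c = 1\<^sub>m (fst V)"
    using e'(5) comm_add_mat[OF carrier_matI carrier_matI, of "b * d" "fst V" "fst V" "a * c"] dd by simp
  have hom: "mod_hom M M (p * a * (c * i))" "mod_hom M M (p * b * (d * i))"
    by (rule mod_hom_comp[OF fM fd(3) fM mod_hom_comp[OF fd(3,1) fM h(3) h'(1)] mod_hom_comp[OF fM fd(1,3) h'(3) h(1)]],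
        rule mod_hom_comp[OF fM fd(4) fM mod_hom_comp[OF fd(4,1) fM h(3) h'(2)] mod_hom_comp[OF fM fd(1,4) h'(4) h(1)]])
  have "p * a * (c * i) + p * b * (d * i) = p * (a * c + b * d) * i"
    by (subst mat_op_inject) (simp_all add: mat_op_simps dd algebra_simps)
  also have "\<dots> = 1\<^sub>m (fst M)"
    using dd e'(5) e(1) by simp
  finally have "p * a * (c * i) + p * b * (d * i) = 1\<^sub>m (fst M)" .
  from indecomposable_local[OF M hom this] obtain v where v: "mod_hom M M v"
    and "v * (p * a * (c * i)) = 1\<^sub>m (fst M) \<or> v * (p * b * (d * i)) = 1\<^sub>m (fst M)"
    by blast
  then show ?thesis
    using exchange_left[OF fd(1) fM fd(2-4) h e h' e' v]
      exchange_left[OF fd(1) fM fd(2,4,3) h e h'(2,1,4,3) e'(2,1,4,3) e5 v] by argo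
qed

text \<open>Exchange between M + X and M + Y. If M replaces the summand M, the remainder has
  dimension zero and X is Y; if M is split off Y with complement W', then X and Y are both sums of M
  and W'.\<close>

lemma dsum_cancel:
  assumes M: "M \<in> indecomposables H" and fd: "V \<in> fdmods H" "X \<in> fdmods H" "Y \<in> fdmods H"
    and s: "is_dsum V M X" and s': "is_dsum V M Y"
  shows "mod_iso X Y"
proof -
  have fM: "M \<in> fdmods H"
    using M by (rule indecomposablesD)
  consider (1) U' where "U' \<in> fdmods H" "is_dsum M M U'" "is_dsum X U' Y"
    | (2) W' where "W' \<in> fdmods H" "is_dsum Y M W'" "is_dsum X W' M"
    using exchange[OF M fd(1,2) fM fd(3) s s'] by blast
  then show ?thesis
  proof cases
    case 1
    then have "fst U' = 0"
      using is_dsum_dim[OF fM fM, of U'] by simp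
    then show ?thesis
      using is_dsum_zero_iso[OF fd(2,3) 1(1) is_dsum_commute[OF 1(3)]] by simp
  next
    case 2
    then show ?thesis
      using is_dsum_unique[OF fd(2,3) fM 2(1)] is_dsum_commute[OF 2(3)] by blast
  qed
qed

section \<open>Multiplicities of indecomposable modules\<close>

inductive has_mult for H :: "('k::field, 'h::ring_1) hopf" and M where
  has_mult_0: "V \<in> fdmods H \<Longrightarrow> \<not> (\<exists>X\<in>fdmods H. is_dsum V M X) \<Longrightarrow> has_mult H M V 0"
| has_mult_Suc: "V \<in> fdmods H \<Longrightarrow> X \<in> fdmods H \<Longrightarrow> is_dsum V M X \<Longrightarrow> has_mult H M X n \<Longrightarrow> has_mult H M V (Suc n)"

text \<open>Complements are determined only up to isomorphism, so splitting off copies of M one at a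
  time is a relation first; \<open>has_mult_exists\<close> and \<open>has_mult_unique\<close> turn
  the count into a function.\<close>

definition multiplicity_in :: "('k::field, 'h::ring_1) hopf \<Rightarrow> ('k, 'h) fdmod \<Rightarrow> ('k, 'h) fdmod \<Rightarrow> nat" where
  "multiplicity_in H M V = (THE n. has_mult H M V n)"

lemma has_mult_fdmods: "has_mult H M V n \<Longrightarrow> V \<in> fdmods H"
  by (auto elim: has_mult.cases)

text \<open>The statement ranges over isomorphic V' because two runs of the splitting reach
  complements that cancellation identifies only up to isomorphism; the induction has to absorb
  this.\<close>

lemma has_mult_unique:
  assumes M: "M \<in> indecomposables H"
  shows "has_mult H M V n \<Longrightarrow> V' \<in> fdmods H \<Longrightarrow> mod_iso V V' \<Longrightarrow> has_mult H M V' m \<Longrightarrow> n = m"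
proof (induction arbitrary: V' m rule: has_mult.induct)
  case (has_mult_0 V)
  from has_mult_0.prems(3) show ?case
  proof cases
    case (has_mult_Suc X k)
    then show ?thesis
      using has_mult_0 is_dsum_iso[OF has_mult_0.hyps(1) has_mult_0.prems(1) indecomposablesD(1)[OF M] _ has_mult_0.prems(2)] by blast
  qed simp
next
  case (has_mult_Suc V X n)
  from has_mult_Suc.prems(3) show ?case
  proof cases
    case has_mult_0
    then show ?thesis
      using has_mult_Suc.hyps has_mult_Suc.prems(2) is_dsum_iso[OF _ _ indecomposablesD(1)[OF M]] mod_iso_sym by blast
  next
    case X': (has_mult_Suc X' k)
    then have "is_dsum V M X'"
      using is_dsum_iso[OF has_mult_Suc.hyps(1) has_mult_Suc.prems(1) indecomposablesD(1)[OF M]] has_mult_Suc.prems(2) by blast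
    then have "mod_iso X X'"
      by (rule dsum_cancel[OF M has_mult_Suc.hyps(1,2) X'(3) has_mult_Suc.hyps(3)])
    then show ?thesis
      using has_mult_Suc.IH X' by blast
  qed
qed

lemma has_mult_exists:
  assumes M: "M \<in> indecomposables H"
  shows "V \<in> fdmods H \<Longrightarrow> \<exists>n. has_mult H M V n"
proof (induction "fst V" arbitrary: V rule: less_induct)
  case less
  show ?case
  proof (cases "\<exists>X\<in>fdmods H. is_dsum V M X")
    case True
    then obtain X where X: "X \<in> fdmods H" "is_dsum V M X"
      by blast
    then have "fst X < fst V"
      using is_dsum_dim[OF less(2) indecomposablesD(1)[OF M] X] indecomposablesD(2)[OF M] by simp
    then show ?thesis
      using less(1)[OF _ X(1)] has_mult_Suc[OF less(2) X] by blast
  qed (use has_mult_0 less in blast)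
qed

lemma multiplicity_in_eq: "M \<in> indecomposables H \<Longrightarrow> has_mult H M V n \<Longrightarrow> multiplicity_in H M V = n"
  unfolding multiplicity_in_def
  by (rule the_equality) (auto dest: has_mult_unique has_mult_fdmods mod_iso_refl)

lemma has_mult_multiplicity_in:
  "M \<in> indecomposables H \<Longrightarrow> V \<in> fdmods H \<Longrightarrow> has_mult H M V (multiplicity_in H M V)"
  using has_mult_exists multiplicity_in_eq by metis

lemma multiplicity_in_iso:
  "M \<in> indecomposables H \<Longrightarrow> V \<in> fdmods H \<Longrightarrow> W \<in> fdmods H \<Longrightarrow> mod_iso V W \<Longrightarrow> multiplicity_in H M V = multiplicity_in H M W"
  using has_mult_unique[of M H V "multiplicity_in H M V" W "multiplicity_in H M W"] has_mult_multiplicity_in by blast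

text \<open>By exchange, a copy of M that splits off V must split off W or U. Since none splits off
  U, the count for V stops exactly when the count for W does.\<close>

lemma has_mult_dsum_0:
  assumes M: "M \<in> indecomposables H" and U: "U \<in> fdmods H" "\<not> (\<exists>X\<in>fdmods H. is_dsum U M X)"
  shows "has_mult H M W n \<Longrightarrow> V \<in> fdmods H \<Longrightarrow> is_dsum V W U \<Longrightarrow> has_mult H M V n"
proof (induction arbitrary: V rule: has_mult.induct)
  case (has_mult_0 W)
  show ?case
    using exchange[OF M has_mult_0.prems(1) _ has_mult_0.hyps(1) U(1) _ has_mult_0.prems(2)] has_mult_0 U
    by (blast intro: has_mult.has_mult_0)
next
  case (has_mult_Suc W X n)
  have fX: "mod_dsum X U \<in> fdmods H" "is_dsum (mod_dsum X U) X U"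
    using has_mult_Suc.hyps U by (auto intro: mod_dsum_fdmods is_dsum_mod_dsum)
  then have "is_dsum V M (mod_dsum X U)"
    using is_dsum_assoc[OF has_mult_Suc.hyps(1) U(1) indecomposablesD(1)[OF M] has_mult_Suc.hyps(2) has_mult_Suc.prems(1) fX(1)
        has_mult_Suc.prems(2) has_mult_Suc.hyps(3) fX(2)] by blast
  then show ?case
    using has_mult_Suc.IH[OF fX] has_mult.has_mult_Suc has_mult_Suc.prems(1) fX(1) by blast
qed

lemma has_mult_dsum:
  assumes M: "M \<in> indecomposables H"
  shows "has_mult H M U m \<Longrightarrow> has_mult H M W n \<Longrightarrow> V \<in> fdmods H \<Longrightarrow> is_dsum V U W \<Longrightarrow> has_mult H M V (m + n)"
proof (induction arbitrary: V rule: has_mult.induct)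
  case (has_mult_0 U)
  then show ?case
    using has_mult_dsum_0[OF M has_mult_0.hyps(1,2) has_mult_0.prems(1,2) is_dsum_commute[OF has_mult_0.prems(3)]] by simp
next
  case (has_mult_Suc U X m)
  have W: "W \<in> fdmods H"
    using has_mult_Suc.prems(1) by (rule has_mult_fdmods)
  have fX: "mod_dsum X W \<in> fdmods H" "is_dsum (mod_dsum X W) X W"
    using has_mult_Suc.hyps W by (auto intro: mod_dsum_fdmods is_dsum_mod_dsum)
  then have "is_dsum V M (mod_dsum X W)"
    using is_dsum_assoc[OF has_mult_Suc.hyps(1) W indecomposablesD(1)[OF M] has_mult_Suc.hyps(2) has_mult_Suc.prems(2) fX(1)
        has_mult_Suc.prems(3) has_mult_Suc.hyps(3) fX(2)] by blast
  then show ?case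
    using has_mult.has_mult_Suc[OF has_mult_Suc.prems(2) fX(1)] has_mult_Suc.IH[OF has_mult_Suc.prems(1) fX] by simp
qed

lemma multiplicity_in_dsum:
  assumes "M \<in> indecomposables H" "V \<in> fdmods H" "U \<in> fdmods H" "W \<in> fdmods H" "is_dsum V U W"
  shows "multiplicity_in H M V = multiplicity_in H M U + multiplicity_in H M W"
  using assms by (intro multiplicity_in_eq has_mult_dsum[of M H U _ W] has_mult_multiplicity_in)

lemma zero_mod_fdmods: "(0, \<lambda>_. 0\<^sub>m 0 0) \<in> fdmods H"
  by (auto simp: fdmods_def intro!: eq_matI)

lemma multiplicity_in_zero:
  assumes M: "M \<in> indecomposables H" and V: "V \<in> fdmods H" "fst V = 0"
  shows "multiplicity_in H M V = 0"
proof (rule multiplicity_in_eq[OF M has_mult_0[OF V(1)]])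
  show "\<not> (\<exists>X\<in>fdmods H. is_dsum V M X)"
    using is_dsum_dim[OF V(1) indecomposablesD(1)[OF M]] indecomposablesD(2)[OF M] V(2) by fastforce
qed

lemma multiplicity_in_indecomposable:
  assumes M: "M \<in> indecomposables H" and N: "N \<in> indecomposables H"
  shows "multiplicity_in H M N = (if mod_iso M N then 1 else 0)"
proof -
  note fM = indecomposablesD[OF M] and fN = indecomposablesD[OF N]
  have *: "mod_iso M N" "fst X = 0" if "X \<in> fdmods H" "is_dsum N M X" for X
  proof -
    show X: "fst X = 0"
      using indecomposable_dsum[OF N fM(1) that] fM(2) by simp
    show "mod_iso M N"
      by (rule mod_iso_sym[OF fN(1) fM(1) is_dsum_zero_iso[OF fN(1) fM(1) that X]])
  qed
  show ?thesis
  proof (cases "mod_iso M N")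
    case True
    let ?Z = "(0, \<lambda>_. 0\<^sub>m 0 0)"
    have "is_dsum M M ?Z"
      by (rule is_dsum_zero[OF fM(1) zero_mod_fdmods]) simp
    then have "multiplicity_in H M M = multiplicity_in H M M + multiplicity_in H M ?Z" and s: "is_dsum N M ?Z"
      using multiplicity_in_dsum[OF M fM(1,1) zero_mod_fdmods]
        is_dsum_iso[OF fN(1) fM(1) fM(1) zero_mod_fdmods mod_iso_sym[OF fM(1) fN(1) True]] by blast+
    have "has_mult H M ?Z 0"
      using has_mult_multiplicity_in[OF M zero_mod_fdmods] multiplicity_in_zero[OF M zero_mod_fdmods] by simp
    then show ?thesis
      using multiplicity_in_eq[OF M has_mult_Suc[OF fN(1) zero_mod_fdmods s]] True by simp
  next
    case False
    then have "\<not> (\<exists>X\<in>fdmods H. is_dsum N M X)"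
      using *(1) by blast
    then show ?thesis
      using multiplicity_in_eq[OF M has_mult_0[OF fN(1)]] False by simp
  qed
qed

text \<open>The existence half of Krull--Schmidt as an induction rule: a module that is neither zero
  nor indecomposable splits into two modules of smaller dimension.\<close>

lemma fdmods_dsum_induct [consumes 1, case_names zero indecomposable dsum]:
  assumes V: "V \<in> fdmods H"
    and 0: "\<And>V. V \<in> fdmods H \<Longrightarrow> fst V = 0 \<Longrightarrow> P V"
    and 1: "\<And>V. V \<in> indecomposables H \<Longrightarrow> P V"
    and 2: "\<And>V U W. V \<in> fdmods H \<Longrightarrow> U \<in> fdmods H \<Longrightarrow> W \<in> fdmods H \<Longrightarrow> is_dsum V U W \<Longrightarrow> P U \<Longrightarrow> P W \<Longrightarrow> P V"
  shows "P V"
  using V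
proof (induction "fst V" arbitrary: V rule: less_induct)
  case less
  consider "fst V = 0" | "V \<in> indecomposables H" | "fst V \<noteq> 0" "V \<notin> indecomposables H"
    by blast
  then show ?case
  proof cases
    case 3
    then obtain U W where UW: "U \<in> fdmods H" "W \<in> fdmods H" "mod_iso V (mod_dsum U W)" "fst U \<noteq> 0" "fst W \<noteq> 0"
      using less(2) unfolding indecomposables_def by blast
    then have s: "is_dsum V U W"
      using mod_iso_mod_dsum_iff[OF less(2)] by blast
    then have "fst V = fst U + fst W"
      by (rule is_dsum_dim[OF less(2) UW(1,2)])
    then show ?thesis
      using 2[OF less(2) UW(1,2) s] less(1) UW by simp
  qed (use 0 1 less in auto)
qed

section \<open>Sweedler sums\<close>

text \<open>Serves two purposes: evaluating formal tensors at a biadditive map, and extending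
  invariants of modules to formal sums of modules.\<close>

definition frag_eval :: "('a \<Rightarrow> 'b::ring_1) \<Rightarrow> ('a \<Rightarrow>\<^sub>0 int) \<Rightarrow> 'b" where
  "frag_eval f c = (\<Sum>k\<in>Poly_Mapping.keys c. of_int (Poly_Mapping.lookup c k) * f k)"

lemma frag_eval_superset:
  "finite K \<Longrightarrow> Poly_Mapping.keys c \<subseteq> K \<Longrightarrow> frag_eval f c = (\<Sum>k\<in>K. of_int (Poly_Mapping.lookup c k) * f k)"
  unfolding frag_eval_def by (rule sum.mono_neutral_left) (auto simp: in_keys_iff)

lemma frag_eval_add: "frag_eval f (c + d) = frag_eval f c + frag_eval f d"
proof -
  let ?K = "Poly_Mapping.keys c \<union> Poly_Mapping.keys d"
  have "frag_eval f (c + d) = (\<Sum>k\<in>?K. of_int (Poly_Mapping.lookup (c + d) k) * f k)"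
    by (rule frag_eval_superset) (auto dest: subsetD[OF Poly_Mapping.keys_add])
  also have "\<dots> = frag_eval f c + frag_eval f d"
    by (simp add: frag_eval_superset[of ?K] lookup_add distrib_right sum.distrib)
  finally show ?thesis .
qed

lemma frag_eval_0 [simp]: "frag_eval f 0 = 0"
  by (simp add: frag_eval_def)

lemma frag_eval_of [simp]: "frag_eval f (frag_of x) = f x"
  by (simp add: frag_eval_def)

lemma frag_eval_minus: "frag_eval f (- c) = - frag_eval f c"
  using frag_eval_add[of f c "- c"] by (simp add: eq_neg_iff_add_eq_0 add.commute)

lemma frag_eval_diff: "frag_eval f (c - d) = frag_eval f c - frag_eval f d"
  using frag_eval_add[of f "c - d" d] by simp

lemma frag_eval_generate:
  assumes c: "c \<in> generate (free_Abelian_group A) S" and S: "\<And>s. s \<in> S \<Longrightarrow> Poly_Mapping.keys s \<subseteq> A"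
    and z: "\<And>s. s \<in> S \<Longrightarrow> frag_eval f s = 0"
  shows "frag_eval f c = 0"
  using c by induction (auto simp: z S frag_eval_add frag_eval_minus)

lemma frag_eval_formal_sum: "frag_eval f (formal_sum xs) = (\<Sum>x\<leftarrow>xs. f x)"
  by (induction xs) (auto simp: formal_sum_def frag_eval_add)

text \<open>The universal property of the tensor product: a balanced biadditive f kills the
  generators of \<open>tensor2_null\<close>. Every axiom on the representatives
  \<open>comult H x\<close> thereby becomes an identity between Sweedler sums.\<close>

lemma tensor2_eq_sum:
  fixes f :: "'h::ab_group_add \<Rightarrow> 'h \<Rightarrow> 'b::ring_1"
  assumes eq: "tensor2_eq s xs ys"
    and add: "\<And>a a' b. f (a + a') b = f a b + f a' b" "\<And>a b b'. f a (b + b') = f a b + f a b'"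
    and bal: "\<And>c a b. f (s c a) b = f a (s c b)"
  shows "(\<Sum>(a, b)\<leftarrow>xs. f a b) = (\<Sum>(a, b)\<leftarrow>ys. f a b)"
proof -
  have "frag_eval (\<lambda>(a, b). f a b) (formal_sum xs - formal_sum ys) = 0"
    using eq unfolding tensor2_eq_def tensor2_null_def
    by (rule frag_eval_generate) (auto simp: frag_eval_diff add bal)
  then show ?thesis
    by (simp add: frag_eval_diff frag_eval_formal_sum)
qed

lemma tensor3_eq_sum:
  fixes f :: "'h::ab_group_add \<Rightarrow> 'h \<Rightarrow> 'h \<Rightarrow> 'b::ring_1"
  assumes eq: "tensor3_eq s xs ys"
    and add: "\<And>a a' b c. f (a + a') b c = f a b c + f a' b c" "\<And>a b b' c. f a (b + b') c = f a b c + f a b' c"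
      "\<And>a b c c'. f a b (c + c') = f a b c + f a b c'"
    and bal: "\<And>r a b c. f (s r a) b c = f a (s r b) c" "\<And>r a b c. f a (s r b) c = f a b (s r c)"
  shows "(\<Sum>(a, b, c)\<leftarrow>xs. f a b c) = (\<Sum>(a, b, c)\<leftarrow>ys. f a b c)"
proof -
  have "frag_eval (\<lambda>(a, b, c). f a b c) (formal_sum xs - formal_sum ys) = 0"
    using eq unfolding tensor3_eq_def tensor3_null_def
    by (rule frag_eval_generate) (auto simp: frag_eval_diff add bal)
  then show ?thesis
    by (simp add: frag_eval_diff frag_eval_formal_sum)
qed

lemma sum_list_concat_map: "(\<Sum>z\<leftarrow>concat (map g xs). f z) = (\<Sum>x\<leftarrow>xs. \<Sum>z\<leftarrow>g x. f z)"
  by (induction xs) auto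

lemma sum_list_swap: "(\<Sum>x\<leftarrow>xs. \<Sum>y\<leftarrow>ys. f x y) = (\<Sum>y\<leftarrow>ys. \<Sum>x\<leftarrow>xs. (f x y :: 'b::comm_monoid_add))"
  by (induction xs) (auto simp: sum_list_addf)

lemma sum_list_additive:
  fixes F :: "'a::ab_group_add \<Rightarrow> 'b::ab_group_add"
  assumes "\<And>a b. F (a + b) = F a + F b"
  shows "F (\<Sum>x\<leftarrow>xs. g x) = (\<Sum>x\<leftarrow>xs. F (g x))"
proof (induction xs)
  case Nil
  show ?case
    using assms[of 0 0] by simp
qed (simp add: assms)

context hopf_algebra
begin

lemma antipode_add: "antipode H (x + y) = antipode H x + antipode H y"
  using antipode_linear by (simp add: linear_iff_module_hom module_hom.add)

lemma antipode_scale: "antipode H (hscale H c x) = hscale H c (antipode H x)"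
  using antipode_linear by (simp add: linear_iff_module_hom module_hom.scale)

lemma counit_add: "counit H (x + y) = counit H x + counit H y"
  using counit_linear by (simp add: linear_iff_module_hom module_hom.add)

lemma counit_scale: "counit H (hscale H c x) = c * counit H x"
  using counit_linear by (simp add: linear_iff_module_hom module_hom.scale)

lemmas scale_simps = scale_mult_left scale_mult_right scale_right_distrib scale_left_distrib

lemma comult_mult_sum:
  fixes f :: "'h \<Rightarrow> 'h \<Rightarrow> 'b::ring_1"
  assumes add: "\<And>a a' b. f (a + a') b = f a b + f a' b" "\<And>a b b'. f a (b + b') = f a b + f a b'"
    and bal: "\<And>c a b. f (hscale H c a) b = f a (hscale H c b)"
  shows "(\<Sum>(a, b)\<leftarrow>comult H (x * y). f a b) = (\<Sum>(a, b)\<leftarrow>comult H x. \<Sum>(a', b')\<leftarrow>comult H y. f (a * a') (b * b'))"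
  unfolding tensor2_eq_sum[OF comult_mult[of x y], of f, OF add bal] sum_list_concat_map
  by (simp only: case_prod_unfold map_map comp_def fst_conv snd_conv)

lemma comult_add_sum:
  fixes f :: "'h \<Rightarrow> 'h \<Rightarrow> 'b::ring_1"
  assumes add: "\<And>a a' b. f (a + a') b = f a b + f a' b" "\<And>a b b'. f a (b + b') = f a b + f a b'"
    and bal: "\<And>c a b. f (hscale H c a) b = f a (hscale H c b)"
  shows "(\<Sum>(a, b)\<leftarrow>comult H (x + y). f a b) = (\<Sum>(a, b)\<leftarrow>comult H x. f a b) + (\<Sum>(a, b)\<leftarrow>comult H y. f a b)"
  unfolding tensor2_eq_sum[OF comult_add[of x y], of f, OF add bal] by simp

lemma comult_scale_sum:
  fixes f :: "'h \<Rightarrow> 'h \<Rightarrow> 'b::ring_1"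
  assumes add: "\<And>a a' b. f (a + a') b = f a b + f a' b" "\<And>a b b'. f a (b + b') = f a b + f a b'"
    and bal: "\<And>c a b. f (hscale H c a) b = f a (hscale H c b)"
  shows "(\<Sum>(a, b)\<leftarrow>comult H (hscale H c x). f a b) = (\<Sum>(a, b)\<leftarrow>comult H x. f (hscale H c a) b)"
  unfolding tensor2_eq_sum[OF comult_scale[of c x], of f, OF add bal]
  by (simp only: case_prod_unfold map_map comp_def fst_conv snd_conv)

lemma comult_one_sum:
  fixes f :: "'h \<Rightarrow> 'h \<Rightarrow> 'b::ring_1"
  assumes add: "\<And>a a' b. f (a + a') b = f a b + f a' b" "\<And>a b b'. f a (b + b') = f a b + f a b'"
    and bal: "\<And>c a b. f (hscale H c a) b = f a (hscale H c b)"
  shows "(\<Sum>(a, b)\<leftarrow>comult H 1. f a b) = f 1 1"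
  unfolding tensor2_eq_sum[OF comult_one, of f, OF add bal] by simp

lemma coassoc_sum:
  fixes f :: "'h \<Rightarrow> 'h \<Rightarrow> 'h \<Rightarrow> 'b::ring_1"
  assumes add: "\<And>a a' b c. f (a + a') b c = f a b c + f a' b c" "\<And>a b b' c. f a (b + b') c = f a b c + f a b' c"
      "\<And>a b c c'. f a b (c + c') = f a b c + f a b c'"
    and bal: "\<And>r a b c. f (hscale H r a) b c = f a (hscale H r b) c" "\<And>r a b c. f a (hscale H r b) c = f a b (hscale H r c)"
  shows "(\<Sum>(a, b)\<leftarrow>comult H x. \<Sum>(a', a'')\<leftarrow>comult H a. f a' a'' b) =
    (\<Sum>(a, b)\<leftarrow>comult H x. \<Sum>(b', b'')\<leftarrow>comult H b. f a b' b'')"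
  using tensor3_eq_sum[OF coassoc[of x], of f, OF add bal] unfolding sum_list_concat_map
  by (simp only: case_prod_unfold map_map comp_def fst_conv snd_conv)

lemma antipode_one: "antipode H 1 = 1"
proof -
  have "(\<Sum>(a, b)\<leftarrow>comult H 1. antipode H a * b) = antipode H 1 * 1"
    by (rule comult_one_sum) (simp_all add: antipode_add antipode_scale scale_simps distrib_left distrib_right)
  then show ?thesis
    by (simp add: antipode_left counit_one)
qed

lemma counit_sum_left: "(\<Sum>(a, b)\<leftarrow>comult H x. hscale H (counit H a) (F b)) = F x"
  if "\<And>a b. F (a + b) = F a + F b" "\<And>c a. F (hscale H c a) = hscale H c (F a)" for F :: "'h \<Rightarrow> 'h"
  using arg_cong[OF counit_left[of x], of F] sum_list_additive[of F "\<lambda>p. hscale H (counit H (fst p)) (snd p)" "comult H x", OF that(1)]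
  by (simp add: case_prod_unfold that(2))

lemma counit_sum_right: "(\<Sum>(a, b)\<leftarrow>comult H x. hscale H (counit H b) (F a)) = F x"
  if "\<And>a b. F (a + b) = F a + F b" "\<And>c a. F (hscale H c a) = hscale H c (F a)" for F :: "'h \<Rightarrow> 'h"
  using arg_cong[OF counit_right[of x], of F] sum_list_additive[of F "\<lambda>p. hscale H (counit H (snd p)) (fst p)" "comult H x", OF that(1)]
  by (simp add: case_prod_unfold that(2))

text \<open>
  Both \<open>S(x y)\<close> and \<open>S(y) S(x)\<close> are convolution inverses of the multiplication, so both agree with
  \<open>\<Sum> S(x\<^sub>1 y\<^sub>1) x\<^sub>2 y\<^sub>2 S(y\<^sub>3) S(x\<^sub>3)\<close>.
\<close>

lemma antipode_mult: "antipode H (x * y) = antipode H y * antipode H x"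
proof -
  let ?S = "antipode H" and ?D = "comult H" and ?e = "counit H"
  define f where "f a1 a2 b c1 c2 d = ?S (a1 * c1) * (a2 * c2) * (?S d * ?S b)" for a1 a2 b c1 c2 d
  note lin = f_def antipode_add antipode_scale scale_simps distrib_left distrib_right
  have A: "(\<Sum>(a', a'')\<leftarrow>?D a. \<Sum>(c', c'')\<leftarrow>?D c. f a' a'' b c' c'' d) = hscale H (?e a * ?e c) (?S d * ?S b)" for a b c d
  proof -
    have "(\<Sum>(a', a'')\<leftarrow>?D a. \<Sum>(c', c'')\<leftarrow>?D c. f a' a'' b c' c'' d) =
        (\<Sum>(u, v)\<leftarrow>?D (a * c). ?S u * v) * (?S d * ?S b)"
      unfolding f_def case_prod_unfold sum_list_mult_const
      by (subst comult_mult_sum[unfolded case_prod_unfold]) (simp_all add: lin)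
    then show ?thesis
      by (simp add: antipode_left counit_mult scale_mult_left)
  qed
  have B: "(\<Sum>(d', d'')\<leftarrow>?D d. f a b' b'' c d' d'') = hscale H (?e d) (?S (a * c) * (b' * ?S b''))" for a b' b'' c d
  proof -
    have "(\<Sum>(d', d'')\<leftarrow>?D d. f a b' b'' c d' d'') = ?S (a * c) * b' * (\<Sum>(d', d'')\<leftarrow>?D d. d' * ?S d'') * ?S b''"
      by (simp add: f_def case_prod_unfold sum_list_mult_const[symmetric] sum_list_const_mult[symmetric] mult.assoc)
    then show ?thesis
      by (simp add: antipode_right scale_simps mult.assoc)
  qed
  have "(\<Sum>(a, b)\<leftarrow>?D x. \<Sum>(a', a'')\<leftarrow>?D a. \<Sum>(c, d)\<leftarrow>?D y. \<Sum>(c', c'')\<leftarrow>?D c. f a' a'' b c' c'' d) =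
      (\<Sum>(a, b)\<leftarrow>?D x. \<Sum>(c, d)\<leftarrow>?D y. hscale H (?e a * ?e c) (?S d * ?S b))"
    unfolding A[symmetric] by (simp add: case_prod_unfold sum_list_swap[of _ "?D y"])
  also have "\<dots> = (\<Sum>(a, b)\<leftarrow>?D x. hscale H (?e a) (?S y * ?S b))"
  proof -
    have "(\<Sum>(c, d)\<leftarrow>?D y. hscale H (?e a * ?e c) (?S d * ?S b)) = hscale H (?e a) (?S y * ?S b)" for a b
      using counit_sum_left[where x = y and F = "\<lambda>d. hscale H (?e a) (?S d * ?S b)"]
      by (simp add: antipode_add antipode_scale scale_simps distrib_right mult.commute)
    then show ?thesis
      by simp
  qed
  also have "\<dots> = ?S y * ?S x"
    by (rule counit_sum_left) (simp_all add: antipode_add antipode_scale scale_simps distrib_left)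
  finally have 1: "(\<Sum>(a, b)\<leftarrow>?D x. \<Sum>(a', a'')\<leftarrow>?D a. \<Sum>(c, d)\<leftarrow>?D y. \<Sum>(c', c'')\<leftarrow>?D c. f a' a'' b c' c'' d) = ?S y * ?S x" .
  \<comment> \<open>Coassociativity in x and then in y regroups the same sum, so that now the
    factors x_2 y_2 S(y_3) S(x_3) collapse instead of S(x_1 y_1) x_2 y_2.\<close>
  have "(\<Sum>(a, b)\<leftarrow>?D x. \<Sum>(a', a'')\<leftarrow>?D a. \<Sum>(c, d)\<leftarrow>?D y. \<Sum>(c', c'')\<leftarrow>?D c. f a' a'' b c' c'' d) =
      (\<Sum>(a, b)\<leftarrow>?D x. \<Sum>(b', b'')\<leftarrow>?D b. \<Sum>(c, d)\<leftarrow>?D y. \<Sum>(c', c'')\<leftarrow>?D c. f a b' b'' c' c'' d)"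
    by (rule coassoc_sum[where f = "\<lambda>a' a'' b. \<Sum>(c, d)\<leftarrow>?D y. \<Sum>(c', c'')\<leftarrow>?D c. f a' a'' b c' c'' d"])
      (simp_all add: lin case_prod_unfold sum_list_addf)
  also have "\<dots> = (\<Sum>(a, b)\<leftarrow>?D x. \<Sum>(b', b'')\<leftarrow>?D b. \<Sum>(c, d)\<leftarrow>?D y. \<Sum>(d', d'')\<leftarrow>?D d. f a b' b'' c d' d'')"
  proof -
    have "(\<Sum>(c, d)\<leftarrow>?D y. \<Sum>(c', c'')\<leftarrow>?D c. f a b' b'' c' c'' d) = (\<Sum>(c, d)\<leftarrow>?D y. \<Sum>(d', d'')\<leftarrow>?D d. f a b' b'' c d' d'')" for a b' b''
      by (rule coassoc_sum[where f = "\<lambda>c' c'' d. f a b' b'' c' c'' d"]) (simp_all add: lin)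
    then show ?thesis
      by simp
  qed
  also have "\<dots> = (\<Sum>(a, b)\<leftarrow>?D x. \<Sum>(b', b'')\<leftarrow>?D b. ?S (a * y) * (b' * ?S b''))"
  proof -
    have "(\<Sum>(c, d)\<leftarrow>?D y. hscale H (?e d) (?S (a * c) * (b' * ?S b''))) = ?S (a * y) * (b' * ?S b'')" for a b' b''
      by (rule counit_sum_right) (simp_all add: antipode_add antipode_scale scale_simps distrib_left distrib_right)
    then show ?thesis
      by (simp add: B)
  qed
  also have "\<dots> = (\<Sum>(a, b)\<leftarrow>?D x. hscale H (?e b) (?S (a * y)))"
  proof -
    have "(\<Sum>(b', b'')\<leftarrow>?D b. ?S (a * y) * (b' * ?S b'')) = ?S (a * y) * (\<Sum>(b', b'')\<leftarrow>?D b. b' * ?S b'')" for a b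
      by (simp add: case_prod_unfold sum_list_const_mult)
    then show ?thesis
      by (simp add: antipode_right scale_simps)
  qed
  also have "\<dots> = ?S (x * y)"
    by (rule counit_sum_right) (simp_all add: antipode_add antipode_scale scale_simps distrib_right)
  finally show ?thesis
    unfolding 1 by simp
qed

end

section \<open>Tensor products and duals of modules\<close>

text \<open>Sweedler sums take values in a \<open>ring_1\<close>, so the operator ring needs a unit.
  It is the identity on all sequences and differs from every idempotent
  \<open>mat_op (1\<^sub>m n)\<close>.\<close>

instantiation addop :: ("{ab_group_add, zero_neq_one}") ring_1
begin
lift_definition one_addop :: "'a addop" is "\<lambda>v. v" by simp
instance
proof
  fix a :: "'a addop"
  show "1 * a = a" "a * 1 = a"
    by (transfer; simp)+
  have ne: "(\<lambda>(v :: nat \<Rightarrow> 'a) (i :: nat). 0 :: 'a) \<noteq> (\<lambda>v. v)"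
  proof
    assume "(\<lambda>(v :: nat \<Rightarrow> 'a) (i :: nat). 0 :: 'a) = (\<lambda>v. v)"
    from fun_cong[OF fun_cong[OF this, of "\<lambda>_. 1"]] show False
      by simp
  qed
  show "(0::'a addop) \<noteq> 1"
    by transfer (rule ne)
qed
end

lemma additive_mat_sum:
  fixes G :: "'k::comm_monoid_add mat \<Rightarrow> 'b::comm_monoid_add"
  assumes "\<And>x. x \<in> set xs \<Longrightarrow> F x \<in> carrier_mat n m" and "G (0\<^sub>m n m) = 0"
    and "\<And>A B. A \<in> carrier_mat n m \<Longrightarrow> B \<in> carrier_mat n m \<Longrightarrow> G (A + B) = G A + G B"
  shows "G (mat n m (\<lambda>ij. \<Sum>x\<leftarrow>xs. F x $$ ij)) = (\<Sum>x\<leftarrow>xs. G (F x))"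
  using assms(1)
proof (induction xs)
  case Nil
  have "mat n m (\<lambda>ij. \<Sum>x\<leftarrow>[]. F x $$ ij) = 0\<^sub>m n m"
    by (intro eq_matI) auto
  then show ?case
    using assms(2) by simp
next
  case (Cons x xs)
  have "mat n m (\<lambda>ij. \<Sum>x\<leftarrow>x # xs. F x $$ ij) = F x + mat n m (\<lambda>ij. \<Sum>x\<leftarrow>xs. F x $$ ij)"
    using Cons.prems by (intro eq_matI) auto
  then show ?case
    using Cons assms(3) by simp
qed

section \<open>Kronecker products\<close>

lemma kron_dim [simp]: "dim_row (kron A B) = dim_row A * dim_row B" "dim_col (kron A B) = dim_col A * dim_col B"
  by (simp_all add: kron_def)

lemma kron_carrier: "A \<in> carrier_mat a b \<Longrightarrow> B \<in> carrier_mat c d \<Longrightarrow> kron A B \<in> carrier_mat (a * c) (b * d)"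
  by (intro carrier_matI) auto

lemma div_mod_less: "i < m * n \<Longrightarrow> i div n < m" "i < m * n \<Longrightarrow> i mod n < (n::nat)"
  by (auto simp: less_mult_imp_div_less) (metis mod_less_divisor mult_is_0 not_gr_zero not_less_zero)

lemma kron_index: "i < dim_row A * dim_row B \<Longrightarrow> j < dim_col A * dim_col B \<Longrightarrow>
    kron A B $$ (i, j) = A $$ (i div dim_row B, j div dim_col B) * B $$ (i mod dim_row B, j mod dim_col B)"
  by (simp add: kron_def)

lemma kron_add_left: "A \<in> carrier_mat a b \<Longrightarrow> A' \<in> carrier_mat a b \<Longrightarrow> kron (A + A') B = kron A B + kron A' B"
  by (intro eq_matI) (auto simp: kron_index div_mod_less distrib_right)

lemma kron_add_right: "B \<in> carrier_mat a b \<Longrightarrow> B' \<in> carrier_mat a b \<Longrightarrow> kron A (B + B') = kron A B + kron A B'"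
  by (intro eq_matI) (auto simp: kron_index div_mod_less distrib_left)

lemma kron_smult_left: "kron (c \<cdot>\<^sub>m A) B = c \<cdot>\<^sub>m kron A (B::'a::comm_ring_1 mat)"
  by (intro eq_matI) (auto simp: kron_index div_mod_less mult.assoc)

lemma kron_smult_right: "kron A (c \<cdot>\<^sub>m B) = c \<cdot>\<^sub>m kron A (B::'a::comm_ring_1 mat)"
  by (intro eq_matI) (auto simp: kron_index div_mod_less mult.left_commute)

lemma kron_zero_left: "kron (0\<^sub>m a b) B = 0\<^sub>m (a * dim_row B) (b * dim_col B)"
  by (intro eq_matI) (auto simp: kron_index div_mod_less)

lemma kron_zero_right: "kron B (0\<^sub>m a b) = 0\<^sub>m (dim_row B * a) (dim_col B * b)"
  by (intro eq_matI) (auto simp: kron_index div_mod_less)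

lemma kron_one: "kron (1\<^sub>m a) (1\<^sub>m b) = (1\<^sub>m (a * b) :: 'a::comm_ring_1 mat)"
proof (intro eq_matI)
  fix i j assume "i < dim_row (1\<^sub>m (a * b) :: 'a mat)" "j < dim_col (1\<^sub>m (a * b) :: 'a mat)"
  then show "kron (1\<^sub>m a) (1\<^sub>m b) $$ (i, j) = (1\<^sub>m (a * b) :: 'a mat) $$ (i, j)"
    by (auto simp: kron_index div_mod_less) (metis div_mult_mod_eq)
qed auto

lemma kron_scalar_left: "kron (mat 1 1 (\<lambda>_. c)) A = c \<cdot>\<^sub>m A"
  by (intro eq_matI) (auto simp: kron_index)

lemma kron_scalar_right: "kron A (mat 1 1 (\<lambda>_. c)) = c \<cdot>\<^sub>m (A::'a::comm_ring_1 mat)"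
  by (intro eq_matI) (auto simp: kron_index mult.commute)

lemma sum_div_mod: "(\<Sum>l<m * n. f (l div n) (l mod n)) = (\<Sum>i<m. \<Sum>j<n. f i j)"
  for f :: "nat \<Rightarrow> nat \<Rightarrow> 'a::comm_monoid_add"
proof (cases "n = 0")
  case False
  have "(\<Sum>l<m * n. f (l div n) (l mod n)) = (\<Sum>i<m. \<Sum>l\<in>{i * n..<i * n + n}. f (l div n) (l mod n))"
    by (rule sum.nat_group[symmetric])
  also have "\<dots> = (\<Sum>i<m. \<Sum>j<n. f i j)"
  proof (rule sum.cong)
    fix i
    show "(\<Sum>l\<in>{i * n..<i * n + n}. f (l div n) (l mod n)) = (\<Sum>j<n. f i j)"
      using sum.shift_bounds_nat_ivl[of "\<lambda>l. f (l div n) (l mod n)" 0 "i * n" n] False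
      by (simp add: add.commute[of n] atLeast0LessThan)
  qed simp
  finally show ?thesis .
qed simp

lemma kron_mult:
  fixes A B C D :: "'a::comm_ring_1 mat"
  assumes "dim_col A = dim_row C" "dim_col B = dim_row D"
  shows "kron A B * kron C D = kron (A * C) (B * D)"
proof (rule eq_matI)
  fix i j assume ij: "i < dim_row (kron (A * C) (B * D))" "j < dim_col (kron (A * C) (B * D))"
  let ?i = "i div dim_row B" and ?i' = "i mod dim_row B" and ?j = "j div dim_col D" and ?j' = "j mod dim_col D"
  have b: "?i < dim_row A" "?i' < dim_row B" "?j < dim_col C" "?j' < dim_col D"
    using ij by (auto simp: div_mod_less)
  have "(kron A B * kron C D) $$ (i, j) = (\<Sum>l<dim_row C * dim_row D.
      (A $$ (?i, l div dim_row D) * B $$ (?i', l mod dim_row D)) * (C $$ (l div dim_row D, ?j) * D $$ (l mod dim_row D, ?j')))"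
    using ij assms by (auto simp: scalar_prod_def atLeast0LessThan kron_index intro!: sum.cong)
  also have "\<dots> = (\<Sum>k<dim_row C. \<Sum>l<dim_row D. (A $$ (?i, k) * B $$ (?i', l)) * (C $$ (k, ?j) * D $$ (l, ?j')))"
    by (rule sum_div_mod)
  also have "\<dots> = (\<Sum>k<dim_row C. A $$ (?i, k) * C $$ (k, ?j)) * (\<Sum>l<dim_row D. B $$ (?i', l) * D $$ (l, ?j'))"
    by (simp add: sum_product mult_ac)
  also have "\<dots> = kron (A * C) (B * D) $$ (i, j)"
    using ij assms b by (simp add: kron_index scalar_prod_def atLeast0LessThan)
  finally show "(kron A B * kron C D) $$ (i, j) = kron (A * C) (B * D) $$ (i, j)" .
qed (use assms in auto)

lemma kron_assoc: "kron (kron A B) C = kron A (kron B (C::'a::comm_ring_1 mat))"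
proof (rule eq_matI)
  fix i j assume ij: "i < dim_row (kron A (kron B C))" "j < dim_col (kron A (kron B C))"
  have *: "l div c div b = l div (b * c)" "l div c mod b = l mod (b * c) div c" "l mod (b * c) mod c = l mod c" for l b c :: nat
    by (cases "c = 0"; simp add: div_mult2_eq mult.commute[of b c] mod_mult2_eq)+
  have r: "l div c < a * b" "l mod (b * c) < b * c" if "l < a * (b * c)" for l a b c :: nat
    using that by (auto simp: less_mult_imp_div_less mult.assoc div_mod_less)
  show "kron (kron A B) C $$ (i, j) = kron A (kron B C) $$ (i, j)"
    using ij r[of i "dim_row A" "dim_row B" "dim_row C"] r[of j "dim_col A" "dim_col B" "dim_col C"]
    by (simp add: kron_index mult.assoc * div_mod_less)
qed (auto simp: mult.assoc)

section \<open>Tensor products of modules\<close>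

context hopf_algebra
begin

lemma fdmods_action:
  assumes "V \<in> fdmods H"
  shows "snd V (g + h) = snd V g + snd V h" "snd V (hscale H c h) = c \<cdot>\<^sub>m snd V h"
    "snd V 1 = 1\<^sub>m (fst V)" "snd V (g * h) = snd V g * snd V h"
  using assms by (auto simp: fdmods_def)

lemma fdmods_eqI:
  assumes "V \<in> fdmods H" "W \<in> fdmods H" "fst V = fst W" "\<And>h. mat_op (snd V h) = mat_op (snd W h)"
  shows "V = W"
proof (rule prod_eqI[OF assms(3) ext])
  fix h
  show "snd V h = snd W h"
    using assms(3,4) fdmods_dim[OF assms(1)] fdmods_dim[OF assms(2)] by (subst mat_op_inject) auto
qed

lemma fst_mod_tensor [simp]: "fst (mod_tensor H V W) = fst V * fst W"
  by (simp add: mod_tensor_def)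

text \<open>G is kept general: \<open>mat_op\<close> gives the action as a Sweedler sum of
  operators, while \<open>\<lambda>A. mat_op (kron A _)\<close> expands the inner factor of a nested
  tensor product.\<close>

lemma tensor_action_additive:
  fixes G :: "'k mat \<Rightarrow> 'b::comm_monoid_add"
  assumes V: "V \<in> fdmods H" and W: "W \<in> fdmods H" and "G (0\<^sub>m (fst V * fst W) (fst V * fst W)) = 0"
    and "\<And>A B. A \<in> carrier_mat (fst V * fst W) (fst V * fst W) \<Longrightarrow> B \<in> carrier_mat (fst V * fst W) (fst V * fst W) \<Longrightarrow> G (A + B) = G A + G B"
  shows "G (snd (mod_tensor H V W) h) = (\<Sum>(a, b)\<leftarrow>comult H h. G (kron (snd V a) (snd W b)))"
  using additive_mat_sum[where F = "\<lambda>(a, b). kron (snd V a) (snd W b)" and xs = "comult H h" and G = G, OF _ assms(3,4)]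
    kron_carrier[OF fdmods_dim(1)[OF V] fdmods_dim(1)[OF W]]
  by (simp add: mod_tensor_def case_prod_unfold)

lemma mat_op_tensor:
  assumes "V \<in> fdmods H" "W \<in> fdmods H"
  shows "mat_op (snd (mod_tensor H V W) h) = (\<Sum>(a, b)\<leftarrow>comult H h. mat_op (kron (snd V a) (snd W b)))"
  by (rule tensor_action_additive[OF assms]) (auto simp: mat_op_zero mat_op_add)

lemma kron_action_add:
  assumes "V \<in> fdmods H" "W \<in> fdmods H"
  shows "mat_op (kron (snd V (a + a')) (snd W b)) = mat_op (kron (snd V a) (snd W b)) + mat_op (kron (snd V a') (snd W b))"
    "mat_op (kron (snd V a) (snd W (b + b'))) = mat_op (kron (snd V a) (snd W b)) + mat_op (kron (snd V a) (snd W b'))"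
    "mat_op (kron (snd V (hscale H c a)) (snd W b)) = mat_op (kron (snd V a) (snd W (hscale H c b)))"
  using assms[THEN fdmods_dim(1)] assms[THEN fdmods_dim(2)] assms[THEN fdmods_dim(3)]
  by (simp_all add: fdmods_action[OF assms(1)] fdmods_action[OF assms(2)] mat_op_add[symmetric]
      kron_add_left[of _ "fst V" "fst V"] kron_add_right[of _ "fst W" "fst W"] kron_smult_left kron_smult_right)

lemma mod_tensor_fdmods:
  assumes V: "V \<in> fdmods H" and W: "W \<in> fdmods H"
  shows "mod_tensor H V W \<in> fdmods H"
proof -
  let ?K = "\<lambda>a b. mat_op (kron (snd V a) (snd W b))"
  let ?n = "fst V * fst W" and ?T = "snd (mod_tensor H V W)"
  note d = fdmods_dim[OF V] fdmods_dim[OF W] and bil = kron_action_add[OF V W]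
  have c: "?T h \<in> carrier_mat ?n ?n" for h
    by (simp add: mod_tensor_def)
  then have dT: "dim_row (?T h) = ?n" "dim_col (?T h) = ?n" for h
    by auto
  \<comment> \<open>The operator ring carries no scalar action, so a scalar becomes left
    multiplication by a scalar matrix.\<close>
  have s: "mat_op (x \<cdot>\<^sub>m A) = mat_op (x \<cdot>\<^sub>m 1\<^sub>m ?n) * mat_op A" if "dim_row A = ?n" for x and A :: "'k mat"
    using that mult_smult_assoc_mat[of "1\<^sub>m ?n" ?n ?n A "dim_col A" x] carrier_matI[of A ?n "dim_col A"]
    by (subst mat_op_mult[symmetric]) auto
  show ?thesis
    unfolding fdmods_def mem_Collect_eq case_prod_unfold fst_mod_tensor
  proof (intro conjI allI)
    fix g h x
    show "?T h \<in> carrier_mat ?n ?n"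
      by (rule c)
    show "?T (g + h) = ?T g + ?T h"
      by (subst mat_op_inject) (simp_all add: dT mat_op_add mat_op_tensor[OF V W] comult_add_sum bil)
    show "?T (hscale H x h) = x \<cdot>\<^sub>m ?T h"
    proof (subst mat_op_inject)
      have "mat_op (?T (hscale H x h)) = (\<Sum>(a, b)\<leftarrow>comult H h. mat_op (x \<cdot>\<^sub>m kron (snd V a) (snd W b)))"
        unfolding mat_op_tensor[OF V W] comult_scale_sum[of "\<lambda>a b. mat_op (kron (snd V a) (snd W b))", OF bil]
        by (simp add: fdmods_action[OF V] kron_smult_left)
      also have "\<dots> = mat_op (x \<cdot>\<^sub>m 1\<^sub>m ?n) * mat_op (?T h)"
      proof -
        have "mat_op (x \<cdot>\<^sub>m kron (snd V a) (snd W b)) = mat_op (x \<cdot>\<^sub>m 1\<^sub>m ?n) * mat_op (kron (snd V a) (snd W b))" for a b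
          by (rule s) (simp add: d)
        then show ?thesis
          by (simp add: mat_op_tensor[OF V W] case_prod_unfold sum_list_const_mult)
      qed
      also have "\<dots> = mat_op (x \<cdot>\<^sub>m ?T h)"
        by (rule s[symmetric]) (rule dT)
      finally show "mat_op (?T (hscale H x h)) = mat_op (x \<cdot>\<^sub>m ?T h)" .
    qed (simp_all add: dT)
    show "?T 1 = 1\<^sub>m ?n"
      by (subst mat_op_inject) (simp_all add: dT mat_op_tensor[OF V W] comult_one_sum[of ?K, OF bil] fdmods_action[OF V] fdmods_action[OF W] kron_one)
    show "?T (g * h) = ?T g * ?T h"
    proof (subst mat_op_inject)
      have "mat_op (?T (g * h)) = (\<Sum>(a, b)\<leftarrow>comult H g. \<Sum>(a', b')\<leftarrow>comult H h. mat_op (kron (snd V (a * a')) (snd W (b * b'))))"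
        unfolding mat_op_tensor[OF V W] by (rule comult_mult_sum[of ?K, OF bil])
      also have "\<dots> = (\<Sum>(a, b)\<leftarrow>comult H g. \<Sum>(a', b')\<leftarrow>comult H h. mat_op (kron (snd V a) (snd W b)) * mat_op (kron (snd V a') (snd W b')))"
        using d by (simp add: mat_op_mult[symmetric] kron_mult fdmods_action[OF V] fdmods_action[OF W])
      also have "\<dots> = mat_op (?T g) * mat_op (?T h)"
        by (simp add: mat_op_tensor[OF V W] case_prod_unfold sum_list_const_mult sum_list_mult_const)
      finally show "mat_op (?T (g * h)) = mat_op (?T g * ?T h)"
        by (simp add: mat_op_mult dT)
    qed (simp_all add: dT)
  qed
qed

end

lemma mat_op_kron_left_zero: "mat_op (kron (0\<^sub>m a b) B) = 0"
  by (simp add: kron_zero_left mat_op_zero)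

lemma mat_op_kron_right_zero: "mat_op (kron B (0\<^sub>m a b)) = 0"
  by (simp add: kron_zero_right mat_op_zero)

text \<open>Presents an isomorphism as a decomposition with zero complement. Tensor products and
  duals then preserve isomorphisms because they preserve direct sums.\<close>

lemma is_dsum_self_zero:
  assumes fd: "V \<in> fdmods H" "W \<in> fdmods H" and Z: "Z \<in> fdmods H" "fst Z = 0" and iso: "mod_iso V W"
  shows "is_dsum V W Z"
  by (rule is_dsum_iso[OF fd fd(2) Z(1) iso is_dsum_zero[OF fd(2) Z]])

context hopf_algebra
begin

text \<open>This is an equality and not merely an isomorphism: with lexicographic bases the
  Kronecker product is strictly associative, so only coassociativity is left to apply. Hence formal
  sums of modules already form an associative ring.\<close>

lemma mod_tensor_assoc:
  assumes fd: "U \<in> fdmods H" "V \<in> fdmods H" "W \<in> fdmods H"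
  shows "mod_tensor H (mod_tensor H U V) W = mod_tensor H U (mod_tensor H V W)"
proof (rule fdmods_eqI)
  note t = mod_tensor_fdmods[OF fd(1,2)] mod_tensor_fdmods[OF fd(2,3)]
  show "mod_tensor H (mod_tensor H U V) W \<in> fdmods H" "mod_tensor H U (mod_tensor H V W) \<in> fdmods H"
    by (intro mod_tensor_fdmods fd)+
  show "fst (mod_tensor H (mod_tensor H U V) W) = fst (mod_tensor H U (mod_tensor H V W))"
    by simp
  fix h
  let ?f = "\<lambda>a b c. mat_op (kron (kron (snd U a) (snd V b)) (snd W c))"
  have "mat_op (snd (mod_tensor H (mod_tensor H U V) W) h) =
      (\<Sum>(a, b)\<leftarrow>comult H h. \<Sum>(a', a'')\<leftarrow>comult H a. ?f a' a'' b)"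
    unfolding mat_op_tensor[OF t(1) fd(3)]
    by (subst tensor_action_additive[OF fd(1,2), where G = "\<lambda>A. mat_op (kron A _)"])
      (simp_all add: mat_op_kron_left_zero kron_add_left mat_op_add)
  also have "\<dots> = (\<Sum>(a, b)\<leftarrow>comult H h. \<Sum>(b', b'')\<leftarrow>comult H b. ?f a b' b'')"
  proof (rule coassoc_sum)
    fix r a a' b b' c c'
    note d = fd[THEN fdmods_dim(1)]
    have k: "kron (snd U a) (snd V b) \<in> carrier_mat (fst U * fst V) (fst U * fst V)" for a b
      by (rule kron_carrier[OF d(1,2)])
    show "?f (a + a') b c = ?f a b c + ?f a' b c"
      using d[THEN carrier_matD(1)] d[THEN carrier_matD(2)] unfolding fdmods_action[OF fd(1)] kron_add_left[OF d(1) d(1)] kron_add_left[OF k k]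
      by (subst mat_op_add) simp_all
    show "?f a (b + b') c = ?f a b c + ?f a b' c"
      using d[THEN carrier_matD(1)] d[THEN carrier_matD(2)] unfolding fdmods_action[OF fd(2)] kron_add_right[OF d(2) d(2)] kron_add_left[OF k k]
      by (subst mat_op_add) simp_all
    show "?f a b (c + c') = ?f a b c + ?f a b c'"
      using d[THEN carrier_matD(1)] d[THEN carrier_matD(2)] unfolding fdmods_action[OF fd(3)] kron_add_right[OF d(3) d(3)]
      by (subst mat_op_add) simp_all
    show "?f (hscale H r a) b c = ?f a (hscale H r b) c" "?f a (hscale H r b) c = ?f a b (hscale H r c)"
      by (simp_all add: fdmods_action[OF fd(1)] fdmods_action[OF fd(2)] fdmods_action[OF fd(3)] kron_smult_left kron_smult_right)
  qed
  also have "\<dots> = mat_op (snd (mod_tensor H U (mod_tensor H V W)) h)"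
    unfolding mat_op_tensor[OF fd(1) t(2)] kron_assoc
    by (subst tensor_action_additive[OF fd(2,3), where G = "\<lambda>A. mat_op (kron _ A)"])
      (simp_all add: mat_op_kron_right_zero kron_add_right mat_op_add)
  finally show "mat_op (snd (mod_tensor H (mod_tensor H U V) W) h) = mat_op (snd (mod_tensor H U (mod_tensor H V W)) h)" .
qed

lemma mod_triv_fdmods: "mod_triv H \<in> fdmods H"
  by (auto simp: fdmods_def mod_triv_def counit_add counit_scale counit_mult counit_one scalar_prod_def intro!: eq_matI)

lemma mat_op_action_add:
  assumes "V \<in> fdmods H"
  shows "mat_op (snd V (g + h)) = mat_op (snd V g) + mat_op (snd V h)"
  using assms fdmods_dim[OF assms] by (simp add: fdmods_action mat_op_add)

lemma mod_tensor_triv_left: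
  assumes V: "V \<in> fdmods H"
  shows "mod_tensor H (mod_triv H) V = V"
proof (rule fdmods_eqI[OF mod_tensor_fdmods[OF mod_triv_fdmods V] V])
  show "fst (mod_tensor H (mod_triv H) V) = fst V"
    by (simp add: mod_triv_def)
  fix h
  have "mat_op (snd (mod_tensor H (mod_triv H) V) h) = (\<Sum>(a, b)\<leftarrow>comult H h. mat_op (snd V (hscale H (counit H a) b)))"
    unfolding mat_op_tensor[OF mod_triv_fdmods V] by (simp add: mod_triv_def kron_scalar_left[unfolded One_nat_def] fdmods_action[OF V])
  also have "\<dots> = mat_op (snd V (\<Sum>(a, b)\<leftarrow>comult H h. hscale H (counit H a) b))"
    unfolding case_prod_unfold
    by (rule sum_list_additive[of "\<lambda>h. mat_op (snd V h)", OF mat_op_action_add[OF V], symmetric])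
  finally show "mat_op (snd (mod_tensor H (mod_triv H) V) h) = mat_op (snd V h)"
    by (simp add: counit_left)
qed

lemma mod_tensor_triv_right:
  assumes V: "V \<in> fdmods H"
  shows "mod_tensor H V (mod_triv H) = V"
proof (rule fdmods_eqI[OF mod_tensor_fdmods[OF V mod_triv_fdmods] V])
  show "fst (mod_tensor H V (mod_triv H)) = fst V"
    by (simp add: mod_triv_def)
  fix h
  have "mat_op (snd (mod_tensor H V (mod_triv H)) h) = (\<Sum>(a, b)\<leftarrow>comult H h. mat_op (snd V (hscale H (counit H b) a)))"
    unfolding mat_op_tensor[OF V mod_triv_fdmods] by (simp add: mod_triv_def kron_scalar_right[unfolded One_nat_def] fdmods_action[OF V])
  also have "\<dots> = mat_op (snd V (\<Sum>(a, b)\<leftarrow>comult H h. hscale H (counit H b) a))"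
    unfolding case_prod_unfold
    by (rule sum_list_additive[of "\<lambda>h. mat_op (snd V h)", OF mat_op_action_add[OF V], symmetric])
  finally show "mat_op (snd (mod_tensor H V (mod_triv H)) h) = mat_op (snd V h)"
    by (simp add: counit_right)
qed

lemma mod_triv_indecomposable: "mod_triv H \<in> indecomposables H"
proof -
  have "fst U = 0 \<or> fst W = 0" if "mod_iso (mod_triv H) (mod_dsum U W)" for U W :: "('k, 'h) fdmod"
    using mod_iso_dim[OF that] by (auto simp: mod_triv_def mod_dsum_def)
  then show ?thesis
    using mod_triv_fdmods unfolding indecomposables_def by (auto simp: mod_triv_def)
qed

lemma tensor_hom:
  assumes fd: "V \<in> fdmods H" "V' \<in> fdmods H" "W \<in> fdmods H" "W' \<in> fdmods H" and P: "mod_hom V V' P" and Q: "mod_hom W W' Q"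
  shows "mod_hom (mod_tensor H V W) (mod_tensor H V' W') (kron P Q)"
proof (rule mod_homI)
  note t = mod_tensor_fdmods[OF fd(1,3)] mod_tensor_fdmods[OF fd(2,4)]
  note d = fdmods_dim(2,3)[OF fd(1)] fdmods_dim(2,3)[OF fd(2)] fdmods_dim(2,3)[OF fd(3)] fdmods_dim(2,3)[OF fd(4)]
    fdmods_dim(2,3)[OF t(1)] fdmods_dim(2,3)[OF t(2)] mod_hom_dim[OF P] mod_hom_dim[OF Q]
  fix h
  show "kron P Q * snd (mod_tensor H V W) h = snd (mod_tensor H V' W') h * kron P Q"
  proof (subst mat_op_inject)
    have "mat_op (kron P Q) * mat_op (kron (snd V a) (snd W b)) = mat_op (kron (snd V' a) (snd W' b)) * mat_op (kron P Q)" for a b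
      using mod_homD[OF P, of a] mod_homD[OF Q, of b] d by (simp add: mat_op_mult[symmetric] kron_mult)
    then show "mat_op (kron P Q * snd (mod_tensor H V W) h) = mat_op (snd (mod_tensor H V' W') h * kron P Q)"
      using d by (simp add: mat_op_mult mat_op_tensor[OF fd(1,3)] mat_op_tensor[OF fd(2,4)] case_prod_unfold
          sum_list_const_mult[symmetric] sum_list_mult_const[symmetric])
  qed (use d in simp_all)
qed (use mod_hom_dim[OF P] mod_hom_dim[OF Q] in simp_all)

lemma tensor_dsum_left:
  assumes fd: "V \<in> fdmods H" "U \<in> fdmods H" "U' \<in> fdmods H" "W \<in> fdmods H" and s: "is_dsum V U U'"
  shows "is_dsum (mod_tensor H V W) (mod_tensor H U W) (mod_tensor H U' W)"
proof -
  obtain i j p q where h: "mod_hom U V i" "mod_hom U' V j" "mod_hom V U p" "mod_hom V U' q"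
    and e: "p * i = 1\<^sub>m (fst U)" "q * j = 1\<^sub>m (fst U')" "p * j = 0\<^sub>m (fst U) (fst U')" "q * i = 0\<^sub>m (fst U') (fst U)"
    "i * p + j * q = 1\<^sub>m (fst V)"
    by (rule is_dsumE[OF s])
  note d = h[THEN mod_hom_dim(1)] h[THEN mod_hom_dim(2)]
  let ?I = "1\<^sub>m (fst W)"
  have I: "mod_hom W W ?I"
    by (rule mod_hom_one[OF fd(4)])
  have c: "i * p \<in> carrier_mat (fst V) (fst V)" "j * q \<in> carrier_mat (fst V) (fst V)"
    using d by (auto intro: carrier_matI)
  show ?thesis
  proof (rule is_dsumI[OF tensor_hom[OF fd(2,1,4,4) h(1) I] tensor_hom[OF fd(3,1,4,4) h(2) I]
        tensor_hom[OF fd(1,2,4,4) h(3) I] tensor_hom[OF fd(1,3,4,4) h(4) I]])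
    show "kron i ?I * kron p ?I + kron j ?I * kron q ?I = 1\<^sub>m (fst (mod_tensor H V W))"
      using d by (simp add: kron_mult kron_add_left[OF c, symmetric] e kron_one)
  qed (use d in \<open>simp_all add: kron_mult e kron_one kron_zero_left\<close>)
qed

lemma tensor_dsum_right:
  assumes fd: "V \<in> fdmods H" "U \<in> fdmods H" "U' \<in> fdmods H" "W \<in> fdmods H" and s: "is_dsum V U U'"
  shows "is_dsum (mod_tensor H W V) (mod_tensor H W U) (mod_tensor H W U')"
proof -
  obtain i j p q where h: "mod_hom U V i" "mod_hom U' V j" "mod_hom V U p" "mod_hom V U' q"
    and e: "p * i = 1\<^sub>m (fst U)" "q * j = 1\<^sub>m (fst U')" "p * j = 0\<^sub>m (fst U) (fst U')" "q * i = 0\<^sub>m (fst U') (fst U)"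
    "i * p + j * q = 1\<^sub>m (fst V)"
    by (rule is_dsumE[OF s])
  note d = h[THEN mod_hom_dim(1)] h[THEN mod_hom_dim(2)]
  let ?I = "1\<^sub>m (fst W)"
  have I: "mod_hom W W ?I"
    by (rule mod_hom_one[OF fd(4)])
  have c: "i * p \<in> carrier_mat (fst V) (fst V)" "j * q \<in> carrier_mat (fst V) (fst V)"
    using d by (auto intro: carrier_matI)
  show ?thesis
  proof (rule is_dsumI[OF tensor_hom[OF fd(4,4,2,1) I h(1)] tensor_hom[OF fd(4,4,3,1) I h(2)]
        tensor_hom[OF fd(4,4,1,2) I h(3)] tensor_hom[OF fd(4,4,1,3) I h(4)]])
    show "kron ?I i * kron ?I p + kron ?I j * kron ?I q = 1\<^sub>m (fst (mod_tensor H W V))"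
      using d by (simp add: kron_mult kron_add_right[OF c, symmetric] e kron_one)
  qed (use d in \<open>simp_all add: kron_mult e kron_one kron_zero_right\<close>)
qed

lemma tensor_iso_left:
  assumes fd: "V \<in> fdmods H" "V' \<in> fdmods H" "W \<in> fdmods H" and iso: "mod_iso V V'"
  shows "mod_iso (mod_tensor H V W) (mod_tensor H V' W)"
  using is_dsum_zero_iso[OF mod_tensor_fdmods[OF fd(1,3)] mod_tensor_fdmods[OF fd(2,3)]
    mod_tensor_fdmods[OF zero_mod_fdmods fd(3)] tensor_dsum_left[OF fd(1,2) zero_mod_fdmods fd(3)
      is_dsum_self_zero[OF fd(1,2) zero_mod_fdmods _ iso]]] by simp

lemma tensor_iso_right:
  assumes fd: "V \<in> fdmods H" "V' \<in> fdmods H" "W \<in> fdmods H" and iso: "mod_iso V V'"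
  shows "mod_iso (mod_tensor H W V) (mod_tensor H W V')"
  using is_dsum_zero_iso[OF mod_tensor_fdmods[OF fd(3,1)] mod_tensor_fdmods[OF fd(3,2)]
    mod_tensor_fdmods[OF fd(3) zero_mod_fdmods] tensor_dsum_right[OF fd(1,2) zero_mod_fdmods fd(3)
      is_dsum_self_zero[OF fd(1,2) zero_mod_fdmods _ iso]]] by simp

section \<open>Duals of modules\<close>

lemma fst_mod_dual [simp]: "fst (mod_dual H V) = fst V"
  by (simp add: mod_dual_def)

lemma snd_mod_dual: "snd (mod_dual H V) h = transpose_mat (snd V (antipode H h))"
  by (simp add: mod_dual_def)

text \<open>Transposition and the antipode both reverse products, so the two together respect them.
  This is what \<open>antipode_mult\<close> is for.\<close>

lemma mod_dual_fdmods:
  assumes V: "V \<in> fdmods H"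
  shows "mod_dual H V \<in> fdmods H"
  unfolding fdmods_def mem_Collect_eq case_prod_unfold fst_mod_dual snd_mod_dual
proof (intro conjI allI)
  note d = fdmods_dim[OF V]
  fix g h c
  show "transpose_mat (snd V (antipode H h)) \<in> carrier_mat (fst V) (fst V)"
    using d by simp
  show "transpose_mat (snd V (antipode H (g + h))) = transpose_mat (snd V (antipode H g)) + transpose_mat (snd V (antipode H h))"
    unfolding antipode_add fdmods_action[OF V] by (rule transpose_add[OF d(1) d(1)])
  show "transpose_mat (snd V (antipode H (hscale H c h))) = c \<cdot>\<^sub>m transpose_mat (snd V (antipode H h))"
    unfolding antipode_scale fdmods_action[OF V] by (intro eq_matI) auto
  show "transpose_mat (snd V (antipode H 1)) = 1\<^sub>m (fst V)"
    by (simp add: antipode_one fdmods_action[OF V])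
  show "transpose_mat (snd V (antipode H (g * h))) = transpose_mat (snd V (antipode H g)) * transpose_mat (snd V (antipode H h))"
    unfolding antipode_mult fdmods_action[OF V] by (rule transpose_mult[OF d(1) d(1)])
qed

lemma dual_hom:
  assumes fd: "V \<in> fdmods H" "W \<in> fdmods H" and P: "mod_hom V W P"
  shows "mod_hom (mod_dual H W) (mod_dual H V) (transpose_mat P)"
proof (rule mod_homI)
  fix h
  have c: "P \<in> carrier_mat (fst W) (fst V)"
    using P by (simp add: mod_hom_def)
  show "transpose_mat P * snd (mod_dual H W) h = snd (mod_dual H V) h * transpose_mat P"
    unfolding snd_mod_dual
    by (simp only: transpose_mult[OF fdmods_dim(1)[OF fd(2)] c, symmetric] transpose_mult[OF c fdmods_dim(1)[OF fd(1)], symmetric] mod_homD[OF P])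
qed (use mod_hom_dim[OF P] in simp_all)

lemma dual_dsum:
  assumes fd: "V \<in> fdmods H" "U \<in> fdmods H" "W \<in> fdmods H" and s: "is_dsum V U W"
  shows "is_dsum (mod_dual H V) (mod_dual H U) (mod_dual H W)"
proof -
  obtain i j p q where h: "mod_hom U V i" "mod_hom W V j" "mod_hom V U p" "mod_hom V W q"
    and e: "p * i = 1\<^sub>m (fst U)" "q * j = 1\<^sub>m (fst W)" "p * j = 0\<^sub>m (fst U) (fst W)" "q * i = 0\<^sub>m (fst W) (fst U)"
    "i * p + j * q = 1\<^sub>m (fst V)"
    by (rule is_dsumE[OF s])
  have c: "i \<in> carrier_mat (fst V) (fst U)" "j \<in> carrier_mat (fst V) (fst W)" "p \<in> carrier_mat (fst U) (fst V)" "q \<in> carrier_mat (fst W) (fst V)"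
    using h by (simp_all add: mod_hom_def)
  have c': "i * p \<in> carrier_mat (fst V) (fst V)" "j * q \<in> carrier_mat (fst V) (fst V)"
    using c by auto
  show ?thesis
  proof (rule is_dsumI[OF dual_hom[OF fd(1,2) h(3)] dual_hom[OF fd(1,3) h(4)] dual_hom[OF fd(2,1) h(1)] dual_hom[OF fd(3,1) h(2)]])
  qed (simp_all only: transpose_mult[symmetric, OF c(3) c(1)] transpose_mult[symmetric, OF c(4) c(2)] transpose_mult[symmetric, OF c(4) c(1)]
      transpose_mult[symmetric, OF c(3) c(2)] transpose_mult[symmetric, OF c(1) c(3)] transpose_mult[symmetric, OF c(2) c(4)]
      transpose_add[symmetric, OF c'] e transpose_one zero_transpose_mat fst_mod_dual)
qed

lemma dual_iso:
  assumes fd: "V \<in> fdmods H" "V' \<in> fdmods H" and iso: "mod_iso V V'"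
  shows "mod_iso (mod_dual H V) (mod_dual H V')"
  using is_dsum_zero_iso[OF mod_dual_fdmods[OF fd(1)] mod_dual_fdmods[OF fd(2)] mod_dual_fdmods[OF zero_mod_fdmods]
    dual_dsum[OF fd zero_mod_fdmods is_dsum_self_zero[OF fd zero_mod_fdmods _ iso]]] by simp

end

section \<open>Integral bases of rings\<close>

text \<open>Additive coordinate functions dual to B express linear independence, and the expansion
  expresses spanning. For the Green ring the functions are multiplicities, which are at hand before
  any basis theorem.\<close>

locale zbasis = ring R for R (structure) +
  fixes B :: "'a set" and co :: "'a \<Rightarrow> 'a \<Rightarrow> int"
  assumes finite_basis: "finite B"
    and basis_closed: "B \<subseteq> carrier R"
    and co_add: "x \<in> carrier R \<Longrightarrow> y \<in> carrier R \<Longrightarrow> b \<in> B \<Longrightarrow> co (x \<oplus> y) b = co x b + co y b"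
    and co_basis: "b \<in> B \<Longrightarrow> b' \<in> B \<Longrightarrow> co b b' = (if b = b' then 1 else 0)"
    and expansion: "x \<in> carrier R \<Longrightarrow> x = (\<Oplus>b\<in>B. [co x b] \<cdot> b)"
begin

lemma basisD: "b \<in> B \<Longrightarrow> b \<in> carrier R"
  using basis_closed by blast

lemma co_zero: "b \<in> B \<Longrightarrow> co \<zero> b = 0"
  using co_add[of \<zero> \<zero> b] by simp

lemma co_minus: "x \<in> carrier R \<Longrightarrow> b \<in> B \<Longrightarrow> co (\<ominus> x) b = - co x b"
  using co_add[of x "\<ominus> x" b] co_zero[of b] by (simp add: r_neg)

lemma co_diff: "x \<in> carrier R \<Longrightarrow> y \<in> carrier R \<Longrightarrow> b \<in> B \<Longrightarrow> co (x \<ominus> y) b = co x b - co y b"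
  by (simp add: minus_eq co_add co_minus)

lemma co_nat_pow: "x \<in> carrier R \<Longrightarrow> b \<in> B \<Longrightarrow> co ([(n::nat)] \<cdot> x) b = int n * co x b"
  by (induction n) (simp_all add: co_zero co_add add.nat_pow_0 add.nat_pow_Suc distrib_right)

lemma int_multiple_closed: "x \<in> carrier R \<Longrightarrow> [(n::int)] \<cdot> x \<in> carrier R"
  by (cases "n \<ge> 0") (simp_all add: add_pow_int_ge add_pow_int_lt)

lemma co_int_pow: "x \<in> carrier R \<Longrightarrow> b \<in> B \<Longrightarrow> co ([(n::int)] \<cdot> x) b = n * co x b"
  by (cases "n \<ge> 0") (simp_all add: add_pow_int_ge add_pow_int_lt co_nat_pow co_minus)

lemma co_finsum:
  "finite A \<Longrightarrow> (\<And>a. a \<in> A \<Longrightarrow> f a \<in> carrier R) \<Longrightarrow> b \<in> B \<Longrightarrow> co (\<Oplus>a\<in>A. f a) b = (\<Sum>a\<in>A. co (f a) b)"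
  by (induction A rule: finite_induct) (auto simp: co_zero co_add Pi_def finsum_closed)

lemma co_combination:
  assumes "A \<subseteq> B" "b \<in> B"
  shows "co (\<Oplus>a\<in>A. [n a] \<cdot> a) b = (if b \<in> A then n b else 0)"
proof -
  have A: "finite A"
    using assms(1) finite_basis by (rule finite_subset)
  have "co (\<Oplus>a\<in>A. [n a] \<cdot> a) b = (\<Sum>a\<in>A. co ([n a] \<cdot> a) b)"
    using assms int_multiple_closed basisD by (intro co_finsum A) auto
  also have "\<dots> = (\<Sum>a\<in>A. n a * (if a = b then 1 else 0))"
    using assms by (intro sum.cong refl) (auto simp: co_int_pow basisD subsetD co_basis)
  also have "\<dots> = (if b \<in> A then n b else 0)"
    using A by (simp add: if_distrib[of "\<lambda>x. _ * x"] cong: if_cong)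
  finally show ?thesis .
qed

lemma co_ext: "x \<in> carrier R \<Longrightarrow> y \<in> carrier R \<Longrightarrow> (\<And>b. b \<in> B \<Longrightarrow> co x b = co y b) \<Longrightarrow> x = y"
  using expansion[of x] expansion[of y] finsum_cong'[of B B "\<lambda>b. [co y b] \<cdot> b" "\<lambda>b. [co x b] \<cdot> b"] int_multiple_closed basisD
  by (simp add: Pi_def)

lemma zlincomb_eq:
  assumes "Poly_Mapping.keys c \<subseteq> A" "A \<subseteq> B"
  shows "zlincomb R c = (\<Oplus>b\<in>A. [Poly_Mapping.lookup c b] \<cdot> b)"
  unfolding zlincomb_def
  using assms finite_subset[OF assms(2) finite_basis] int_multiple_closed basisD
  by (intro add.finprod_mono_neutral_cong_left) (auto simp: in_keys_iff add_pow_int_ge)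

text \<open>Resolves the definite description in \<open>zcoords\<close>: existence is the expansion,
  and uniqueness follows by reading off the coefficients of a combination with
  \<open>co\<close>.\<close>

lemma lookup_zcoords:
  assumes x: "x \<in> carrier R"
  shows "Poly_Mapping.lookup (zcoords R B x) b = (if b \<in> B then co x b else 0)"
proof -
  define c where "c = Abs_poly_mapping (\<lambda>b. if b \<in> B then co x b else 0)"
  have lc: "Poly_Mapping.lookup c = (\<lambda>b. if b \<in> B then co x b else 0)"
    unfolding c_def by (rule lookup_Abs_poly_mapping) (auto intro: finite_subset[OF _ finite_basis])
  have k: "Poly_Mapping.keys c \<subseteq> B"
    by (auto simp: in_keys_iff lc split: if_splits)
  have "zlincomb R c = (\<Oplus>b\<in>B. [Poly_Mapping.lookup c b] \<cdot> b)"
    by (rule zlincomb_eq[OF k order_refl])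
  also have "\<dots> = x"
    unfolding lc using expansion[OF x] finsum_cong'[of B B "\<lambda>b. [co x b] \<cdot> b" "\<lambda>b. [(if b \<in> B then co x b else 0)] \<cdot> b"] int_multiple_closed basisD
    by (simp add: Pi_def)
  finally have c: "zlincomb R c = x" .
  have "zcoords R B x = c"
    unfolding zcoords_def
  proof (rule the_equality)
    fix d assume d: "Poly_Mapping.keys d \<subseteq> B \<and> zlincomb R d = x"
    then have "Poly_Mapping.lookup d b = co x b" if "b \<in> B" for b
      using zlincomb_eq[of d B] co_combination[OF order_refl that, of "Poly_Mapping.lookup d"] that by simp
    moreover have "Poly_Mapping.lookup d b = 0" if "b \<notin> B" for b
      using d that by (auto simp: in_keys_iff)
    ultimately show "d = c"
      by (intro poly_mapping_eqI) (simp add: lc)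
  qed (use k c in auto)
  then show ?thesis
    by (simp add: lc)
qed

lemma zspan_iff:
  assumes "X \<subseteq> B"
  shows "x \<in> zspan R X \<longleftrightarrow> x \<in> carrier R \<and> (\<forall>b\<in>B - X. co x b = 0)"
proof
  assume "x \<in> zspan R X"
  then obtain c where c: "Poly_Mapping.keys c \<subseteq> X" "x = zlincomb R c"
    by (auto simp: zspan_def)
  then have x: "x = (\<Oplus>b\<in>X. [Poly_Mapping.lookup c b] \<cdot> b)"
    using zlincomb_eq assms by simp
  show "x \<in> carrier R \<and> (\<forall>b\<in>B - X. co x b = 0)"
    unfolding x using assms int_multiple_closed basisD by (auto simp: co_combination Pi_def subset_iff intro!: finsum_closed)
next
  assume x: "x \<in> carrier R \<and> (\<forall>b\<in>B - X. co x b = 0)"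
  let ?c = "zcoords R B x"
  have l: "Poly_Mapping.lookup ?c b = (if b \<in> B then co x b else 0)" for b
    using lookup_zcoords x by blast
  have k: "Poly_Mapping.keys ?c \<subseteq> X"
    using x by (auto simp: in_keys_iff l split: if_splits)
  have "zlincomb R ?c = (\<Oplus>b\<in>B. [Poly_Mapping.lookup ?c b] \<cdot> b)"
    using k assms by (intro zlincomb_eq) auto
  also have "\<dots> = x"
    unfolding l using x expansion[of x] finsum_cong'[of B B "\<lambda>b. [co x b] \<cdot> b" "\<lambda>b. [(if b \<in> B then co x b else 0)] \<cdot> b"] int_multiple_closed basisD
    by (simp add: Pi_def)
  finally show "x \<in> zspan R X"
    using k unfolding zspan_def by (auto intro!: image_eqI[of _ _ ?c])
qed

lemma co_mult:
  assumes "x \<in> carrier R" "y \<in> carrier R" "b \<in> B"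
  shows "co (x \<otimes> y) b = (\<Sum>a\<in>B. \<Sum>a'\<in>B. co x a * co y a' * co (a \<otimes> a') b)"
proof -
  have l: "co (x \<otimes> z) b = (\<Sum>a\<in>B. co x a * co (a \<otimes> z) b)" if z: "z \<in> carrier R" for z
  proof -
    have "x \<otimes> z = (\<Oplus>a\<in>B. [co x a] \<cdot> a) \<otimes> z"
      using expansion[OF assms(1)] by simp
    also have "\<dots> = (\<Oplus>a\<in>B. [co x a] \<cdot> a \<otimes> z)"
      using finite_basis z int_multiple_closed basisD by (intro finsum_ldistr) auto
    also have "\<dots> = (\<Oplus>a\<in>B. [co x a] \<cdot> (a \<otimes> z))"
      using z basisD by (intro finsum_cong') (auto simp: add_pow_ldistr_int int_multiple_closed)
    finally show ?thesis
      using z basisD assms(3) finite_basis by (simp add: co_finsum co_int_pow int_multiple_closed)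
  qed
  have r: "co (a \<otimes> y) b = (\<Sum>a'\<in>B. co y a' * co (a \<otimes> a') b)" if a: "a \<in> B" for a
  proof -
    note a = basisD[OF a]
    have "a \<otimes> y = a \<otimes> (\<Oplus>a'\<in>B. [co y a'] \<cdot> a')"
      using expansion[OF assms(2)] by simp
    also have "\<dots> = (\<Oplus>a'\<in>B. a \<otimes> [co y a'] \<cdot> a')"
      using finite_basis a int_multiple_closed basisD by (intro finsum_rdistr) auto
    also have "\<dots> = (\<Oplus>a'\<in>B. [co y a'] \<cdot> (a \<otimes> a'))"
      using a basisD by (intro finsum_cong') (auto simp: add_pow_rdistr_int int_multiple_closed)
    finally show ?thesis
      using a basisD assms(3) finite_basis by (simp add: co_finsum co_int_pow int_multiple_closed)
  qed
  show ?thesis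
    by (simp add: l[OF assms(2)] r sum_distrib_left mult.assoc)
qed

lemma zspan_basis_iff: "X \<subseteq> B \<Longrightarrow> b \<in> B \<Longrightarrow> b \<in> zspan R X \<longleftrightarrow> b \<in> X"
  by (auto simp: zspan_iff basisD co_basis)

lemma zspan_Un:
  assumes X: "X \<subseteq> B" and Y: "Y \<subseteq> B"
  shows "zspan R (X \<union> Y) = zspan R X <+> zspan R Y"
proof
  have XY: "X \<union> Y \<subseteq> B"
    using X Y by blast
  show "zspan R X <+> zspan R Y \<subseteq> zspan R (X \<union> Y)"
    unfolding set_add_def' using X Y XY by (auto simp: zspan_iff co_add)
  show "zspan R (X \<union> Y) \<subseteq> zspan R X <+> zspan R Y"
  proof
    fix x assume "x \<in> zspan R (X \<union> Y)"
    then have x: "x \<in> carrier R" "\<And>b. b \<in> B - (X \<union> Y) \<Longrightarrow> co x b = 0"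
      using zspan_iff[OF XY] by auto
    \<comment> \<open>The part of x supported on X; what remains is supported on Y.\<close>
    let ?u = "\<Oplus>b\<in>X. [co x b] \<cdot> b"
    have u: "?u \<in> carrier R"
      using X basisD int_multiple_closed by (intro finsum_closed) auto
    have co_u: "co ?u b = (if b \<in> X then co x b else 0)" if "b \<in> B" for b
      by (rule co_combination[OF X that])
    have "?u \<in> zspan R X"
      using u co_u by (simp add: zspan_iff[OF X])
    moreover have "x \<ominus> ?u \<in> zspan R Y"
      using u co_u x by (auto simp: zspan_iff[OF Y] co_diff)
    moreover have "x = ?u \<oplus> (x \<ominus> ?u)"
      using u x(1) by (intro co_ext) (simp_all add: co_add co_diff)
    ultimately show "x \<in> zspan R X <+> zspan R Y"
      unfolding set_add_def' by blast
  qed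
qed

lemma zspan_empty: "zspan R {} = {\<zero>}"
  using co_ext[of _ \<zero>] by (auto simp: zspan_iff co_zero)

section \<open>The quotient by an ideal spanned by basis elements\<close>

context
  fixes X :: "'a set"
  assumes X: "X \<subseteq> B" and I: "ideal (zspan R X) R"
begin

interpretation I: ideal "zspan R X" R
  by (rule I)

abbreviation quot_map :: "'a \<Rightarrow> 'a set" where
  "quot_map x \<equiv> zspan R X +>\<^bsub>R\<^esub> x"

text \<open>Both the coset and the basis coset are replaced by chosen representatives. The choices
  are harmless: coordinates outside X are constant on cosets, and the quotient map is injective on
  \<open>B - X\<close>.\<close>

definition quot_co :: "'a set \<Rightarrow> 'a set \<Rightarrow> int" where
  "quot_co Y c = co (SOME x. x \<in> Y) (SOME b. b \<in> B - X \<and> quot_map b = c)"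

lemma co_quot_map: "x \<in> carrier R \<Longrightarrow> y \<in> quot_map x \<Longrightarrow> b \<in> B - X \<Longrightarrow> co y b = co x b"
  by (auto simp: a_r_coset_def r_coset_def zspan_iff[OF X] co_add)

lemma quot_map_eq_iff:
  assumes x: "x \<in> carrier R" and y: "y \<in> carrier R"
  shows "quot_map x = quot_map y \<longleftrightarrow> (\<forall>b\<in>B - X. co x b = co y b)"
proof
  assume "quot_map x = quot_map y"
  then have "x \<in> quot_map y"
    using I.a_rcos_self[OF x] by simp
  then show "\<forall>b\<in>B - X. co x b = co y b"
    using co_quot_map[OF y] by blast
next
  assume "\<forall>b\<in>B - X. co x b = co y b"
  then have "x \<ominus> y \<in> zspan R X"
    using x y by (simp add: zspan_iff[OF X] co_diff)
  then show "quot_map x = quot_map y"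
    using quotient_eq_iff_same_a_r_cos[OF I x y] by simp
qed

lemma quot_map_inj: "inj_on quot_map (B - X)"
proof (rule inj_onI)
  fix b b' assume b: "b \<in> B - X" "b' \<in> B - X" "quot_map b = quot_map b'"
  then have "co b b' = co b' b'"
    using quot_map_eq_iff[of b b'] basisD by blast
  then show "b = b'"
    using b by (auto simp: co_basis split: if_splits)
qed

lemma quot_co_eq: "x \<in> carrier R \<Longrightarrow> b \<in> B - X \<Longrightarrow> quot_co (quot_map x) (quot_map b) = co x b"
proof -
  assume x: "x \<in> carrier R" and b: "b \<in> B - X"
  have "(SOME b'. b' \<in> B - X \<and> quot_map b' = quot_map b) = b"
    by (rule some_equality) (use b quot_map_inj in \<open>auto dest: inj_onD\<close>)
  moreover have "(SOME y. y \<in> quot_map x) \<in> quot_map x"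
    using I.a_rcos_self[OF x] by (rule someI)
  ultimately show ?thesis
    unfolding quot_co_def using co_quot_map[OF x _ b] by simp
qed

lemma quot_zbasis: "zbasis (R Quot zspan R X) (quot_map ` (B - X)) quot_co"
proof -
  let ?Q = "R Quot zspan R X"
  have carr: "\<exists>x\<in>carrier R. y = quot_map x" if "y \<in> carrier ?Q" for y
    using that unfolding FactRing_def A_RCOSETS_def' by (simp only: partial_object.simps UN_iff singleton_iff)
  interpret Q: ring ?Q
    by (rule I.quotient_is_ring)
  interpret h: ring_hom_ring R ?Q "quot_map"
    by (rule I.rcos_ring_hom_ring)
  have fin: "quot_map (\<Oplus>a\<in>A. f a) = (\<Oplus>\<^bsub>?Q\<^esub>a\<in>A. quot_map (f a))"
    if "finite A" "\<And>a. a \<in> A \<Longrightarrow> f a \<in> carrier R" for f :: "'a \<Rightarrow> 'a" and A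
    using that by (induction A rule: finite_induct) (auto simp: Pi_def)
  have npow: "quot_map ([(n::nat)] \<cdot> x) = [n] \<cdot>\<^bsub>?Q\<^esub> quot_map x" if "x \<in> carrier R" for n x
    using that by (induction n) (simp_all add: add.nat_pow_0 add.nat_pow_Suc)
  have pow: "quot_map ([(n::int)] \<cdot> x) = [n] \<cdot>\<^bsub>?Q\<^esub> quot_map x" if "x \<in> carrier R" for n x
    using that by (cases "n \<ge> 0") (simp_all add: add_pow_int_ge add_pow_int_lt npow)
  have cl: "[n] \<cdot>\<^bsub>?Q\<^esub> quot_map b \<in> carrier ?Q" if "b \<in> B" for b and n :: int
    using that basisD int_multiple_closed by (simp flip: pow)
  show ?thesis
  proof unfold_locales
    show "finite (quot_map ` (B - X))"
      using finite_basis by simp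
    show "quot_map ` (B - X) \<subseteq> carrier ?Q"
      using basisD by auto
  next
    fix y z b assume "y \<in> carrier ?Q" "z \<in> carrier ?Q" "b \<in> quot_map ` (B - X)"
    then obtain y' z' b' where "y' \<in> carrier R" "y = quot_map y'" "z' \<in> carrier R" "z = quot_map z'" "b' \<in> B - X" "b = quot_map b'"
      by (elim imageE carr[THEN bexE])
    then show "quot_co (y \<oplus>\<^bsub>?Q\<^esub> z) b = quot_co y b + quot_co z b"
      using quot_co_eq by (simp add: co_add flip: h.hom_add)
  next
    fix c d assume "c \<in> quot_map ` (B - X)" "d \<in> quot_map ` (B - X)"
    then obtain c' d' where cd: "c' \<in> B - X" "c = quot_map c'" "d' \<in> B - X" "d = quot_map d'"
      by (elim imageE) simp_all
    then show "quot_co c d = (if c = d then 1 else 0)"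
      using quot_co_eq[of c' d'] inj_onD[OF quot_map_inj, of c' d'] by (auto simp: co_basis basisD)
  next
    fix y assume "y \<in> carrier ?Q"
    then obtain x where x: "x \<in> carrier R" "y = quot_map x"
      by (elim carr[THEN bexE])
    let ?x = "\<Oplus>b\<in>B - X. [co x b] \<cdot> b"
    have x': "?x \<in> carrier R"
      using basisD int_multiple_closed by (intro finsum_closed) auto
    have "quot_map x = quot_map ?x"
      using x x' co_combination[of "B - X"] by (subst quot_map_eq_iff) auto
    also have "\<dots> = (\<Oplus>\<^bsub>?Q\<^esub>b\<in>B - X. quot_map ([co x b] \<cdot> b))"
      using finite_basis basisD int_multiple_closed by (intro fin) simp_all
    also have "\<dots> = (\<Oplus>\<^bsub>?Q\<^esub>b\<in>B - X. [quot_co (quot_map x) (quot_map b)] \<cdot>\<^bsub>?Q\<^esub> quot_map b)"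
      by (rule Q.finsum_cong'[OF refl]) (simp_all add: Pi_def cl pow basisD quot_co_eq x(1))
    also have "\<dots> = (\<Oplus>\<^bsub>?Q\<^esub>b\<in>quot_map ` (B - X). [quot_co (quot_map x) b] \<cdot>\<^bsub>?Q\<^esub> b)"
      by (rule Q.add.finprod_reindex[symmetric]) (auto simp: cl quot_map_inj)
    finally show "y = (\<Oplus>\<^bsub>?Q\<^esub>b\<in>quot_map ` (B - X). [quot_co y b] \<cdot>\<^bsub>?Q\<^esub> b)"
      by (simp add: x)
  qed
qed

end

end

section \<open>The Green ring\<close>

definition frag_tensor :: "('k::field, 'h::ring_1) hopf \<Rightarrow> (('k, 'h) fdmod \<Rightarrow>\<^sub>0 int) \<Rightarrow> (('k, 'h) fdmod \<Rightarrow>\<^sub>0 int) \<Rightarrow> (('k, 'h) fdmod \<Rightarrow>\<^sub>0 int)" where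
  "frag_tensor H x y = frag_extend (\<lambda>V. frag_extend (\<lambda>W. frag_of (mod_tensor H V W)) y) x"

lemmas frag_induct = free_Abelian_group_induct[consumes 1, case_names zero diff single]

lemma frag_extend_pointwise_diff:
  fixes g h :: "'a \<Rightarrow> 'b \<Rightarrow>\<^sub>0 int"
  shows "frag_extend (\<lambda>V. g V - h V) x = frag_extend g x - frag_extend h x"
proof -
  have "frag_cmul c (a - b) = frag_cmul c a - frag_cmul c b" for c and a b :: "'b \<Rightarrow>\<^sub>0 int"
    using frag_cmul_distrib2[of c "a - b" b] by simp
  then show ?thesis
    by (simp add: frag_extend_def sum_subtractf)
qed

lemma frag_tensor_simps:
  "frag_tensor H (x - x') y = frag_tensor H x y - frag_tensor H x' y"
  "frag_tensor H x (y - y') = frag_tensor H x y - frag_tensor H x y'"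
  "frag_tensor H 0 y = 0" "frag_tensor H x 0 = 0"
  "frag_tensor H (frag_of V) (frag_of W) = frag_of (mod_tensor H V W)"
  by (simp_all add: frag_tensor_def frag_extend_diff frag_extend_pointwise_diff frag_extend_eq_0)

lemma frag_tensor_minus: "frag_tensor H (- x) y = - frag_tensor H x y" "frag_tensor H x (- y) = - frag_tensor H x y"
  using frag_tensor_simps(1)[of H 0 x y] frag_tensor_simps(2)[of H x 0 y] by (simp_all add: frag_tensor_simps(3,4))

lemma frag_tensor_add:
  "frag_tensor H (x + x') y = frag_tensor H x y + frag_tensor H x' y"
  "frag_tensor H x (y + y') = frag_tensor H x y + frag_tensor H x y'"
  using frag_tensor_simps(1)[of H x "- x'" y] frag_tensor_simps(2)[of H x y "- y'"] by (simp_all add: frag_tensor_minus)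

lemma free_mod_ring_simps [simp]:
  "carrier (free_mod_ring H) = {c. Poly_Mapping.keys c \<subseteq> fdmods H}"
  "x \<otimes>\<^bsub>free_mod_ring H\<^esub> y = frag_tensor H x y"
  "x \<oplus>\<^bsub>free_mod_ring H\<^esub> y = x + y"
  "\<one>\<^bsub>free_mod_ring H\<^esub> = frag_of (mod_triv H)"
  "\<zero>\<^bsub>free_mod_ring H\<^esub> = 0"
  by (auto simp: free_mod_ring_def frag_tensor_def)

lemma add_monoid_free_mod_ring: "add_monoid (free_mod_ring H) = free_Abelian_group (fdmods H)"
  by (auto simp: free_mod_ring_def free_Abelian_group_def)

abbreviation green_gens :: "('k::field, 'h::ring_1) hopf \<Rightarrow> (('k, 'h) fdmod \<Rightarrow>\<^sub>0 int) set" where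
  "green_gens H \<equiv> {frag_of V - frag_of W | V W. V \<in> fdmods H \<and> W \<in> fdmods H \<and> mod_iso V W} \<union>
      {frag_of (mod_dsum V W) - frag_of V - frag_of W | V W. V \<in> fdmods H \<and> W \<in> fdmods H}"

lemma keys_diff_subset: "Poly_Mapping.keys a \<subseteq> S \<Longrightarrow> Poly_Mapping.keys b \<subseteq> S \<Longrightarrow> Poly_Mapping.keys (a - b) \<subseteq> S"
  using keys_diff[of a b] by blast

lemma green_gens_keys: "g \<in> green_gens H \<Longrightarrow> Poly_Mapping.keys g \<subseteq> fdmods H"
  by (elim UnE CollectE exE conjE) (simp_all add: keys_diff_subset mod_dsum_fdmods)

lemma green_rels_subgroup: "subgroup (green_rels H) (free_Abelian_group (fdmods H))"
  unfolding green_rels_def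
  by (rule group.generate_is_subgroup[OF group_free_Abelian_group], rule subsetI, simp only: carrier_free_Abelian_group_iff, erule green_gens_keys)

lemma green_rels_keys: "c \<in> green_rels H \<Longrightarrow> Poly_Mapping.keys c \<subseteq> fdmods H"
  using subgroup.subset[OF green_rels_subgroup] by (auto simp: subset_iff)

lemma green_rels_add: "c \<in> green_rels H \<Longrightarrow> d \<in> green_rels H \<Longrightarrow> c + d \<in> green_rels H"
  using subgroup.m_closed[OF green_rels_subgroup] by simp

lemma green_rels_zero: "0 \<in> green_rels H"
  using subgroup.one_closed[OF green_rels_subgroup] by simp

lemma green_rels_minus: "c \<in> green_rels H \<Longrightarrow> - c \<in> green_rels H"
  using subgroup.m_inv_closed[OF green_rels_subgroup[of H], of c] inv_free_Abelian_group[OF green_rels_keys[of c H]] by simp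

lemma green_rels_diff: "c \<in> green_rels H \<Longrightarrow> d \<in> green_rels H \<Longrightarrow> c - d \<in> green_rels H"
  using green_rels_add[of c H "- d"] green_rels_minus[of d H] by simp

lemma green_rels_iso: "V \<in> fdmods H \<Longrightarrow> W \<in> fdmods H \<Longrightarrow> mod_iso V W \<Longrightarrow> frag_of V - frag_of W \<in> green_rels H"
  unfolding green_rels_def by (rule generate.incl) blast

lemma green_rels_dsum:
  assumes fd: "V \<in> fdmods H" "U \<in> fdmods H" "W \<in> fdmods H" and s: "is_dsum V U W"
  shows "frag_of V - frag_of U - frag_of W \<in> green_rels H"
proof -
  have "frag_of V - frag_of (mod_dsum U W) \<in> green_rels H"
    using fd s by (intro green_rels_iso mod_dsum_fdmods) (simp_all add: mod_iso_mod_dsum_iff)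
  moreover have "frag_of (mod_dsum U W) - frag_of U - frag_of W \<in> green_rels H"
    unfolding green_rels_def by (rule generate.incl) (use fd in blast)
  ultimately have "(frag_of V - frag_of (mod_dsum U W)) + (frag_of (mod_dsum U W) - frag_of U - frag_of W) \<in> green_rels H"
    by (rule green_rels_add)
  then show ?thesis
    by (simp add: algebra_simps)
qed

text \<open>The sum case is phrased with \<open>is_dsum\<close> although the generators use
  \<open>mod_dsum\<close>: this is the form that tensoring and dualizing preserve.\<close>

lemma green_rels_induct [consumes 1, case_names zero iso dsum minus add]:
  assumes c: "c \<in> green_rels H"
    and "P 0"
    and "\<And>V W. V \<in> fdmods H \<Longrightarrow> W \<in> fdmods H \<Longrightarrow> mod_iso V W \<Longrightarrow> P (frag_of V - frag_of W)"
    and "\<And>V U W. V \<in> fdmods H \<Longrightarrow> U \<in> fdmods H \<Longrightarrow> W \<in> fdmods H \<Longrightarrow> is_dsum V U W \<Longrightarrow> P (frag_of V - frag_of U - frag_of W)"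
    and minus: "\<And>c. P c \<Longrightarrow> P (- c)"
    and "\<And>c d. P c \<Longrightarrow> P d \<Longrightarrow> P (c + d)"
  shows "P c"
proof -
  have gens: "P g" if "g \<in> green_gens H" for g
    using that
  proof (elim UnE CollectE exE conjE)
    fix V W assume g: "g = frag_of (mod_dsum V W) - frag_of V - frag_of W" and fd: "V \<in> fdmods H" "W \<in> fdmods H"
    show "P g"
      unfolding g by (rule assms(4)[OF mod_dsum_fdmods[OF fd] fd is_dsum_mod_dsum[OF fd]])
  next
    fix V W assume g: "g = frag_of V - frag_of W" and fd: "V \<in> fdmods H" "W \<in> fdmods H" "mod_iso V W"
    show "P g"
      unfolding g by (rule assms(3)[OF fd])
  qed
  show ?thesis
    using c unfolding green_rels_def
  proof (induction rule: generate.induct)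
    case (incl h)
    then show ?case
      by (rule gens)
  next
    case (inv h)
    show ?case
      unfolding inv_free_Abelian_group[OF green_gens_keys[OF inv]] by (rule minus[OF gens[OF inv]])
  qed (use assms in simp_all)
qed

text \<open>Evaluates a coset at a chosen representative. For additive invariants, such as the
  dimension or a multiplicity, \<open>green_lift_cls\<close> shows that the choice does not
  matter.\<close>

definition green_lift :: "(('k, 'h) fdmod \<Rightarrow> int) \<Rightarrow> ('k, 'h) green \<Rightarrow> int" where
  "green_lift \<phi> x = frag_eval \<phi> (SOME c. c \<in> x)"

definition additive_invariant :: "('k::field, 'h::ring_1) hopf \<Rightarrow> (('k, 'h) fdmod \<Rightarrow> int) \<Rightarrow> bool" where
  "additive_invariant H \<phi> \<longleftrightarrow>
     (\<forall>V\<in>fdmods H. \<forall>W\<in>fdmods H. mod_iso V W \<longrightarrow> \<phi> V = \<phi> W) \<and>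
     (\<forall>V\<in>fdmods H. \<forall>U\<in>fdmods H. \<forall>W\<in>fdmods H. is_dsum V U W \<longrightarrow> \<phi> V = \<phi> U + \<phi> W)"

lemma additive_invariant_rels:
  assumes "additive_invariant H \<phi>" "c \<in> green_rels H"
  shows "frag_eval \<phi> c = 0"
  using assms(2)
  by (induction rule: green_rels_induct) (use assms(1) in \<open>auto simp: frag_eval_diff frag_eval_add frag_eval_minus additive_invariant_def\<close>)

lemma additive_invariant_dim: "additive_invariant H (\<lambda>V. int (fst V))"
  unfolding additive_invariant_def using mod_iso_dim is_dsum_dim by fastforce

lemma additive_invariant_multiplicity:
  "M \<in> indecomposables H \<Longrightarrow> additive_invariant H (\<lambda>V. int (multiplicity_in H M V))"
  unfolding additive_invariant_def by (auto intro: multiplicity_in_iso multiplicity_in_dsum simp flip: of_nat_add)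

section \<open>Ring structure, dimension and duality on classes of modules\<close>

context hopf_algebra
begin

lemma frag_tensor_keys:
  assumes x: "Poly_Mapping.keys x \<subseteq> fdmods H" and y: "Poly_Mapping.keys y \<subseteq> fdmods H"
  shows "Poly_Mapping.keys (frag_tensor H x y) \<subseteq> fdmods H"
  using x
proof (induction x rule: frag_induct)
  case (single V)
  from y show ?case
    by (induction y rule: frag_induct) (simp_all add: frag_tensor_simps mod_tensor_fdmods keys_diff_subset single)
qed (simp_all add: frag_tensor_simps keys_diff_subset)

lemma frag_tensor_assoc:
  assumes "Poly_Mapping.keys x \<subseteq> fdmods H" "Poly_Mapping.keys y \<subseteq> fdmods H" "Poly_Mapping.keys z \<subseteq> fdmods H"
  shows "frag_tensor H (frag_tensor H x y) z = frag_tensor H x (frag_tensor H y z)"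
  using assms(1)
proof (induction x rule: frag_induct)
  case (single U)
  from assms(2) show ?case
  proof (induction y rule: frag_induct)
    case (single V)
    from assms(3) show ?case
      by (induction z rule: frag_induct) (simp_all add: frag_tensor_simps mod_tensor_assoc \<open>U \<in> fdmods H\<close> \<open>V \<in> fdmods H\<close>)
  qed (simp_all add: frag_tensor_simps)
qed (simp_all add: frag_tensor_simps)

lemma frag_tensor_one:
  assumes "Poly_Mapping.keys x \<subseteq> fdmods H"
  shows "frag_tensor H (frag_of (mod_triv H)) x = x" "frag_tensor H x (frag_of (mod_triv H)) = x"
  using assms by (induction x rule: frag_induct) (simp_all add: frag_tensor_simps mod_tensor_triv_left mod_tensor_triv_right)

lemma ring_free_mod_ring: "ring (free_mod_ring H)"
proof (rule ringI)
  show "abelian_group (free_mod_ring H)"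
  proof (rule abelian_groupI)
    fix x assume "x \<in> carrier (free_mod_ring H)"
    then show "\<exists>y\<in>carrier (free_mod_ring H). y \<oplus>\<^bsub>free_mod_ring H\<^esub> x = \<zero>\<^bsub>free_mod_ring H\<^esub>"
      by (intro bexI[of _ "- x"]) auto
  qed (auto simp: dest: subsetD[OF Poly_Mapping.keys_add])
  show "Group.monoid (free_mod_ring H)"
    by (rule monoidI) (simp_all add: frag_tensor_keys frag_tensor_assoc frag_tensor_one mod_triv_fdmods)
qed (simp_all add: frag_tensor_add)

lemma green_rels_tensor_left:
  assumes c: "c \<in> green_rels H" and x: "Poly_Mapping.keys x \<subseteq> fdmods H"
  shows "frag_tensor H x c \<in> green_rels H"
  using x
proof (induction x rule: frag_induct)
  case (single U)
  from c show ?case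
    by (induction rule: green_rels_induct)
      (simp_all add: frag_tensor_simps frag_tensor_minus frag_tensor_add green_rels_zero green_rels_add green_rels_minus
        green_rels_iso green_rels_dsum mod_tensor_fdmods tensor_iso_right tensor_dsum_right single)
qed (simp_all add: frag_tensor_simps green_rels_zero green_rels_diff)

lemma green_rels_tensor_right:
  assumes c: "c \<in> green_rels H" and x: "Poly_Mapping.keys x \<subseteq> fdmods H"
  shows "frag_tensor H c x \<in> green_rels H"
  using x
proof (induction x rule: frag_induct)
  case (single U)
  from c show ?case
    by (induction rule: green_rels_induct)
      (simp_all add: frag_tensor_simps frag_tensor_minus frag_tensor_add green_rels_zero green_rels_add green_rels_minus
        green_rels_iso green_rels_dsum mod_tensor_fdmods tensor_iso_left tensor_dsum_left single)
qed (simp_all add: frag_tensor_simps green_rels_zero green_rels_diff)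

text \<open>Tensoring with a module on either side preserves isomorphisms and direct sums, hence
  carries the generating relations to relations.\<close>

lemma green_rels_ideal: "ideal (green_rels H) (free_mod_ring H)"
proof (rule idealI[OF ring_free_mod_ring])
  show "subgroup (green_rels H) (add_monoid (free_mod_ring H))"
    unfolding add_monoid_free_mod_ring by (rule green_rels_subgroup)
qed (simp_all add: green_rels_tensor_left green_rels_tensor_right)

sublocale green: ring "green_ring H"
  unfolding green_ring_def by (rule ideal.quotient_is_ring[OF green_rels_ideal])

definition cls :: "(('k, 'h) fdmod \<Rightarrow>\<^sub>0 int) \<Rightarrow> ('k, 'h) green" where
  "cls c = green_rels H +>\<^bsub>free_mod_ring H\<^esub> c"

lemma green_class_eq: "green_class H V = cls (frag_of V)"
  by (simp add: green_class_def cls_def)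

lemma mem_cls: "d \<in> cls c \<longleftrightarrow> d - c \<in> green_rels H"
proof -
  have "d \<in> cls c \<longleftrightarrow> (\<exists>r\<in>green_rels H. d = r + c)"
    by (auto simp: cls_def a_r_coset_def r_coset_def)
  also have "\<dots> \<longleftrightarrow> d - c \<in> green_rels H"
    by (metis add_diff_cancel_right' diff_add_cancel)
  finally show ?thesis .
qed

lemma cls_eq_iff: "cls c = cls d \<longleftrightarrow> c - d \<in> green_rels H"
proof
  assume "cls c = cls d"
  then have "c \<in> cls d"
    using mem_cls[of c c] green_rels_zero by auto
  then show "c - d \<in> green_rels H"
    by (simp add: mem_cls)
next
  assume cd: "c - d \<in> green_rels H"
  have "e - c \<in> green_rels H \<longleftrightarrow> e - d \<in> green_rels H" for e
    using green_rels_add[OF _ cd, of "e - c"] green_rels_diff[OF _ cd, of "e - d"] by auto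
  then show "cls c = cls d"
    by (auto simp: mem_cls)
qed

lemma carrier_green: "x \<in> carrier (green_ring H) \<longleftrightarrow> (\<exists>c. Poly_Mapping.keys c \<subseteq> fdmods H \<and> x = cls c)"
  by (auto simp: green_ring_def FactRing_def A_RCOSETS_def' cls_def)

lemma cls_hom: "cls \<in> Ring.ring_hom (free_mod_ring H) (green_ring H)"
  using ideal.rcos_ring_hom[OF green_rels_ideal] by (simp add: green_ring_def cls_def[abs_def])

lemma cls_closed: "Poly_Mapping.keys c \<subseteq> fdmods H \<Longrightarrow> cls c \<in> carrier (green_ring H)"
  using carrier_green by blast

lemma cls_add: "Poly_Mapping.keys c \<subseteq> fdmods H \<Longrightarrow> Poly_Mapping.keys d \<subseteq> fdmods H \<Longrightarrow> cls c \<oplus>\<^bsub>green_ring H\<^esub> cls d = cls (c + d)"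
  using Ring.ring_hom_add[OF cls_hom, of c d] by simp

lemma cls_mult: "Poly_Mapping.keys c \<subseteq> fdmods H \<Longrightarrow> Poly_Mapping.keys d \<subseteq> fdmods H \<Longrightarrow> cls c \<otimes>\<^bsub>green_ring H\<^esub> cls d = cls (frag_tensor H c d)"
  using Ring.ring_hom_mult[OF cls_hom, of c d] by simp

lemma cls_one: "\<one>\<^bsub>green_ring H\<^esub> = cls (frag_of (mod_triv H))"
  using Ring.ring_hom_one[OF cls_hom] by simp

lemma cls_zero: "\<zero>\<^bsub>green_ring H\<^esub> = cls 0"
  using green.add.r_cancel_one[of "cls 0" "cls 0"] cls_add[of 0 0] cls_closed[of 0] by simp

lemma cls_minus: "Poly_Mapping.keys c \<subseteq> fdmods H \<Longrightarrow> \<ominus>\<^bsub>green_ring H\<^esub> cls c = cls (- c)"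
  by (rule green.minus_equality) (simp_all add: cls_add cls_zero cls_closed)

lemma cls_diff: "Poly_Mapping.keys c \<subseteq> fdmods H \<Longrightarrow> Poly_Mapping.keys d \<subseteq> fdmods H \<Longrightarrow> cls c \<ominus>\<^bsub>green_ring H\<^esub> cls d = cls (c - d)"
  by (simp add: a_minus_def cls_minus cls_add)

lemma green_class_closed: "V \<in> fdmods H \<Longrightarrow> green_class H V \<in> carrier (green_ring H)"
  by (simp add: green_class_eq cls_closed)

lemma green_class_mult:
  "V \<in> fdmods H \<Longrightarrow> W \<in> fdmods H \<Longrightarrow> green_class H V \<otimes>\<^bsub>green_ring H\<^esub> green_class H W = green_class H (mod_tensor H V W)"
  by (simp add: green_class_eq cls_mult frag_tensor_simps)

lemma green_class_one: "\<one>\<^bsub>green_ring H\<^esub> = green_class H (mod_triv H)"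
  by (simp add: green_class_eq cls_one)

lemma green_class_dsum:
  "V \<in> fdmods H \<Longrightarrow> U \<in> fdmods H \<Longrightarrow> W \<in> fdmods H \<Longrightarrow> is_dsum V U W \<Longrightarrow>
    green_class H V = green_class H U \<oplus>\<^bsub>green_ring H\<^esub> green_class H W"
  using green_rels_dsum[of V H U W] by (simp add: green_class_eq cls_add cls_eq_iff diff_diff_add)

lemma green_class_iso:
  "V \<in> fdmods H \<Longrightarrow> W \<in> fdmods H \<Longrightarrow> mod_iso V W \<Longrightarrow> green_class H V = green_class H W"
  using green_rels_iso[of V H W] by (simp add: green_class_eq cls_eq_iff)

text \<open>A zero module satisfies V = V + V, so its class cancels.\<close>

lemma green_class_zero: "V \<in> fdmods H \<Longrightarrow> fst V = 0 \<Longrightarrow> green_class H V = \<zero>\<^bsub>green_ring H\<^esub>"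
  using green_class_dsum[of V V V] is_dsum_zero[of V H V] green_class_closed[of V] green.add.r_cancel_one' by metis

lemma green_lift_cls: "additive_invariant H \<phi> \<Longrightarrow> green_lift \<phi> (cls c) = frag_eval \<phi> c"
proof -
  assume \<phi>: "additive_invariant H \<phi>"
  have "c \<in> cls c"
    by (simp add: mem_cls green_rels_zero)
  then have "(SOME d. d \<in> cls c) \<in> cls c"
    by (rule someI)
  then show ?thesis
    using additive_invariant_rels[OF \<phi>] by (fastforce simp: green_lift_def mem_cls frag_eval_diff)
qed

lemma green_lift_add:
  "additive_invariant H \<phi> \<Longrightarrow> x \<in> carrier (green_ring H) \<Longrightarrow> y \<in> carrier (green_ring H) \<Longrightarrow>
    green_lift \<phi> (x \<oplus>\<^bsub>green_ring H\<^esub> y) = green_lift \<phi> x + green_lift \<phi> y"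
  by (auto simp: carrier_green cls_add green_lift_cls frag_eval_add)

lemma green_lift_class: "additive_invariant H \<phi> \<Longrightarrow> green_lift \<phi> (green_class H V) = \<phi> V"
  by (simp add: green_class_eq green_lift_cls)

text \<open>All representatives of x have the same dimension, so \<open>the_elem\<close> is applied
  to a singleton and returns the value at any representative.\<close>

lemma green_dim_eq:
  assumes "x \<in> carrier (green_ring H)"
  shows "green_dim x = green_lift (\<lambda>V. int (fst V)) x"
proof -
  obtain c where c: "x = cls c"
    using assms carrier_green by auto
  let ?v = "frag_eval (\<lambda>V. int (fst V))"
  have eq: "?v d = ?v c" if "d \<in> x" for d
    using additive_invariant_rels[OF additive_invariant_dim, of "d - c"] that by (simp add: c mem_cls frag_eval_diff)
  have "c \<in> x"
    by (simp add: c mem_cls green_rels_zero)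
  from imageI[OF this, of ?v] have "?v ` x = {?v c}"
    by (intro subset_antisym image_subsetI) (simp_all only: eq singleton_iff insert_subset empty_subsetI simp_thms)
  moreover have "green_dim x = the_elem (?v ` x)"
    by (simp only: green_dim_def frag_eval_def[abs_def] of_int_eq_id id_apply)
  ultimately show ?thesis
    by (simp add: c green_lift_cls[OF additive_invariant_dim])
qed

text \<open>Dualizing preserves the generating relations, so the cosets in the union that defines
  \<open>green_dual\<close> all coincide.\<close>

lemma green_dual_cls:
  assumes "Poly_Mapping.keys c \<subseteq> fdmods H"
  shows "green_dual H (cls c) = cls (frag_extend (\<lambda>V. frag_of (mod_dual H V)) c)"
proof -
  let ?D = "frag_extend (\<lambda>V. frag_of (mod_dual H V))"
  have r: "?D r \<in> green_rels H" if "r \<in> green_rels H" for r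
    using that
    by (induction rule: green_rels_induct)
      (simp_all add: frag_extend_diff frag_extend_add frag_extend_minus green_rels_zero green_rels_iso green_rels_dsum
        green_rels_minus green_rels_add dual_iso dual_dsum mod_dual_fdmods)
  have "cls (?D d) = cls (?D c)" if "d \<in> cls c" for d
    using r[of "d - c"] that by (simp add: mem_cls cls_eq_iff frag_extend_diff)
  moreover have "c \<in> cls c"
    by (simp add: mem_cls green_rels_zero)
  ultimately show ?thesis
    unfolding green_dual_def cls_def[symmetric] by blast
qed

lemma green_dual_class: "V \<in> fdmods H \<Longrightarrow> green_dual H (green_class H V) = green_class H (mod_dual H V)"
  by (simp add: green_class_eq green_dual_cls)

lemma green_dual_add:
  assumes "x \<in> carrier (green_ring H)" "y \<in> carrier (green_ring H)"
  shows "green_dual H (x \<oplus>\<^bsub>green_ring H\<^esub> y) = green_dual H x \<oplus>\<^bsub>green_ring H\<^esub> green_dual H y"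
proof -
  have k: "Poly_Mapping.keys (frag_extend (\<lambda>V. frag_of (mod_dual H V)) c) \<subseteq> fdmods H" if "Poly_Mapping.keys c \<subseteq> fdmods H" for c
    using keys_frag_extend[of "\<lambda>V. frag_of (mod_dual H V)" c] that mod_dual_fdmods by (fastforce simp: keys_frag_of)
  obtain c d where cd: "Poly_Mapping.keys c \<subseteq> fdmods H" "Poly_Mapping.keys d \<subseteq> fdmods H" "x = cls c" "y = cls d"
    using assms carrier_green by auto
  have "Poly_Mapping.keys (c + d) \<subseteq> fdmods H"
    using cd(1,2) Poly_Mapping.keys_add[of c d] by blast
  then show ?thesis
    using cd k by (simp add: cls_add green_dual_cls frag_extend_add)
qed

text \<open>The indecomposable classes generate the additive group:
  \<open>fdmods_dsum_induct\<close> reaches the classes of modules, and formal differences of these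
  reach everything.\<close>

lemma green_ring_induct [consumes 1, case_names zero indecomposable add minus]:
  assumes x: "x \<in> carrier (green_ring H)"
    and 0: "P \<zero>\<^bsub>green_ring H\<^esub>"
    and 1: "\<And>M. M \<in> indecomposables H \<Longrightarrow> P (green_class H M)"
    and 2: "\<And>x y. x \<in> carrier (green_ring H) \<Longrightarrow> y \<in> carrier (green_ring H) \<Longrightarrow> P x \<Longrightarrow> P y \<Longrightarrow> P (x \<oplus>\<^bsub>green_ring H\<^esub> y)"
    and 3: "\<And>x. x \<in> carrier (green_ring H) \<Longrightarrow> P x \<Longrightarrow> P (\<ominus>\<^bsub>green_ring H\<^esub> x)"
  shows "P x"
proof -
  have V: "P (green_class H V)" if "V \<in> fdmods H" for V
    using that
  proof (induction rule: fdmods_dsum_induct)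
    case (dsum V U W)
    then show ?case
      using 2[OF green_class_closed green_class_closed] by (simp add: green_class_dsum)
  qed (simp_all add: 0 1 green_class_zero)
  obtain c where c: "Poly_Mapping.keys c \<subseteq> fdmods H" "x = cls c"
    using x carrier_green by auto
  have "P (cls c)"
    using c(1)
  proof (induction c rule: frag_induct)
    case (diff a b)
    then show ?case
      using assms(4)[OF cls_closed[of a] green.a_inv_closed[OF cls_closed[of b]]] 3[OF cls_closed[of b]]
      by (simp add: cls_diff[symmetric] a_minus_def)
  qed (use 0 V in \<open>simp_all add: cls_zero green_class_eq\<close>)
  then show ?thesis
    by (simp add: c)
qed

end

section \<open>Representation ideals\<close>

locale finite_type_hopf_algebra = hopf_algebra H
  for H :: "('k::field, 'h::ring_1) hopf" (structure) +
  assumes finite_type: "finite_rep_type H"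
begin

text \<open>The coordinate at b counts copies of a chosen indecomposable M of class b; the
  multiplicity of M is additive and so descends to the Green ring.\<close>

definition green_co :: "('k, 'h) green \<Rightarrow> ('k, 'h) green \<Rightarrow> int" where
  "green_co x b = green_lift (\<lambda>V. int (multiplicity_in H (SOME M. M \<in> indecomposables H \<and> green_class H M = b) V)) x"

lemma basis_representative:
  assumes "b \<in> indec_basis H"
  obtains M where "M \<in> indecomposables H" "green_class H M = b"
    "\<forall>x. green_co x b = green_lift (\<lambda>V. int (multiplicity_in H M V)) x"
proof -
  let ?M = "SOME M. M \<in> indecomposables H \<and> green_class H M = b"
  have "?M \<in> indecomposables H \<and> green_class H ?M = b"
    by (rule someI_ex) (use assms in \<open>auto simp: indec_basis_def\<close>)
  then show thesis
    by (intro that[of ?M]) (simp_all add: green_co_def)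
qed

text \<open>The multiplicity of M depends only on the class of a module. It is 1 at M and 0 at any
  indecomposable not isomorphic to M, so it separates the two classes.\<close>

lemma green_class_indecomposable_iff:
  assumes M: "M \<in> indecomposables H" and N: "N \<in> indecomposables H"
  shows "green_class H M = green_class H N \<longleftrightarrow> mod_iso M N"
proof
  assume "green_class H M = green_class H N"
  then have "int (multiplicity_in H M M) = int (multiplicity_in H M N)"
    using green_lift_class[OF additive_invariant_multiplicity[OF M]] by metis
  then have eq: "multiplicity_in H M M = multiplicity_in H M N"
    by (simp only: of_nat_eq_iff)
  have "multiplicity_in H M M = 1"
    unfolding multiplicity_in_indecomposable[OF M M] by (simp only: mod_iso_refl[OF indecomposablesD(1)[OF M]] if_True)
  then have "multiplicity_in H M N \<noteq> 0"
    unfolding eq by (simp only: one_neq_zero not_False_eq_True)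
  then show "mod_iso M N"
    unfolding multiplicity_in_indecomposable[OF M N] by presburger
next
  assume "mod_iso M N"
  then show "green_class H M = green_class H N"
    by (rule green_class_iso[OF indecomposablesD(1)[OF M] indecomposablesD(1)[OF N]])
qed

lemma finite_indec_basis: "finite (indec_basis H)"
proof -
  let ?r = "{(V, W). V \<in> indecomposables H \<and> W \<in> indecomposables H \<and> mod_iso V W}"
  have "green_class H M \<in> (\<lambda>C. green_class H (SOME V. V \<in> C)) ` (indecomposables H // ?r)" if M: "M \<in> indecomposables H" for M
  proof -
    have "M \<in> ?r `` {M}"
      using M mod_iso_refl[OF indecomposablesD(1)[OF M]] by auto
    then have "(SOME V. V \<in> ?r `` {M}) \<in> ?r `` {M}"
      by (rule someI)
    then have "green_class H M = green_class H (SOME V. V \<in> ?r `` {M})"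
      using green_class_indecomposable_iff[OF M, of "SOME V. V \<in> ?r `` {M}"] by auto
    moreover have "?r `` {M} \<in> indecomposables H // ?r"
      using M by (rule quotientI)
    ultimately show ?thesis
      by (rule image_eqI)
  qed
  then have "indec_basis H \<subseteq> (\<lambda>C. green_class H (SOME V. V \<in> C)) ` (indecomposables H // ?r)"
    unfolding indec_basis_def by (rule image_subsetI)
  then show ?thesis
    using finite_type unfolding finite_rep_type_def by (rule finite_surj[rotated])
qed

lemma green_co_class:
  assumes "b \<in> indec_basis H"
  shows "0 \<le> green_co (green_class H V) b"
proof -
  obtain M where "M \<in> indecomposables H" "green_class H M = b" "\<forall>x. green_co x b = green_lift (\<lambda>V. int (multiplicity_in H M V)) x"
    using assms by (rule basis_representative)
  then show ?thesis
    by (simp add: green_lift_class additive_invariant_multiplicity)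
qed

lemma green_co_add:
  assumes "b \<in> indec_basis H" "x \<in> carrier (green_ring H)" "y \<in> carrier (green_ring H)"
  shows "green_co (x \<oplus>\<^bsub>green_ring H\<^esub> y) b = green_co x b + green_co y b"
proof -
  obtain M where "M \<in> indecomposables H" "green_class H M = b" "\<forall>x. green_co x b = green_lift (\<lambda>V. int (multiplicity_in H M V)) x"
    using assms(1) by (rule basis_representative)
  then show ?thesis
    using assms(2,3) by (simp add: green_lift_add additive_invariant_multiplicity)
qed

lemma green_co_basis:
  assumes "b \<in> indec_basis H" "b' \<in> indec_basis H"
  shows "green_co b b' = (if b = b' then 1 else 0)"
proof -
  obtain M where M: "M \<in> indecomposables H" "green_class H M = b'"
    "\<forall>x. green_co x b' = green_lift (\<lambda>V. int (multiplicity_in H M V)) x"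
    using assms(2) by (rule basis_representative)
  obtain N where N: "N \<in> indecomposables H" "green_class H N = b"
    using assms(1) by (auto simp: indec_basis_def)
  have "green_co b b' = (if mod_iso M N then 1 else 0)"
    by (simp add: M(3) N(2)[symmetric] green_lift_class additive_invariant_multiplicity M(1) multiplicity_in_indecomposable N(1))
  then show ?thesis
    using green_class_indecomposable_iff[OF M(1) N(1)] by (auto simp: M(2) N(2))
qed

lemma indec_basis_closed: "indec_basis H \<subseteq> carrier (green_ring H)"
  unfolding indec_basis_def using green_class_closed indecomposablesD(1) by blast

lemma green_int_multiple_closed: "x \<in> carrier (green_ring H) \<Longrightarrow> [(n::int)] \<cdot>\<^bsub>green_ring H\<^esub> x \<in> carrier (green_ring H)"
  by (cases "n \<ge> 0") (simp_all add: add_pow_int_ge add_pow_int_lt)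

lemma green_int_multiple_add:
  "x \<in> carrier (green_ring H) \<Longrightarrow> [(m + n :: int)] \<cdot>\<^bsub>green_ring H\<^esub> x = [m] \<cdot>\<^bsub>green_ring H\<^esub> x \<oplus>\<^bsub>green_ring H\<^esub> [n] \<cdot>\<^bsub>green_ring H\<^esub> x"
  using group.int_pow_mult[OF green.a_group, of x m n] by (simp add: add_pow_def)

text \<open>The right-hand side \<open>?E x\<close> is additive in x, so it suffices to compare on
  indecomposable classes, where the coordinates are Kronecker deltas.\<close>

lemma green_expansion:
  assumes "x \<in> carrier (green_ring H)"
  shows "x = (\<Oplus>\<^bsub>green_ring H\<^esub>b\<in>indec_basis H. [green_co x b] \<cdot>\<^bsub>green_ring H\<^esub> b)"
proof -
  let ?R = "green_ring H"
  let ?E = "\<lambda>x. \<Oplus>\<^bsub>?R\<^esub>b\<in>indec_basis H. [green_co x b] \<cdot>\<^bsub>?R\<^esub> b"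
  have cl: "[(n::int)] \<cdot>\<^bsub>?R\<^esub> b \<in> carrier ?R" if "b \<in> indec_basis H" for n b
    using that indec_basis_closed green_int_multiple_closed by blast
  have Ecl: "?E x \<in> carrier ?R" for x
    by (rule green.finsum_closed) (simp add: Pi_def cl)
  have E_add: "?E (x \<oplus>\<^bsub>?R\<^esub> y) = ?E x \<oplus>\<^bsub>?R\<^esub> ?E y" if "x \<in> carrier ?R" "y \<in> carrier ?R" for x y
  proof -
    have "?E (x \<oplus>\<^bsub>?R\<^esub> y) = (\<Oplus>\<^bsub>?R\<^esub>b\<in>indec_basis H. [green_co x b] \<cdot>\<^bsub>?R\<^esub> b \<oplus>\<^bsub>?R\<^esub> [green_co y b] \<cdot>\<^bsub>?R\<^esub> b)"
      using that cl indec_basis_closed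
      by (intro green.finsum_cong'[OF refl]) (auto simp: Pi_def green_co_add green_int_multiple_add subset_iff)
    also have "\<dots> = ?E x \<oplus>\<^bsub>?R\<^esub> ?E y"
      by (rule green.finsum_addf) (simp_all add: Pi_def cl)
    finally show ?thesis .
  qed
  have E_zero: "?E \<zero>\<^bsub>?R\<^esub> = \<zero>\<^bsub>?R\<^esub>"
    using E_add[of "\<zero>\<^bsub>?R\<^esub>" "\<zero>\<^bsub>?R\<^esub>"] Ecl[of "\<zero>\<^bsub>?R\<^esub>"] green.add.r_cancel_one' by simp
  have "?E x = x"
    using assms
  proof (induction rule: green_ring_induct)
    case zero
    show ?case
      by (rule E_zero)
  next
    case (indecomposable M)
    let ?b = "green_class H M"
    have b: "?b \<in> indec_basis H"
      using indecomposable by (simp add: indec_basis_def)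
    have "?E ?b = (\<Oplus>\<^bsub>?R\<^esub>b\<in>indec_basis H. if ?b = b then b else \<zero>\<^bsub>?R\<^esub>)"
      using b indec_basis_closed
      by (intro green.finsum_cong'[OF refl]) (auto simp: Pi_def green_co_basis subset_iff add_pow_int_ge)
    also have "\<dots> = ?b"
      using b indec_basis_closed by (intro green.finsum_singleton finite_indec_basis) auto
    finally show ?case .
  next
    case (add x y)
    then show ?case
      by (simp only: E_add)
  next
    case (minus x)
    have "?E (\<ominus>\<^bsub>?R\<^esub> x) \<oplus>\<^bsub>?R\<^esub> x = \<zero>\<^bsub>?R\<^esub>"
      using E_add[of "\<ominus>\<^bsub>?R\<^esub> x" x] minus E_zero by (simp add: green.l_neg)
    then show ?case
      using green.minus_equality[of "?E (\<ominus>\<^bsub>?R\<^esub> x)" x] Ecl minus(1) by simp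
  qed
  then show ?thesis
    by simp
qed

sublocale zbasis "green_ring H" "indec_basis H" green_co
  using finite_indec_basis indec_basis_closed green_co_add green_co_basis green_expansion by unfold_locales blast+

lemma green_coeff_eq: "x \<in> carrier (green_ring H) \<Longrightarrow> b \<in> indec_basis H \<Longrightarrow> green_coeff H x b = green_co x b"
  by (simp add: green_coeff_def lookup_zcoords)

lemma one_basis: "\<one>\<^bsub>green_ring H\<^esub> \<in> indec_basis H"
  by (simp add: green_class_one indec_basis_def mod_triv_indecomposable)

lemma basis_mult_nonneg:
  assumes "a \<in> indec_basis H" "b \<in> indec_basis H" "c \<in> indec_basis H"
  shows "0 \<le> green_co (a \<otimes>\<^bsub>green_ring H\<^esub> b) c"
proof -
  obtain M N where "M \<in> indecomposables H" "N \<in> indecomposables H" "a = green_class H M" "b = green_class H N"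
    using assms(1,2) unfolding indec_basis_def by (elim imageE)
  then show ?thesis
    by (simp add: green_class_mult indecomposablesD(1) green_co_class[OF assms(3)])
qed

lemma green_dual_basis:
  assumes "b \<in> indec_basis H"
  shows "green_dual H b \<in> carrier (green_ring H)" "\<And>c. c \<in> indec_basis H \<Longrightarrow> 0 \<le> green_co (green_dual H b) c"
proof -
  obtain M where M: "M \<in> indecomposables H" "b = green_class H M"
    using assms unfolding indec_basis_def by (elim imageE)
  then show "green_dual H b \<in> carrier (green_ring H)"
    by (simp add: green_dual_class indecomposablesD(1) green_class_closed mod_dual_fdmods)
  show "0 \<le> green_co (green_dual H b) c" if "c \<in> indec_basis H" for c
    using M by (simp add: green_dual_class indecomposablesD(1) green_co_class[OF that])
qed

text \<open>An ideal that contains the unit contains every basis element, against the properness of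
  X.\<close>

lemma one_not_in_rep_ideal: "spans_rep_ideal H X \<Longrightarrow> \<one>\<^bsub>green_ring H\<^esub> \<notin> X"
proof
  assume X: "spans_rep_ideal H X" and one: "\<one>\<^bsub>green_ring H\<^esub> \<in> X"
  then have sub: "X \<subseteq> indec_basis H" and I: "ideal (zspan (green_ring H) X) (green_ring H)"
    by (auto simp: spans_rep_ideal_def)
  have "\<one>\<^bsub>green_ring H\<^esub> \<in> zspan (green_ring H) X"
    using zspan_basis_iff[OF sub one_basis] one by simp
  then have "zspan (green_ring H) X = carrier (green_ring H)"
    by (rule ideal.one_imp_carrier[OF I])
  then have "indec_basis H \<subseteq> X"
    using zspan_basis_iff[OF sub] basisD by blast
  then show False
    using X by (auto simp: spans_rep_ideal_def)
qed

lemma rep_ideal_empty: "spans_rep_ideal H {}"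
proof -
  have "green_dual H \<zero>\<^bsub>green_ring H\<^esub> = \<zero>\<^bsub>green_ring H\<^esub>"
    using green_dual_cls[of 0] by (simp add: cls_zero)
  then show ?thesis
    using one_basis green.zeroideal by (auto simp: spans_rep_ideal_def zspan_empty)
qed

lemma rep_ideal_Un:
  assumes X: "spans_rep_ideal H X" and Y: "spans_rep_ideal H Y"
  shows "spans_rep_ideal H (X \<union> Y)"
proof -
  let ?R = "green_ring H"
  have sub: "X \<subseteq> indec_basis H" "Y \<subseteq> indec_basis H"
    and I: "ideal (zspan ?R X) ?R" "ideal (zspan ?R Y) ?R"
    and d: "\<And>x. x \<in> zspan ?R X \<Longrightarrow> green_dual H x \<in> zspan ?R X" "\<And>x. x \<in> zspan ?R Y \<Longrightarrow> green_dual H x \<in> zspan ?R Y"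
    using X Y by (auto simp: spans_rep_ideal_def)
  \<comment> \<open>A union of proper subsets could be everything; here the unit is a basis element
    that lies outside both.\<close>
  have "X \<union> Y \<subset> indec_basis H"
    using sub one_basis one_not_in_rep_ideal[OF X] one_not_in_rep_ideal[OF Y] by blast
  moreover have "ideal (zspan ?R (X \<union> Y)) ?R"
    unfolding zspan_Un[OF sub] by (rule green.add_ideals[OF I])
  moreover have "green_dual H z \<in> zspan ?R (X \<union> Y)" if "z \<in> zspan ?R (X \<union> Y)" for z
  proof -
    obtain x y where xy: "x \<in> zspan ?R X" "y \<in> zspan ?R Y" "z = x \<oplus>\<^bsub>?R\<^esub> y"
      using \<open>z \<in> zspan ?R (X \<union> Y)\<close> unfolding zspan_Un[OF sub] set_add_def' by blast
    then have "green_dual H z = green_dual H x \<oplus>\<^bsub>?R\<^esub> green_dual H y"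
      using green_dual_add zspan_iff[OF sub(1)] zspan_iff[OF sub(2)] by simp
    then show ?thesis
      using d xy unfolding zspan_Un[OF sub] set_add_def' by blast
  qed
  ultimately show ?thesis
    unfolding spans_rep_ideal_def by blast
qed

text \<open>\<open>GREATEST\<close> is meaningful only if some candidate contains all others. The
  basis is finite, so there are finitely many candidates, and their union is one again.\<close>

lemma rep_ideal_X_max: "spans_rep_ideal H (X_max H)"
proof -
  let ?A = "{X. spans_rep_ideal H X}"
  have "?A \<subseteq> Pow (indec_basis H)"
    by (auto simp: spans_rep_ideal_def)
  then have "finite ?A"
    using finite_indec_basis finite_subset by blast
  have "spans_rep_ideal H (\<Union>F)" if "finite F" "F \<subseteq> ?A" for F
    using that by (induction F rule: finite_induct) (auto simp: rep_ideal_empty rep_ideal_Un)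
  then have "spans_rep_ideal H (\<Union>?A)"
    using \<open>finite ?A\<close> by blast
  then have "X_max H = \<Union>?A"
    unfolding X_max_def by (intro Greatest_equality) auto
  then show ?thesis
    using \<open>spans_rep_ideal H (\<Union>?A)\<close> by simp
qed

end

section \<open>Characters of transitive based rings\<close>

text \<open>
  The eigenvalue of a positive matrix is found by maximizing \<open>t\<close> under \<open>A v \<ge> t v\<close> over the
  simplex: at a maximum equality holds, since otherwise \<open>A v\<close> admits a larger \<open>t\<close>.
\<close>

lemma perron_frobenius:
  fixes A :: "'i \<Rightarrow> 'i \<Rightarrow> real"
  assumes fin: "finite I" and ne: "I \<noteq> {}" and pos: "\<And>i j. i \<in> I \<Longrightarrow> j \<in> I \<Longrightarrow> A i j > 0"
  shows "\<exists>r v. (\<forall>i\<in>I. v i > 0) \<and> (\<forall>i\<in>I. (\<Sum>j\<in>I. A i j * v j) = r * v i)"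
proof -
  \<comment> \<open>A bound for every admissible t, found by summing
    \<open>t * v i \<le> (\<Sum>j\<in>I. A i j * v j)\<close> over i, with coordinates at most 1 and
    total 1. It makes the search region compact.\<close>
  define T where "T = (\<Sum>i\<in>I. \<Sum>j\<in>I. A i j)"
  \<comment> \<open>Vectors on I are functions on the whole index type, pinned to 0 outside I; as a
    product of compact sets, K is compact.\<close>
  define K where "K = PiE UNIV (\<lambda>i. if i \<in> I then {0..1} else {0::real})"
  define S where "S = {(t, v). (\<Sum>i\<in>I. v i) = 1 \<and> (\<forall>i\<in>I. t * v i \<le> (\<Sum>j\<in>I. A i j * v j))}"
  define C where "C = ({0..T} \<times> K) \<inter> S"
  have "compactin (product_topology (\<lambda>i. euclidean) UNIV) K"
    unfolding K_def by (subst compactin_PiE) simp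
  then have K: "compact K"
    by (simp add: euclidean_product_topology)
  have cont: "continuous_on UNIV (\<lambda>p::real \<times> ('i \<Rightarrow> real). snd p i)" for i
    by (rule continuous_on_compose2[OF continuous_on_product_coordinates continuous_on_snd[OF continuous_on_id]]) auto
  have S: "S = {p. (\<Sum>i\<in>I. snd p i) = 1} \<inter> (\<Inter>i\<in>I. {p. fst p * snd p i \<le> (\<Sum>j\<in>I. A i j * snd p j)})"
    by (auto simp: S_def)
  have c1: "closed {p::real \<times> ('i \<Rightarrow> real). (\<Sum>i\<in>I. snd p i) = 1}"
    by (intro closed_Collect_eq continuous_intros cont)
  have c2: "closed {p::real \<times> ('i \<Rightarrow> real). fst p * snd p i \<le> (\<Sum>j\<in>I. A i j * snd p j)}" for i
    by (intro closed_Collect_le continuous_intros cont)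
  have "closed S"
    unfolding S by (intro closed_Int closed_INT ballI c1 c2)
  then have C: "compact C"
    unfolding C_def by (intro compact_Int_closed compact_Times K compact_Icc)
  obtain i0 where i0: "i0 \<in> I"
    using ne by blast
  have T0: "0 \<le> T"
    unfolding T_def by (intro sum_nonneg less_imp_le pos)
  have "(0, \<lambda>i. if i = i0 then 1 else 0) \<in> C"
    using i0 fin T0 pos by (auto simp: C_def S_def K_def if_distrib less_imp_le cong: if_cong)
  then have "C \<noteq> {}"
    by blast
  then obtain p where p: "p \<in> C" "\<And>q. q \<in> C \<Longrightarrow> fst q \<le> fst p"
    using continuous_attains_sup[OF C _ continuous_on_fst[OF continuous_on_id]] by auto
  obtain t v where tv: "p = (t, v)"
    by fastforce
  have v0: "0 \<le> v i" if "i \<in> I" for i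
    using p(1) that by (auto simp: tv C_def K_def PiE_def Pi_def split: if_splits)
  have v1: "(\<Sum>i\<in>I. v i) = 1" and vt: "\<And>i. i \<in> I \<Longrightarrow> t * v i \<le> (\<Sum>j\<in>I. A i j * v j)"
    using p(1) by (auto simp: tv C_def S_def)
  have t0: "0 \<le> t"
    using p(1) by (auto simp: tv C_def)
  define w where "w i = (\<Sum>j\<in>I. A i j * v j)" for i
  have pos_sum: "0 < (\<Sum>j\<in>I. A i j * u j)"
    if i: "i \<in> I" and u: "\<And>j. j \<in> I \<Longrightarrow> 0 \<le> u j" and nz: "\<exists>j\<in>I. u j \<noteq> 0" for i u
  proof -
    obtain j where j: "j \<in> I" "u j \<noteq> 0"
      using nz by blast
    then have "0 < A i j * u j"
      using u[OF j(1)] pos[OF i j(1)] by simp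
    then show ?thesis
      using j fin i u pos by (intro sum_pos2[of _ j]) (auto simp: less_imp_le)
  qed
  have "\<exists>j\<in>I. v j \<noteq> 0"
    using v1 by (metis sum.neutral zero_neq_one)
  then have w: "0 < w i" if "i \<in> I" for i
    unfolding w_def using pos_sum[OF that] v0 by blast
  have max: "s \<le> t"
    if u0: "\<And>i. i \<in> I \<Longrightarrow> 0 \<le> u i" and usum: "(\<Sum>i\<in>I. u i) = 1"
      and su: "\<And>i. i \<in> I \<Longrightarrow> s * u i \<le> (\<Sum>j\<in>I. A i j * u j)" and s0: "0 \<le> s" for s u
  proof -
    let ?u = "\<lambda>i. if i \<in> I then u i else 0"
    have u1: "u i \<le> 1" if "i \<in> I" for i
      using member_le_sum[of i I u] that u0 usum fin by simp
    have "s = (\<Sum>i\<in>I. s * u i)"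
      using usum by (simp flip: sum_distrib_left)
    also have "\<dots> \<le> (\<Sum>i\<in>I. \<Sum>j\<in>I. A i j * u j)"
      by (intro sum_mono su)
    also have "\<dots> \<le> T"
      unfolding T_def using pos u1 by (intro sum_mono) (simp add: less_imp_le mult_left_le)
    finally have "s \<le> T" .
    then have "(s, ?u) \<in> C"
      using u0 usum su s0 u1 by (auto simp: C_def S_def K_def cong: sum.cong)
    then show ?thesis
      using p(2)[of "(s, ?u)"] by (simp add: tv)
  qed
  have eq: "w i = t * v i" if "i \<in> I" for i
  proof (rule ccontr)
    assume i: "w i \<noteq> t * v i"
    define s where "s = (\<Sum>i\<in>I. w i)"
    have s: "0 < s"
      unfolding s_def using w fin ne by (intro sum_pos)
    \<comment> \<open>The vector \<open>w - t v\<close> is non-negative and nonzero, so A makes it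
      positive. With e the least ratio d / w below, \<open>A w = d + t w\<close> dominates
      \<open>(t + e) w\<close>, and w scaled to total 1 contradicts the maximality of t.\<close>
    define d where "d k = (\<Sum>j\<in>I. A k j * (w j - t * v j))" for k
    have d: "0 < d k" if "k \<in> I" for k
      unfolding d_def using vt i \<open>i \<in> I\<close> by (intro pos_sum[OF that]) (auto simp: w_def)
    have dw: "(\<Sum>j\<in>I. A k j * w j) = d k + t * w k" for k
      by (simp add: d_def w_def algebra_simps sum_subtractf sum_distrib_left)
    define e where "e = Min ((\<lambda>k. d k / w k) ` I)"
    have e: "0 < e"
      unfolding e_def using fin ne d w by simp
    have "e * w k \<le> d k" if "k \<in> I" for k
    proof -
      have "e \<le> d k / w k"
        unfolding e_def using fin that by simp
      then show ?thesis
        using w[OF that] by (simp add: pos_le_divide_eq)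
    qed
    then have "(t + e) * (w k / s) \<le> (\<Sum>j\<in>I. A k j * (w j / s))" if "k \<in> I" for k
      using dw[of k] s that by (simp add: distrib_right divide_right_mono flip: sum_divide_distrib)
    then have "t + e \<le> t"
      using w s t0 e by (intro max[of "\<lambda>k. w k / s"]) (auto simp: less_imp_le s_def simp flip: sum_divide_distrib)
    then show False
      using e by simp
  qed
  show ?thesis
  proof (intro exI[of _ t] exI[of _ v] conjI ballI)
    show "0 < v i" if "i \<in> I" for i
      using w[OF that] eq[OF that] t0 v0[OF that] by (metis less_eq_real_def mult_zero_right)
    show "(\<Sum>j\<in>I. A i j * v j) = t * v i" if "i \<in> I" for i
      using eq[OF that] by (simp add: w_def)
  qed
qed

text \<open>Subtract from x the largest multiple of v that stays below it. The difference z is a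
  non-negative solution of the same equation with a zero entry k, and positivity of row k of A
  forces z = 0.\<close>

lemma perron_frobenius_unique:
  fixes A :: "'i \<Rightarrow> 'i \<Rightarrow> real"
  assumes fin: "finite I" and ne: "I \<noteq> {}" and pos: "\<And>i j. i \<in> I \<Longrightarrow> j \<in> I \<Longrightarrow> A i j > 0"
    and v: "\<And>i. i \<in> I \<Longrightarrow> v i > 0" "\<And>i. i \<in> I \<Longrightarrow> (\<Sum>j\<in>I. A i j * v j) = r * v i"
    and x: "\<And>i. i \<in> I \<Longrightarrow> (\<Sum>j\<in>I. A i j * x j) = r * x i"
  shows "\<exists>c. \<forall>i\<in>I. x i = c * v i"
proof -
  define c where "c = Min ((\<lambda>i. x i / v i) ` I)"
  have "c \<in> (\<lambda>i. x i / v i) ` I"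
    unfolding c_def using fin ne by simp
  then obtain k where k: "k \<in> I" "c = x k / v k"
    by blast
  define z where "z i = x i - c * v i" for i
  have z: "0 \<le> z i" if "i \<in> I" for i
  proof -
    have "c \<le> x i / v i"
      unfolding c_def using fin that by simp
    then show ?thesis
      using v(1)[OF that] by (simp add: z_def pos_le_divide_eq)
  qed
  have zk: "z k = 0"
    using k v(1)[OF k(1)] by (simp add: z_def)
  have "(\<Sum>j\<in>I. A k j * z j) = (\<Sum>j\<in>I. A k j * x j) - c * (\<Sum>j\<in>I. A k j * v j)"
    by (simp add: z_def algebra_simps sum_subtractf sum_distrib_left)
  also have "\<dots> = r * z k"
    using v(2)[OF k(1)] x[OF k(1)] by (simp add: z_def algebra_simps)
  finally have "(\<Sum>j\<in>I. A k j * z j) = 0"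
    by (simp add: zk)
  then have "\<forall>j\<in>I. A k j * z j = 0"
    using fin z pos[OF k(1)] by (subst (asm) sum_nonneg_eq_0_iff) (auto simp: less_imp_le)
  then have "\<forall>j\<in>I. z j = 0"
    using pos[OF k(1)] by fastforce
  then show ?thesis
    by (auto simp: z_def)
qed

text \<open>
  Functionals are acted on by right multiplication with the sum of the basis, which is a positive
  matrix, and this commutes with left multiplications. So the Perron--Frobenius functional is an
  eigenvector of all left multiplications.
\<close>

lemma based_ring_character:
  fixes N :: "'i \<Rightarrow> 'i \<Rightarrow> 'i \<Rightarrow> real"
  assumes fin: "finite I" and e: "e \<in> I"
    and nonneg: "\<And>i j k. i \<in> I \<Longrightarrow> j \<in> I \<Longrightarrow> k \<in> I \<Longrightarrow> 0 \<le> N i j k"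
    and unit: "\<And>i k. i \<in> I \<Longrightarrow> k \<in> I \<Longrightarrow> N i e k = (if k = i then 1 else 0)"
    and assoc: "\<And>i j k m. i \<in> I \<Longrightarrow> j \<in> I \<Longrightarrow> k \<in> I \<Longrightarrow> m \<in> I \<Longrightarrow> (\<Sum>l\<in>I. N i j l * N l k m) = (\<Sum>l\<in>I. N j k l * N i l m)"
    and trans: "\<And>i j. i \<in> I \<Longrightarrow> j \<in> I \<Longrightarrow> \<exists>k\<in>I. 0 < N j k i"
  shows "\<exists>d. (\<forall>i\<in>I. 0 < d i) \<and> d e = 1 \<and> (\<forall>i\<in>I. \<forall>j\<in>I. (\<Sum>k\<in>I. N i j k * d k) = d i * d j)"
proof -
  define A where "A j i = (\<Sum>k\<in>I. N j k i)" for j i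
  have A: "0 < A j i" if ij: "j \<in> I" "i \<in> I" for i j
  proof -
    obtain k where "k \<in> I" "0 < N j k i"
      using trans[OF ij(2,1)] by blast
    then show ?thesis
      unfolding A_def using fin nonneg ij by (intro sum_pos2[of _ k]) auto
  qed
  have ne: "I \<noteq> {}"
    using e by blast
  obtain r f where f: "\<And>i. i \<in> I \<Longrightarrow> 0 < f i" "\<And>j. j \<in> I \<Longrightarrow> (\<Sum>i\<in>I. A j i * f i) = r * f j"
    using perron_frobenius[OF fin ne, of A, OF A] by auto
  have eig: "\<exists>c. \<forall>j\<in>I. (\<Sum>i\<in>I. N b j i * f i) = c * f j" if b: "b \<in> I" for b
  proof (rule perron_frobenius_unique[OF fin ne, where A = A and v = f and r = r, OF A f])
    fix j assume j: "j \<in> I"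
    \<comment> \<open>With s the sum of the basis and f extended additively, the left side is f(b (j
      s)); associativity turns it into f((b j) s) = r f(b j).\<close>
    have "(\<Sum>i\<in>I. A j i * (\<Sum>m\<in>I. N b i m * f m)) = (\<Sum>i\<in>I. \<Sum>k\<in>I. \<Sum>m\<in>I. N j k i * N b i m * f m)"
      by (simp add: A_def sum_distrib_left sum_distrib_right mult.assoc)
        (subst sum.swap, rule refl)
    also have "\<dots> = (\<Sum>k\<in>I. \<Sum>m\<in>I. (\<Sum>i\<in>I. N j k i * N b i m) * f m)"
      by (subst sum.swap, rule sum.cong[OF refl], subst sum.swap) (simp add: sum_distrib_right)
    also have "\<dots> = (\<Sum>k\<in>I. \<Sum>m\<in>I. (\<Sum>l\<in>I. N b j l * N l k m) * f m)"
      using assoc b j by (intro sum.cong refl) simp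
    also have "\<dots> = (\<Sum>k\<in>I. \<Sum>m\<in>I. \<Sum>l\<in>I. N b j l * N l k m * f m)"
      by (simp add: sum_distrib_right)
    also have "\<dots> = (\<Sum>l\<in>I. \<Sum>k\<in>I. \<Sum>m\<in>I. N b j l * N l k m * f m)"
    proof -
      have "(\<Sum>k\<in>I. \<Sum>m\<in>I. \<Sum>l\<in>I. N b j l * N l k m * f m) = (\<Sum>k\<in>I. \<Sum>l\<in>I. \<Sum>m\<in>I. N b j l * N l k m * f m)"
        by (rule sum.cong[OF refl], rule sum.swap)
      also have "\<dots> = (\<Sum>l\<in>I. \<Sum>k\<in>I. \<Sum>m\<in>I. N b j l * N l k m * f m)"
        by (rule sum.swap)
      finally show ?thesis .
    qed
    also have "\<dots> = (\<Sum>l\<in>I. N b j l * (\<Sum>m\<in>I. A l m * f m))"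
    proof (intro sum.cong refl)
      fix l
      have "(\<Sum>k\<in>I. \<Sum>m\<in>I. N b j l * N l k m * f m) = (\<Sum>m\<in>I. \<Sum>k\<in>I. N b j l * N l k m * f m)"
        by (rule sum.swap)
      then show "(\<Sum>k\<in>I. \<Sum>m\<in>I. N b j l * N l k m * f m) = N b j l * (\<Sum>m\<in>I. A l m * f m)"
        by (simp add: A_def sum_distrib_left sum_distrib_right mult.assoc)
    qed
    also have "\<dots> = r * (\<Sum>i\<in>I. N b j i * f i)"
      using f(2) by (simp add: sum_distrib_left mult.left_commute)
    finally show "(\<Sum>i\<in>I. A j i * (\<Sum>m\<in>I. N b i m * f m)) = r * (\<Sum>m\<in>I. N b j m * f m)" .
  qed
  \<comment> \<open>Dividing by \<open>f e\<close> normalizes the functional at the unit. Evaluating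
    the eigenvector equation of i at e then shows that its scalar is \<open>f i / f e\<close>, which
    is multiplicativity.\<close>
  show ?thesis
  proof (intro exI[of _ "\<lambda>i. f i / f e"] conjI ballI)
    show "0 < f i / f e" if "i \<in> I" for i
      using f(1) e that by simp
    show "f e / f e = 1"
      using f(1)[OF e] by simp
    fix i j assume ij: "i \<in> I" "j \<in> I"
    obtain c where c: "\<And>j. j \<in> I \<Longrightarrow> (\<Sum>k\<in>I. N i j k * f k) = c * f j"
      using eig[OF ij(1)] by blast
    have "(\<Sum>k\<in>I. N i e k * f k) = (\<Sum>k\<in>I. if k = i then f k else 0)"
      using unit ij by (intro sum.cong) auto
    then have "f i = c * f e"
      using c[OF e] fin ij by simp
    then show "(\<Sum>k\<in>I. N i j k * (f k / f e)) = f i / f e * (f j / f e)"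
      using c[OF ij(2)] f(1)[OF e] by (simp flip: sum_divide_distrib)
  qed
qed

section \<open>Growth and Frobenius--Perron dimension\<close>

text \<open>Constant factors vanish under n-th roots, since \<open>root n c\<close> tends to 1 for
  positive c. The bounds make the sequence converge, so the limit superior is a limit.\<close>

lemma limsup_root_sandwich:
  fixes G :: "nat \<Rightarrow> real"
  assumes c: "0 < c" and c': "0 < c'" and D: "0 \<le> D"
    and le: "\<And>n. c * D ^ n \<le> G n" "\<And>n. G n \<le> c' * D ^ n"
  shows "limsup (\<lambda>n. ereal (root n (G n))) = ereal D"
proof -
  have r: "root n (x * D ^ n) = root n x * D" if "n > 0" for n x
    using that D by (simp add: real_root_mult real_root_power_cancel)
  have lim: "(\<lambda>n. root n x * D) \<longlonglongrightarrow> D" if "0 < x" for x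
    using tendsto_mult[OF LIMSEQ_root_const[OF that] tendsto_const[of D]] by simp
  have "(\<lambda>n. root n (G n)) \<longlonglongrightarrow> D"
  proof (rule tendsto_sandwich[OF _ _ lim[OF c] lim[OF c']])
    show "\<forall>\<^sub>F n in sequentially. root n c * D \<le> root n (G n)"
      using eventually_gt_at_top[of 0] by eventually_elim (simp add: r[symmetric] le)
    show "\<forall>\<^sub>F n in sequentially. root n (G n) \<le> root n c' * D"
      using eventually_gt_at_top[of 0] by eventually_elim (simp add: r[symmetric] le)
  qed
  then show ?thesis
    by (intro lim_imp_Limsup) (simp_all add: tendsto_ereal)
qed

lemma (in zbasis) co_mult_basis:
  assumes "x \<in> carrier R" "k \<in> B" "b \<in> B"
  shows "co (x \<otimes> k) b = (\<Sum>a\<in>B. co x a * co (a \<otimes> k) b)" "co (k \<otimes> x) b = (\<Sum>a\<in>B. co x a * co (k \<otimes> a) b)"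
proof -
  have "co (x \<otimes> k) b = (\<Sum>a\<in>B. \<Sum>a'\<in>B. if k = a' then co x a * co (a \<otimes> a') b else 0)"
    using assms basisD by (simp add: co_mult co_basis if_distrib[of "\<lambda>z. _ * z * _"] cong: if_cong)
  then show "co (x \<otimes> k) b = (\<Sum>a\<in>B. co x a * co (a \<otimes> k) b)"
    using assms(2) finite_basis by simp
  have "co (k \<otimes> x) b = (\<Sum>a\<in>B. \<Sum>a'\<in>B. if k = a then co x a' * co (a \<otimes> a') b else 0)"
    using assms basisD by (simp add: co_mult co_basis if_distrib[of "\<lambda>z. z * _ * _"] cong: if_cong)
  also have "\<dots> = (\<Sum>a'\<in>B. \<Sum>a\<in>B. if k = a then co x a' * co (a \<otimes> a') b else 0)"
    by (rule sum.swap)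
  finally show "co (k \<otimes> x) b = (\<Sum>a\<in>B. co x a * co (k \<otimes> a) b)"
    using assms(2) finite_basis by simp
qed

text \<open>Eigenvalues are detected by a determinant, which transposition does not change. The
  character is a left eigenvector, whereas the definition asks for right ones.\<close>

lemma eigenvalue_of_left_eigenvector:
  fixes M :: "complex mat"
  assumes M: "M \<in> carrier_mat n n" and d: "d \<in> carrier_vec n" "d \<noteq> 0\<^sub>v n" and eq: "transpose_mat M *\<^sub>v d = t \<cdot>\<^sub>v d"
  shows "eigenvalue M t"
proof -
  have "eigenvalue (transpose_mat M) t"
    using assms unfolding eigenvalue_def eigenvector_def by (intro exI[of _ d]) auto
  then have "det (char_matrix (transpose_mat M) t) = 0"
    using eigenvalue_det[of "transpose_mat M" n t] M by simp
  moreover have "char_matrix (transpose_mat M) t = transpose_mat (char_matrix M t)"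
    using M unfolding char_matrix_def by (intro eq_matI) auto
  moreover have "char_matrix M t \<in> carrier_mat n n"
    using M by simp
  ultimately show ?thesis
    using eigenvalue_det[OF M, of t] det_transpose[of "char_matrix M t" n] by simp
qed

lemma finite_eigenvalues: "M \<in> carrier_mat n n \<Longrightarrow> finite {t. eigenvalue (M :: complex mat) t}"
  using poly_roots_finite[of "char_poly M"] eigenvalue_root_char_poly[of M n] degree_monic_char_poly[of M n] by fastforce

text \<open>
  A positive left eigenvector of a non-negative matrix bounds every eigenvalue by its own:
  pair \<open>\<bar>M v\<bar> \<le> M \<bar>v\<bar>\<close> with it.
\<close>

lemma Max_eigenvalue_nonneg_matrix:
  fixes m :: "nat \<Rightarrow> nat \<Rightarrow> real" and d :: "nat \<Rightarrow> real"
  assumes n: "0 < n" and m: "\<And>i j. i < n \<Longrightarrow> j < n \<Longrightarrow> 0 \<le> m i j" and d: "\<And>i. i < n \<Longrightarrow> 0 < d i" and r: "0 \<le> r"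
    and eq: "\<And>j. j < n \<Longrightarrow> (\<Sum>i<n. m i j * d i) = r * d j"
  shows "Max {t::real. 0 \<le> t \<and> eigenvalue (mat n n (\<lambda>(i, j). complex_of_real (m i j))) (complex_of_real t)} = r"
proof (rule Max_eqI)
  let ?M = "mat n n (\<lambda>(i, j). complex_of_real (m i j))"
  have M: "?M \<in> carrier_mat n n"
    by simp
  show "finite {t::real. 0 \<le> t \<and> eigenvalue ?M (complex_of_real t)}"
    by (rule finite_subset[OF _ finite_vimageI[OF finite_eigenvalues[OF M] inj_of_real]]) auto
  have "eigenvalue ?M (complex_of_real r)"
  proof (rule eigenvalue_of_left_eigenvector[OF M])
    let ?d = "vec n (\<lambda>i. complex_of_real (d i))"
    show "?d \<in> carrier_vec n"
      by simp
    show "?d \<noteq> 0\<^sub>v n"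
    proof
      assume "?d = 0\<^sub>v n"
      then have "?d $ 0 = 0\<^sub>v n $ 0"
        by simp
      then show False
        using n d[OF n] by simp
    qed
    show "transpose_mat ?M *\<^sub>v ?d = complex_of_real r \<cdot>\<^sub>v ?d"
    proof (rule eq_vecI)
      fix j assume "j < dim_vec (complex_of_real r \<cdot>\<^sub>v ?d)"
      then have j: "j < n"
        by simp
      have "(transpose_mat ?M *\<^sub>v ?d) $ j = (\<Sum>i<n. complex_of_real (m i j) * complex_of_real (d i))"
        using j by (simp add: scalar_prod_def atLeast0LessThan)
      also have "\<dots> = complex_of_real (r * d j)"
        by (simp flip: eq[OF j])
      finally show "(transpose_mat ?M *\<^sub>v ?d) $ j = (complex_of_real r \<cdot>\<^sub>v ?d) $ j"
        using j by simp
    qed simp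
  qed
  then show "r \<in> {t. 0 \<le> t \<and> eigenvalue ?M (complex_of_real t)}"
    using r by simp
  fix t assume "t \<in> {t::real. 0 \<le> t \<and> eigenvalue ?M (complex_of_real t)}"
  then obtain v where t: "0 \<le> t" and v: "v \<in> carrier_vec n" "v \<noteq> 0\<^sub>v n" and ev: "?M *\<^sub>v v = complex_of_real t \<cdot>\<^sub>v v"
    unfolding eigenvalue_def eigenvector_def by auto
  have le: "t * norm (v $ i) \<le> (\<Sum>j<n. m i j * norm (v $ j))" if i: "i < n" for i
  proof -
    have "complex_of_real t * v $ i = (?M *\<^sub>v v) $ i"
      using i v unfolding ev by simp
    also have "\<dots> = (\<Sum>j<n. complex_of_real (m i j) * v $ j)"
      using i v by (simp add: scalar_prod_def atLeast0LessThan)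
    finally have "norm (complex_of_real t * v $ i) = norm (\<Sum>j<n. complex_of_real (m i j) * v $ j)"
      by simp
    then show ?thesis
      using t m[OF i] norm_sum[of "\<lambda>j. complex_of_real (m i j) * v $ j" "{..<n}"] by (simp add: norm_mult)
  qed
  obtain k where k: "k < n" "v $ k \<noteq> 0"
    using v by (metis carrier_vecD eq_vecI index_zero_vec)
  define s where "s = (\<Sum>i<n. d i * norm (v $ i))"
  have "0 < s"
    unfolding s_def using k d by (intro sum_pos2[of _ k]) (auto simp: less_imp_le)
  have "t * s = (\<Sum>i<n. d i * (t * norm (v $ i)))"
    by (simp add: s_def sum_distrib_left mult.left_commute)
  also have "\<dots> \<le> (\<Sum>i<n. d i * (\<Sum>j<n. m i j * norm (v $ j)))"
    using le d by (intro sum_mono mult_left_mono) (auto simp: less_imp_le)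
  also have "\<dots> = (\<Sum>j<n. (\<Sum>i<n. m i j * d i) * norm (v $ j))"
    by (simp add: sum_distrib_left sum_distrib_right mult.commute mult.left_commute) (rule sum.swap)
  also have "\<dots> = r * s"
    by (simp add: eq s_def sum_distrib_left mult.assoc)
  finally show "t \<le> r"
    using \<open>0 < s\<close> by simp
qed

section \<open>Transitivity and the character outside the largest representation ideal\<close>

locale max_rep_ideal_hopf_algebra = finite_type_hopf_algebra H
  for H :: "('k::field, 'h::ring_1) hopf" (structure) +
  assumes P_plus_eq: "P_plus H = I_max H"
begin

abbreviation core_basis :: "('k, 'h) green set" where
  "core_basis \<equiv> indec_basis H - X_max H"

lemma X_max_subset: "X_max H \<subseteq> indec_basis H"
  using rep_ideal_X_max by (auto simp: spans_rep_ideal_def)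

lemma I_max_ideal: "ideal (zspan (green_ring H) (X_max H)) (green_ring H)"
  using rep_ideal_X_max by (auto simp: spans_rep_ideal_def)

lemma finite_core_basis: "finite core_basis"
  using finite_indec_basis by simp

lemma core_basisD: "b \<in> core_basis \<Longrightarrow> b \<in> indec_basis H"
  by simp

lemma one_core_basis: "\<one>\<^bsub>green_ring H\<^esub> \<in> core_basis"
  using one_basis one_not_in_rep_ideal[OF rep_ideal_X_max] by simp

lemma co_ideal:
  assumes "a \<in> X_max H" "x \<in> carrier (green_ring H)" "b \<in> core_basis"
  shows "green_co (a \<otimes>\<^bsub>green_ring H\<^esub> x) b = 0" "green_co (x \<otimes>\<^bsub>green_ring H\<^esub> a) b = 0"
proof -
  have "a \<in> zspan (green_ring H) (X_max H)"
    using assms(1) X_max_subset zspan_basis_iff[OF X_max_subset] by blast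
  then have "a \<otimes>\<^bsub>green_ring H\<^esub> x \<in> zspan (green_ring H) (X_max H)" "x \<otimes>\<^bsub>green_ring H\<^esub> a \<in> zspan (green_ring H) (X_max H)"
    using ideal.I_r_closed[OF I_max_ideal] ideal.I_l_closed[OF I_max_ideal] assms(2) by blast+
  then show "green_co (a \<otimes>\<^bsub>green_ring H\<^esub> x) b = 0" "green_co (x \<otimes>\<^bsub>green_ring H\<^esub> a) b = 0"
    using assms(3) zspan_iff[OF X_max_subset] by blast+
qed

text \<open>Gives the structure constants of the quotient without leaving the Green ring: a basis
  element of \<open>X_max\<close> contributes nothing to coordinates outside
  \<open>X_max\<close>.\<close>

lemma co_mult_core:
  assumes "x \<in> carrier (green_ring H)" "k \<in> indec_basis H" "b \<in> core_basis"
  shows "green_co (x \<otimes>\<^bsub>green_ring H\<^esub> k) b = (\<Sum>a\<in>core_basis. green_co x a * green_co (a \<otimes>\<^bsub>green_ring H\<^esub> k) b)"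
    "green_co (k \<otimes>\<^bsub>green_ring H\<^esub> x) b = (\<Sum>a\<in>core_basis. green_co x a * green_co (k \<otimes>\<^bsub>green_ring H\<^esub> a) b)"
  unfolding co_mult_basis[OF assms(1,2) core_basisD[OF assms(3)]]
  using assms co_ideal basisD finite_indec_basis
  by (auto intro!: sum.mono_neutral_right)

text \<open>Here \<open>P_plus H = I_max H\<close> enters: a basis element outside
  \<open>X_max\<close> is not among those spanning \<open>P_plus H\<close>, so the coefficient is
  nonzero, and it is non-negative as duals and products have non-negative coordinates.\<close>

lemma dual_coeff_pos:
  assumes "b \<in> core_basis"
  shows "0 < green_co (b \<otimes>\<^bsub>green_ring H\<^esub> green_dual H b) \<one>\<^bsub>green_ring H\<^esub>"
proof -
  let ?R = "green_ring H"
  let ?Y = "{b \<in> indec_basis H. green_coeff H (b \<otimes>\<^bsub>?R\<^esub> green_dual H b) \<one>\<^bsub>?R\<^esub> = 0}"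
  have b: "b \<in> indec_basis H" "b \<notin> X_max H"
    using assms by auto
  have cl: "b \<otimes>\<^bsub>?R\<^esub> green_dual H b \<in> carrier ?R"
    using b(1) basisD green_dual_basis(1) by blast
  have "b \<notin> zspan ?R ?Y"
    using zspan_basis_iff[OF X_max_subset b(1)] b(2) P_plus_eq by (simp add: P_plus_def I_max_def)
  then have "b \<notin> ?Y"
    using zspan_basis_iff[of ?Y b] b(1) by blast
  then have "green_co (b \<otimes>\<^bsub>?R\<^esub> green_dual H b) \<one>\<^bsub>?R\<^esub> \<noteq> 0"
    using b(1) green_coeff_eq[OF cl one_basis] by simp
  moreover have "0 \<le> green_co (b \<otimes>\<^bsub>?R\<^esub> green_dual H b) \<one>\<^bsub>?R\<^esub>"
    unfolding co_mult_basis(2)[OF green_dual_basis(1)[OF b(1)] b(1) one_basis]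
    using b(1) by (intro sum_nonneg mult_nonneg_nonneg green_dual_basis(2) basis_mult_nonneg one_basis)
  ultimately show ?thesis
    by simp
qed

text \<open>\<open>x\<^sub>i\<close> occurs in \<open>(x\<^sub>j x\<^sub>j\<^sup>*) x\<^sub>i = x\<^sub>j (x\<^sub>j\<^sup>* x\<^sub>i)\<close>, as the unit occurs in \<open>x\<^sub>j x\<^sub>j\<^sup>*\<close>.\<close>

lemma core_transitive:
  assumes i: "i \<in> core_basis" and j: "j \<in> core_basis"
  shows "\<exists>k\<in>core_basis. 0 < green_co (j \<otimes>\<^bsub>green_ring H\<^esub> k) i"
proof (rule ccontr)
  let ?R = "green_ring H"
  let ?y = "j \<otimes>\<^bsub>?R\<^esub> green_dual H j"
  assume no: "\<not> (\<exists>k\<in>core_basis. 0 < green_co (j \<otimes>\<^bsub>?R\<^esub> k) i)"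
  have B: "i \<in> indec_basis H" "j \<in> indec_basis H"
    using i j by auto
  note cl = basisD[OF B(1)] basisD[OF B(2)] green_dual_basis(1)[OF B(2)]
  have z: "green_co (j \<otimes>\<^bsub>?R\<^esub> k) i = 0" if "k \<in> core_basis" for k
    using no that basis_mult_nonneg[OF B(2) core_basisD[OF that] B(1)] by force
  have nonneg: "0 \<le> green_co ?y a" if "a \<in> indec_basis H" for a
    unfolding co_mult_basis(2)[OF cl(3) B(2) that]
    using B(2) that by (intro sum_nonneg mult_nonneg_nonneg green_dual_basis(2) basis_mult_nonneg)
  have "green_co ?y \<one>\<^bsub>?R\<^esub> = green_co ?y \<one>\<^bsub>?R\<^esub> * green_co (\<one>\<^bsub>?R\<^esub> \<otimes>\<^bsub>?R\<^esub> i) i"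
    using cl B by (simp add: co_basis)
  \<comment> \<open>All terms of the expansion of \<open>?y\<close> times i are non-negative, so
    keeping only the term of the unit gives a lower bound. Reassociated, the same product has
    coordinate 0 at i by assumption.\<close>
  also have "\<dots> \<le> (\<Sum>a\<in>indec_basis H. green_co ?y a * green_co (a \<otimes>\<^bsub>?R\<^esub> i) i)"
    using nonneg basis_mult_nonneg B
    by (intro member_le_sum[of _ _ "\<lambda>a. green_co ?y a * green_co (a \<otimes>\<^bsub>?R\<^esub> i) i"] one_basis finite_indec_basis) simp
  also have "\<dots> = green_co (?y \<otimes>\<^bsub>?R\<^esub> i) i"
    using cl by (intro co_mult_basis(1)[symmetric] B) simp
  also have "?y \<otimes>\<^bsub>?R\<^esub> i = j \<otimes>\<^bsub>?R\<^esub> (green_dual H j \<otimes>\<^bsub>?R\<^esub> i)"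
    using cl by (intro green.m_assoc)
  also have "green_co \<dots> i = 0"
    using cl z by (subst co_mult_core(2)[OF _ B(2) i]) simp_all
  finally show False
    using dual_coeff_pos[OF j] by simp
qed

lemma core_char_exists: "\<exists>d. (\<forall>i\<in>core_basis. 0 < d i) \<and> d \<one>\<^bsub>green_ring H\<^esub> = 1 \<and>
     (\<forall>i\<in>core_basis. \<forall>j\<in>core_basis. (\<Sum>k\<in>core_basis. real_of_int (green_co (i \<otimes>\<^bsub>green_ring H\<^esub> j) k) * d k) = d i * d j)"
proof (rule based_ring_character[OF finite_core_basis one_core_basis, where N = "\<lambda>i j k. real_of_int (green_co (i \<otimes>\<^bsub>green_ring H\<^esub> j) k)"])
  fix i j k m assume ijk: "i \<in> core_basis" "j \<in> core_basis" "k \<in> core_basis"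
  note B = ijk[THEN core_basisD]
  show "0 \<le> real_of_int (green_co (i \<otimes>\<^bsub>green_ring H\<^esub> j) k)"
    using basis_mult_nonneg[OF B] by simp
  assume m: "m \<in> core_basis"
  have "green_co (i \<otimes>\<^bsub>green_ring H\<^esub> j \<otimes>\<^bsub>green_ring H\<^esub> k) m = green_co (i \<otimes>\<^bsub>green_ring H\<^esub> (j \<otimes>\<^bsub>green_ring H\<^esub> k)) m"
    using B[THEN basisD] by (simp add: green.m_assoc)
  then have "(\<Sum>l\<in>core_basis. green_co (i \<otimes>\<^bsub>green_ring H\<^esub> j) l * green_co (l \<otimes>\<^bsub>green_ring H\<^esub> k) m) =
      (\<Sum>l\<in>core_basis. green_co (j \<otimes>\<^bsub>green_ring H\<^esub> k) l * green_co (i \<otimes>\<^bsub>green_ring H\<^esub> l) m)"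
    using B[THEN basisD] m by (simp add: co_mult_core(1)[OF _ B(3)] co_mult_core(2)[OF _ B(1)])
  then show "(\<Sum>l\<in>core_basis. real_of_int (green_co (i \<otimes>\<^bsub>green_ring H\<^esub> j) l) * real_of_int (green_co (l \<otimes>\<^bsub>green_ring H\<^esub> k) m)) =
      (\<Sum>l\<in>core_basis. real_of_int (green_co (j \<otimes>\<^bsub>green_ring H\<^esub> k) l) * real_of_int (green_co (i \<otimes>\<^bsub>green_ring H\<^esub> l) m))"
    by (simp flip: of_int_mult of_int_sum)
next
  fix i k assume "i \<in> core_basis" "k \<in> core_basis"
  then show "real_of_int (green_co (i \<otimes>\<^bsub>green_ring H\<^esub> \<one>\<^bsub>green_ring H\<^esub>) k) = (if k = i then 1 else 0)"
    using basisD by (simp add: co_basis)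
next
  fix i j assume "i \<in> core_basis" "j \<in> core_basis"
  then show "\<exists>k\<in>core_basis. 0 < real_of_int (green_co (j \<otimes>\<^bsub>green_ring H\<^esub> k) i)"
    using core_transitive by simp
qed

definition core_char :: "('k, 'h) green \<Rightarrow> real" where
  "core_char = (SOME d. (\<forall>i\<in>core_basis. 0 < d i) \<and> d \<one>\<^bsub>green_ring H\<^esub> = 1 \<and>
     (\<forall>i\<in>core_basis. \<forall>j\<in>core_basis. (\<Sum>k\<in>core_basis. real_of_int (green_co (i \<otimes>\<^bsub>green_ring H\<^esub> j) k) * d k) = d i * d j))"

lemma core_char_pos: "b \<in> core_basis \<Longrightarrow> 0 < core_char b"
  and core_char_one: "core_char \<one>\<^bsub>green_ring H\<^esub> = 1"
  and core_char_mult: "i \<in> core_basis \<Longrightarrow> j \<in> core_basis \<Longrightarrow>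
    (\<Sum>k\<in>core_basis. real_of_int (green_co (i \<otimes>\<^bsub>green_ring H\<^esub> j) k) * core_char k) = core_char i * core_char j"
  using someI_ex[OF core_char_exists, folded core_char_def] by blast+

text \<open>The character of the quotient pulled back to the Green ring: coordinates in
  \<open>X_max\<close> are ignored, so powers and their growth can be studied before
  reduction.\<close>

definition FP :: "('k, 'h) green \<Rightarrow> real" where
  "FP x = (\<Sum>b\<in>core_basis. real_of_int (green_co x b) * core_char b)"

lemma FP_add: "x \<in> carrier (green_ring H) \<Longrightarrow> y \<in> carrier (green_ring H) \<Longrightarrow> FP (x \<oplus>\<^bsub>green_ring H\<^esub> y) = FP x + FP y"
  by (simp add: FP_def co_add distrib_right sum.distrib)

lemma FP_one: "FP \<one>\<^bsub>green_ring H\<^esub> = 1"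
proof -
  have "FP \<one>\<^bsub>green_ring H\<^esub> = (\<Sum>b\<in>core_basis. if \<one>\<^bsub>green_ring H\<^esub> = b then core_char b else 0)"
    unfolding FP_def by (rule sum.cong[OF refl]) (simp add: co_basis one_basis)
  then show ?thesis
    using one_core_basis finite_core_basis by (simp add: core_char_one)
qed

text \<open>Products with a factor in \<open>X_max\<close> have no coordinates outside
  \<open>X_max\<close>. Only structure constants among \<open>core_basis\<close> remain, and on
  these \<open>core_char\<close> is multiplicative.\<close>

lemma FP_mult:
  assumes x: "x \<in> carrier (green_ring H)" and y: "y \<in> carrier (green_ring H)"
  shows "FP (x \<otimes>\<^bsub>green_ring H\<^esub> y) = FP x * FP y"
proof -
  let ?R = "green_ring H" and ?B = core_basis
  have co: "green_co (x \<otimes>\<^bsub>?R\<^esub> y) b = (\<Sum>a\<in>?B. \<Sum>a'\<in>?B. green_co x a * green_co y a' * green_co (a \<otimes>\<^bsub>?R\<^esub> a') b)"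
    if b: "b \<in> ?B" for b
  proof -
    have "green_co (x \<otimes>\<^bsub>?R\<^esub> y) b = (\<Sum>a\<in>indec_basis H. \<Sum>a'\<in>indec_basis H. green_co x a * green_co y a' * green_co (a \<otimes>\<^bsub>?R\<^esub> a') b)"
      by (rule co_mult[OF x y core_basisD[OF b]])
    also have "\<dots> = (\<Sum>a\<in>?B. \<Sum>a'\<in>indec_basis H. green_co x a * green_co y a' * green_co (a \<otimes>\<^bsub>?R\<^esub> a') b)"
      using finite_indec_basis co_ideal(1)[OF _ _ b] basisD by (intro sum.mono_neutral_right) auto
    also have "\<dots> = (\<Sum>a\<in>?B. \<Sum>a'\<in>?B. green_co x a * green_co y a' * green_co (a \<otimes>\<^bsub>?R\<^esub> a') b)"
      using finite_indec_basis co_ideal(2)[OF _ _ b] basisD by (intro sum.cong refl sum.mono_neutral_right) auto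
    finally show ?thesis .
  qed
  have "FP (x \<otimes>\<^bsub>?R\<^esub> y) = (\<Sum>b\<in>?B. \<Sum>a\<in>?B. \<Sum>a'\<in>?B. green_co x a * green_co y a' * (green_co (a \<otimes>\<^bsub>?R\<^esub> a') b * core_char b))"
    unfolding FP_def by (rule sum.cong[OF refl]) (simp add: co sum_distrib_right mult.assoc)
  also have "\<dots> = (\<Sum>a\<in>?B. \<Sum>b\<in>?B. \<Sum>a'\<in>?B. green_co x a * green_co y a' * (green_co (a \<otimes>\<^bsub>?R\<^esub> a') b * core_char b))"
    by (rule sum.swap)
  also have "\<dots> = (\<Sum>a\<in>?B. \<Sum>a'\<in>?B. \<Sum>b\<in>?B. green_co x a * green_co y a' * (green_co (a \<otimes>\<^bsub>?R\<^esub> a') b * core_char b))"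
    by (rule sum.cong[OF refl], rule sum.swap)
  also have "\<dots> = (\<Sum>a\<in>?B. \<Sum>a'\<in>?B. green_co x a * green_co y a' * (core_char a * core_char a'))"
    by (intro sum.cong refl) (simp add: core_char_mult flip: sum_distrib_left)
  also have "\<dots> = FP x * FP y"
    by (simp add: FP_def sum_product mult_ac)
  finally show ?thesis .
qed

lemma FP_pow: "x \<in> carrier (green_ring H) \<Longrightarrow> FP (x [^]\<^bsub>green_ring H\<^esub> (n::nat)) = FP x ^ n"
  by (induction n) (simp_all add: FP_one FP_mult green.nat_pow_Suc mult.commute)

section \<open>Non-negative elements, dimension and growth\<close>

lemma green_nonneg_iff: "x \<in> green_nonneg H \<longleftrightarrow> x \<in> carrier (green_ring H) \<and> (\<forall>b\<in>indec_basis H. 0 \<le> green_co x b)"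
  by (auto simp: green_nonneg_def green_coeff_eq)

lemma green_nonneg_add: "x \<in> green_nonneg H \<Longrightarrow> y \<in> green_nonneg H \<Longrightarrow> x \<oplus>\<^bsub>green_ring H\<^esub> y \<in> green_nonneg H"
  by (simp add: green_nonneg_iff co_add)

lemma green_nonneg_mult: "x \<in> green_nonneg H \<Longrightarrow> y \<in> green_nonneg H \<Longrightarrow> x \<otimes>\<^bsub>green_ring H\<^esub> y \<in> green_nonneg H"
  by (auto simp: green_nonneg_iff co_mult basis_mult_nonneg intro!: sum_nonneg)

lemma green_nonneg_pow: "x \<in> green_nonneg H \<Longrightarrow> x [^]\<^bsub>green_ring H\<^esub> (n::nat) \<in> green_nonneg H"
  by (induction n) (auto simp: green_nonneg_mult green_nonneg_iff[of "\<one>\<^bsub>green_ring H\<^esub>"] co_basis one_basis)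

lemma green_dim_add:
  "x \<in> carrier (green_ring H) \<Longrightarrow> y \<in> carrier (green_ring H) \<Longrightarrow> green_dim (x \<oplus>\<^bsub>green_ring H\<^esub> y) = green_dim x + green_dim y"
  by (simp add: green_dim_eq green_lift_add additive_invariant_dim)

lemma green_dim_zero: "green_dim \<zero>\<^bsub>green_ring H\<^esub> = 0"
  using green_dim_add[of "\<zero>\<^bsub>green_ring H\<^esub>" "\<zero>\<^bsub>green_ring H\<^esub>"] by simp

text \<open>Both sides are additive in x, so the indecomposable classes suffice. It reduces the
  dimension of a core to a weighted sum of coordinates, which can be compared with
  \<open>FP\<close>.\<close>

lemma green_dim_expansion:
  assumes "x \<in> carrier (green_ring H)"
  shows "green_dim x = (\<Sum>b\<in>indec_basis H. green_co x b * green_dim b)"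
  using assms
proof (induction rule: green_ring_induct)
  case (indecomposable M)
  let ?b = "green_class H M"
  have b: "?b \<in> indec_basis H"
    using indecomposable by (simp add: indec_basis_def)
  then have "(\<Sum>b\<in>indec_basis H. green_co ?b b * green_dim b) = (\<Sum>b\<in>indec_basis H. if ?b = b then green_dim b else 0)"
    by (intro sum.cong) (auto simp: co_basis)
  then show ?case
    using b finite_indec_basis by simp
next
  case (add x y)
  then show ?case
    by (simp add: green_dim_add co_add distrib_right sum.distrib)
next
  case (minus x)
  then show ?case
    using green_dim_add[of x "\<ominus>\<^bsub>green_ring H\<^esub> x"] by (simp add: green.r_neg green_dim_zero co_minus sum_negf)
qed (simp add: green_dim_zero co_zero)

lemma green_dim_pos:
  assumes "b \<in> indec_basis H"
  shows "0 < green_dim b"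
proof -
  obtain M where M: "M \<in> indecomposables H" "b = green_class H M"
    using assms unfolding indec_basis_def by (elim imageE)
  then show ?thesis
    using indecomposablesD[OF M(1)] by (simp add: green_dim_eq green_class_closed green_lift_class additive_invariant_dim)
qed

lemma green_dim_core_max:
  assumes x: "x \<in> carrier (green_ring H)"
  shows "green_dim (core_max H x) = (\<Sum>b\<in>core_basis. green_co x b * green_dim b)"
proof -
  let ?A = "{b \<in> core_basis. green_coeff H x b \<noteq> 0}"
  have A: "?A \<subseteq> indec_basis H"
    by auto
  have c: "green_co (core_max H x) b = (if b \<in> core_basis then green_co x b else 0)" if "b \<in> indec_basis H" for b
    unfolding core_max_def co_combination[OF A that] using that green_coeff_eq[OF x that] by auto
  have cl: "core_max H x \<in> carrier (green_ring H)"
    unfolding core_max_def using basisD int_multiple_closed by (intro green.finsum_closed) auto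
  have "green_dim (core_max H x) = (\<Sum>b\<in>indec_basis H. green_co (core_max H x) b * green_dim b)"
    by (rule green_dim_expansion[OF cl])
  also have "\<dots> = (\<Sum>b\<in>core_basis. green_co x b * green_dim b)"
    using finite_indec_basis by (intro sum.mono_neutral_cong_right) (auto simp: c)
  finally show ?thesis .
qed

lemma gamma_max_eq_FP:
  assumes x: "x \<in> green_nonneg H"
  shows "gamma_max H x = ereal (FP x)"
proof -
  let ?R = "green_ring H"
  \<comment> \<open>Each constant dominates every one of its summands: c bounds dimension by
    character through the ratios, and c' bounds the character by the dimension because dimensions of
    indecomposables are at least 1.\<close>
  define c where "c = (\<Sum>b\<in>core_basis. real_of_int (green_dim b) / core_char b)"
  define c' where "c' = (\<Sum>b\<in>core_basis. core_char b)"
  have dpos: "0 < real_of_int (green_dim b)" if "b \<in> core_basis" for b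
    using green_dim_pos[OF core_basisD[OF that]] by simp
  have pos: "0 < c" "0 < c'"
    unfolding c_def c'_def using finite_core_basis one_core_basis core_char_pos dpos by (auto intro!: sum_pos)
  have le: "real_of_int (green_dim b) \<le> c * core_char b" "core_char b \<le> c' * real_of_int (green_dim b)" if b: "b \<in> core_basis" for b
  proof -
    have "real_of_int (green_dim b) / core_char b \<le> c"
      unfolding c_def using b finite_core_basis core_char_pos dpos
      by (intro member_le_sum[of _ _ "\<lambda>b. real_of_int (green_dim b) / core_char b"]) (auto simp: less_imp_le)
    then show "real_of_int (green_dim b) \<le> c * core_char b"
      using core_char_pos[OF b] by (simp add: pos_divide_le_eq)
    have "core_char b \<le> c'"
      unfolding c'_def using b finite_core_basis core_char_pos by (intro member_le_sum) (auto simp: less_imp_le)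
    also have "c' \<le> c' * real_of_int (green_dim b)"
      using pos(2) green_dim_pos[OF core_basisD[OF b]] by simp
    finally show "core_char b \<le> c' * real_of_int (green_dim b)" .
  qed
  have carr: "y \<in> carrier ?R" and nonneg: "\<And>b. b \<in> core_basis \<Longrightarrow> 0 \<le> real_of_int (green_co y b)" if "y \<in> green_nonneg H" for y
    using that by (auto simp: green_nonneg_iff)
  let ?G = "\<lambda>y. real_of_int (green_dim (core_max H y))"
  have upper: "?G y \<le> c * FP y" if y: "y \<in> green_nonneg H" for y
  proof -
    have "?G y = (\<Sum>b\<in>core_basis. real_of_int (green_co y b) * real_of_int (green_dim b))"
      by (simp add: green_dim_core_max[OF carr[OF y]])
    also have "\<dots> \<le> (\<Sum>b\<in>core_basis. real_of_int (green_co y b) * (c * core_char b))"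
      by (intro sum_mono mult_left_mono le nonneg[OF y])
    finally show ?thesis
      by (simp add: FP_def sum_distrib_left mult.left_commute)
  qed
  have lower: "FP y \<le> c' * ?G y" if y: "y \<in> green_nonneg H" for y
  proof -
    have "FP y \<le> (\<Sum>b\<in>core_basis. real_of_int (green_co y b) * (c' * real_of_int (green_dim b)))"
      unfolding FP_def by (intro sum_mono mult_left_mono le nonneg[OF y])
    then show ?thesis
      by (simp add: green_dim_core_max[OF carr[OF y]] sum_distrib_left mult.left_commute)
  qed
  have FP0: "0 \<le> FP x"
    unfolding FP_def using nonneg[OF x] core_char_pos by (intro sum_nonneg mult_nonneg_nonneg) (auto simp: less_imp_le)
  show ?thesis
    unfolding gamma_max_def
  proof (rule limsup_root_sandwich[of "1 / c'" c, OF _ pos(1) FP0])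
    fix n :: nat
    have n: "x [^]\<^bsub>?R\<^esub> n \<in> green_nonneg H"
      by (rule green_nonneg_pow[OF x])
    show "1 / c' * FP x ^ n \<le> ?G (x [^]\<^bsub>?R\<^esub> n)"
      using lower[OF n] pos(2) by (simp add: FP_pow[OF carr[OF x]] pos_divide_le_eq mult.commute)
    show "?G (x [^]\<^bsub>?R\<^esub> n) \<le> c * FP x ^ n"
      using upper[OF n] by (simp add: FP_pow[OF carr[OF x]])
  qed (use pos in simp)
qed

section \<open>Comparison with the Frobenius--Perron dimension of the quotient\<close>

abbreviation qmap :: "('k, 'h) green \<Rightarrow> ('k, 'h) green set" where
  "qmap \<equiv> to_R_max H"

abbreviation qco :: "('k, 'h) green set \<Rightarrow> ('k, 'h) green set \<Rightarrow> int" where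
  "qco \<equiv> quot_co (X_max H)"

lemma qmap_eq: "qmap x = zspan (green_ring H) (X_max H) +>\<^bsub>green_ring H\<^esub> x"
  by (simp add: to_R_max_def I_max_def)

lemma R_max_zbasis: "zbasis (R_max H) (R_max_basis H) qco"
  using quot_zbasis[OF X_max_subset I_max_ideal]
  by (simp add: R_max_def R_max_basis_def I_max_def to_R_max_def[abs_def])

lemma qco_eq: "x \<in> carrier (green_ring H) \<Longrightarrow> b \<in> core_basis \<Longrightarrow> qco (qmap x) (qmap b) = green_co x b"
  unfolding qmap_eq by (rule quot_co_eq[OF X_max_subset I_max_ideal])

lemma qmap_inj: "inj_on qmap core_basis"
  using quot_map_inj[OF X_max_subset I_max_ideal] by (simp add: qmap_eq[abs_def])

lemma qmap_closed: "x \<in> carrier (green_ring H) \<Longrightarrow> qmap x \<in> carrier (R_max H)"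
  using ring_hom_closed[OF ideal.rcos_ring_hom[OF I_max_ideal]] by (simp add: qmap_eq R_max_def I_max_def)

lemma qmap_mult:
  "x \<in> carrier (green_ring H) \<Longrightarrow> y \<in> carrier (green_ring H) \<Longrightarrow> qmap x \<otimes>\<^bsub>R_max H\<^esub> qmap y = qmap (x \<otimes>\<^bsub>green_ring H\<^esub> y)"
  using ring_hom_mult[OF ideal.rcos_ring_hom[OF I_max_ideal]] by (simp add: qmap_eq R_max_def I_max_def)

lemma lookup_zcoords_R_max:
  "x \<in> carrier (green_ring H) \<Longrightarrow> b \<in> core_basis \<Longrightarrow>
    Poly_Mapping.lookup (zcoords (R_max H) (R_max_basis H) (qmap x)) (qmap b) = green_co x b"
  using zbasis.lookup_zcoords[OF R_max_zbasis qmap_closed] by (simp add: qco_eq R_max_basis_def)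

text \<open>Column j of the matrix holds the coordinates of b times the j-th basis element.
  Multiplicativity of \<open>core_char\<close> therefore makes it a left eigenvector with eigenvalue
  \<open>core_char b\<close>, and its positivity singles this out as the largest non-negative
  eigenvalue.\<close>

lemma FPdim_basis_eq:
  assumes b: "b \<in> core_basis"
  shows "FPdim_basis H (qmap b) = core_char b"
proof -
  let ?bs = "R_max_basis_list H"
  have "\<exists>bs. distinct bs \<and> set bs = R_max_basis H"
    using finite_distinct_list[of "R_max_basis H"] finite_core_basis by (auto simp: R_max_basis_def)
  then have bs: "distinct ?bs" "set ?bs = R_max_basis H"
    unfolding R_max_basis_list_def by (metis (mono_tags, lifting) someI_ex)+
  let ?n = "length ?bs"
  \<comment> \<open>The basis list consists of cosets in an arbitrary order; u returns the unique
    basis element outside \<open>X_max\<close> in such a coset, which makes list positions an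
    indexing of \<open>core_basis\<close>.\<close>
  define u where "u = the_inv_into core_basis qmap"
  have u: "u (?bs ! i) \<in> core_basis" "qmap (u (?bs ! i)) = ?bs ! i" if "i < ?n" for i
  proof -
    have "?bs ! i \<in> qmap ` core_basis"
      using that bs(2) nth_mem by (fastforce simp: R_max_basis_def)
    then show "u (?bs ! i) \<in> core_basis" "qmap (u (?bs ! i)) = ?bs ! i"
      unfolding u_def using qmap_inj by (auto simp: the_inv_into_f_f f_the_inv_into_f)
  qed
  have bij: "bij_betw (\<lambda>i. u (?bs ! i)) {..<?n} core_basis"
  proof -
    have "bij_betw ((!) ?bs) {..<?n} (qmap ` core_basis)"
      using bij_betw_nth[OF bs(1), of "{..<?n}" "qmap ` core_basis"] bs(2) by (simp add: R_max_basis_def)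
    moreover have "bij_betw u (qmap ` core_basis) core_basis"
      unfolding u_def using qmap_inj by (intro bij_betw_the_inv_into inj_on_imp_bij_betw)
    ultimately show ?thesis
      using bij_betw_trans[of "(!) ?bs" "{..<?n}" _ u] by (simp add: comp_def)
  qed
  have n: "0 < ?n"
    using bij one_core_basis by (auto simp: bij_betw_def)
  define m where "m i j = real_of_int (green_co (b \<otimes>\<^bsub>green_ring H\<^esub> u (?bs ! j)) (u (?bs ! i)))" for i j
  have "left_mult_mat (R_max H) ?bs (qmap b) = mat ?n ?n (\<lambda>(i, j). complex_of_real (m i j))"
  proof (rule eq_matI)
    fix i j assume "i < dim_row (mat ?n ?n (\<lambda>(i, j). complex_of_real (m i j)))" "j < dim_col (mat ?n ?n (\<lambda>(i, j). complex_of_real (m i j)))"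
    then have ij: "i < ?n" "j < ?n"
      by simp_all
    have "qmap b \<otimes>\<^bsub>R_max H\<^esub> ?bs ! j = qmap (b \<otimes>\<^bsub>green_ring H\<^esub> u (?bs ! j))"
      using qmap_mult[of b "u (?bs ! j)"] u[OF ij(2)] b basisD by simp
    moreover have "b \<otimes>\<^bsub>green_ring H\<^esub> u (?bs ! j) \<in> carrier (green_ring H)"
      using u(1)[OF ij(2)] b basisD by simp
    ultimately show "left_mult_mat (R_max H) ?bs (qmap b) $$ (i, j) = mat ?n ?n (\<lambda>(i, j). complex_of_real (m i j)) $$ (i, j)"
      using ij lookup_zcoords_R_max[of "b \<otimes>\<^bsub>green_ring H\<^esub> u (?bs ! j)" "u (?bs ! i)"] u[OF ij(1)]
      by (simp add: left_mult_mat_def bs(2) m_def)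
  qed (simp_all add: left_mult_mat_def)
  moreover have "Max {t::real. 0 \<le> t \<and> eigenvalue (mat ?n ?n (\<lambda>(i, j). complex_of_real (m i j))) (complex_of_real t)} = core_char b"
  proof (rule Max_eigenvalue_nonneg_matrix[OF n, where d = "\<lambda>i. core_char (u (?bs ! i))"])
    fix i j assume ij: "i < ?n" "j < ?n"
    show "0 \<le> m i j"
      unfolding m_def using basis_mult_nonneg u(1)[OF ij(1)] u(1)[OF ij(2)] b by simp
  next
    fix j assume j: "j < ?n"
    have "(\<Sum>i<?n. m i j * core_char (u (?bs ! i))) =
        (\<Sum>k\<in>core_basis. real_of_int (green_co (b \<otimes>\<^bsub>green_ring H\<^esub> u (?bs ! j)) k) * core_char k)"
      unfolding m_def by (rule sum.reindex_bij_betw[OF bij])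
    then show "(\<Sum>i<?n. m i j * core_char (u (?bs ! i))) = core_char b * core_char (u (?bs ! j))"
      using core_char_mult[OF b u(1)[OF j]] by simp
  qed (use core_char_pos u b in \<open>auto simp: less_imp_le\<close>)
  ultimately show ?thesis
    by (simp add: FPdim_basis_def)
qed

lemma FPdim_RC_max_eq:
  assumes x: "x \<in> carrier (green_ring H)"
  shows "FPdim_RC_max H (to_RC_max H (qmap x)) = complex_of_real (FP x)"
proof -
  let ?z = "zcoords (R_max H) (R_max_basis H) (qmap x)"
  let ?v = "to_RC_max H (qmap x)"
  have l: "Poly_Mapping.lookup ?v c = complex_of_int (Poly_Mapping.lookup ?z c)" for c
    by (simp add: to_RC_max_def Poly_Mapping.map.rep_eq when_def)
  have k: "Poly_Mapping.keys ?v \<subseteq> qmap ` core_basis"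
    using zbasis.lookup_zcoords[OF R_max_zbasis qmap_closed[OF x]] by (auto simp: in_keys_iff l R_max_basis_def split: if_splits)
  have "FPdim_RC_max H ?v = (\<Sum>c\<in>qmap ` core_basis. Poly_Mapping.lookup ?v c * complex_of_real (FPdim_basis H c))"
    unfolding FPdim_RC_max_def using k finite_core_basis by (intro sum.mono_neutral_left) (auto simp: in_keys_iff)
  also have "\<dots> = (\<Sum>b\<in>core_basis. Poly_Mapping.lookup ?v (qmap b) * complex_of_real (FPdim_basis H (qmap b)))"
    by (simp add: sum.reindex[OF qmap_inj])
  also have "\<dots> = complex_of_real (FP x)"
    by (simp add: FP_def l lookup_zcoords_R_max[OF x] FPdim_basis_eq)
  finally show ?thesis .
qed

end

theorem theorem4p2:
  fixes H :: "('k::alg_closed_field, 'h::ring_1) hopf"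
    and x y :: "('k, 'h) green"
  assumes "hopf_algebra H"
    and "finite_dim_algebra H"
    and "\<not> semisimple_algebra H"
    and "finite_rep_type H"
    and "P_plus H = I_max H"
    and "P_minus H = I_max H"
    and "x \<in> green_nonneg H"
    and "y \<in> green_nonneg H"
  shows "(\<exists>r::real. gamma_max H x = ereal r \<and>
            FPdim_RC_max H (to_RC_max H (to_R_max H x)) = complex_of_real r) \<and>
         gamma_max H (x \<otimes>\<^bsub>green_ring H\<^esub> y) = gamma_max H x * gamma_max H y \<and>
         gamma_max H (x \<oplus>\<^bsub>green_ring H\<^esub> y) = gamma_max H x + gamma_max H y"
proof -
  interpret hopf_algebra H
    by (rule assms(1))
  interpret max_rep_ideal_hopf_algebra H
    using assms(4,5) by unfold_locales
  note x = assms(7) and y = assms(8)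
  have xy: "x \<in> carrier (green_ring H)" "y \<in> carrier (green_ring H)"
    using x y by (auto simp: green_nonneg_iff)
  \<comment> \<open>Sums and products of non-negative elements are non-negative, so
    \<open>gamma_max_eq_FP\<close> applies to x, y, their product and their sum, and both identities
    become those of \<open>FP\<close>.\<close>
  show ?thesis
    using FPdim_RC_max_eq[OF xy(1)]
    by (simp add: gamma_max_eq_FP x y green_nonneg_mult green_nonneg_add FP_mult FP_add xy)
qed

end
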